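(* There is an algorithm that, given a Maker-Breaker poset positional game $(X,\mathcal{F},P)$ in which $P$ consists of $w$ pairwise disjoint chains each of height at most $h$ and every winning set has size at most $2$, decides which player has a winning strategy when Maker starts, in time $O(h^{2(w+1)})$.
   Context: A poset positional game is a triple $(X,\mathcal{F},P)$ with $X$ a finite board of vertices, $\mathcal{F}\subseteq 2^X$ the winning sets, and $P$ a partial order on $X$. Two players alternately claim an unclaimed vertex $v$ such that all vertices smaller than $v$ in $P$ are already claimed, until all vertices are claimed. In the Maker-Breaker convention, Maker wins if she claims all vertices of some winning set; otherwise Breaker wins. A poset made of pairwise disjoint chains has its ground set partitioned into chains with elements of distinct chains incomparable; the height of a chain is its number of elements. *)

theory Defs
  imports Complex_Main "HOL-Library.Disjoint_Sets" "HOL-Library.Landau_Symbols"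
begin

section \<open>Poset positional games, Maker-Breaker convention\<close>

text \<open>A pair \<open>(u, v)\<close> in \<open>P\<close> means \<open>u \<le> v\<close>.\<close>

definition poset_game :: "'a set \<Rightarrow> 'a set set \<Rightarrow> 'a rel \<Rightarrow> bool" where
  "poset_game X F P \<longleftrightarrow> finite X \<and> F \<subseteq> Pow X \<and> partial_order_on X P"

text \<open>The vertices that may be claimed next when \<open>C\<close> is the set of claimed vertices.\<close>

definition available :: "'a set \<Rightarrow> 'a rel \<Rightarrow> 'a set \<Rightarrow> 'a set" where
  "available X P C = {v \<in> X - C. \<forall>u\<in>X. (u, v) \<in> P \<and> u \<noteq> v \<longrightarrow> u \<in> C}"

text \<open>
  A play is the list of the vertices claimed so far, in chronological order. Maker starts, so the
  moves with even index are hers and those with odd index are Breaker's.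
\<close>

definition is_play :: "'a set \<Rightarrow> 'a rel \<Rightarrow> 'a list \<Rightarrow> bool" where
  "is_play X P p \<longleftrightarrow> (\<forall>i<length p. p ! i \<in> available X P (set (take i p)))"

definition complete_play :: "'a set \<Rightarrow> 'a rel \<Rightarrow> 'a list \<Rightarrow> bool" where
  "complete_play X P p \<longleftrightarrow> is_play X P p \<and> set p = X"

datatype player = Maker | Breaker

definition turn :: "nat \<Rightarrow> player" where
  "turn i = (if even i then Maker else Breaker)"

definition claimed_by :: "player \<Rightarrow> 'a list \<Rightarrow> 'a set" where
  "claimed_by q p = {p ! i | i. i < length p \<and> turn i = q}"

definition wins_play :: "'a set set \<Rightarrow> player \<Rightarrow> 'a list \<Rightarrow> bool" where
  "wins_play F q p \<longleftrightarrow>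
     (case q of
        Maker \<Rightarrow> \<exists>S\<in>F. S \<subseteq> claimed_by Maker p
      | Breaker \<Rightarrow> \<not> (\<exists>S\<in>F. S \<subseteq> claimed_by Maker p))"

text \<open>A strategy maps the play so far to the next vertex to claim.\<close>

definition follows :: "player \<Rightarrow> ('a list \<Rightarrow> 'a) \<Rightarrow> 'a list \<Rightarrow> bool" where
  "follows q \<sigma> p \<longleftrightarrow> (\<forall>i<length p. turn i = q \<longrightarrow> p ! i = \<sigma> (take i p))"

text \<open>
  The first conjunct says that the strategy prescribes a legal move whenever it is consulted;
  without it the second one could hold because no complete play follows the strategy.
\<close>

definition winning_strategy ::
    "'a set \<Rightarrow> 'a set set \<Rightarrow> 'a rel \<Rightarrow> player \<Rightarrow> ('a list \<Rightarrow> 'a) \<Rightarrow> bool" where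
  "winning_strategy X F P q \<sigma> \<longleftrightarrow>
     (\<forall>p. is_play X P p \<and> set p \<noteq> X \<and> turn (length p) = q \<and> follows q \<sigma> p
            \<longrightarrow> \<sigma> p \<in> available X P (set p)) \<and>
     (\<forall>p. complete_play X P p \<and> follows q \<sigma> p \<longrightarrow> wins_play F q p)"

definition has_winning_strategy ::
    "'a set \<Rightarrow> 'a set set \<Rightarrow> 'a rel \<Rightarrow> player \<Rightarrow> bool" where
  "has_winning_strategy X F P q \<longleftrightarrow> (\<exists>\<sigma>. winning_strategy X F P q \<sigma>)"

definition disjoint_chains :: "nat \<Rightarrow> nat \<Rightarrow> 'a set \<Rightarrow> 'a rel \<Rightarrow> bool" where
  "disjoint_chains w h X P \<longleftrightarrow>
     (\<exists>\<C>. partition_on X \<C> \<and> finite \<C> \<and> card \<C> = w \<and>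
          (\<forall>C\<in>\<C>. total_on C P \<and> card C \<le> h) \<and>
          (\<forall>C\<in>\<C>. \<forall>D\<in>\<C>. C \<noteq> D \<longrightarrow> (\<forall>u\<in>C. \<forall>v\<in>D. (u, v) \<notin> P)))"

section \<open>Random access machines with unit cost\<close>

text \<open>
  Registers (addressed directly by the program) and memory cells (addressed indirectly, through
  the content of a register) hold natural numbers. The only arithmetic is addition and truncated
  subtraction: with multiplication, unit-cost machines would be unreasonably powerful.
  The machine halts when the program counter leaves the program.
\<close>

datatype instr =
    Const nat nat           \<comment> \<open>\<open>Const d c\<close>: \<open>r\<^sub>d := c\<close>\<close>
  | Add nat nat nat         \<comment> \<open>\<open>Add d a b\<close>: \<open>r\<^sub>d := r\<^sub>a + r\<^sub>b\<close>\<close>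
  | Sub nat nat nat         \<comment> \<open>\<open>Sub d a b\<close>: \<open>r\<^sub>d := max 0 (r\<^sub>a - r\<^sub>b)\<close>\<close>
  | Load nat nat            \<comment> \<open>\<open>Load d a\<close>: \<open>r\<^sub>d := mem[r\<^sub>a]\<close>\<close>
  | Store nat nat           \<comment> \<open>\<open>Store a b\<close>: \<open>mem[r\<^sub>a] := r\<^sub>b\<close>\<close>
  | JumpZero nat nat        \<comment> \<open>\<open>JumpZero a l\<close>: \<open>if r\<^sub>a = 0 then goto l\<close>\<close>

datatype config = Config (pc: nat) (reg: "nat \<Rightarrow> nat") (mem: "nat \<Rightarrow> nat")

fun exec_instr :: "instr \<Rightarrow> config \<Rightarrow> config" where
  "exec_instr (Const d c) (Config i r m) = Config (Suc i) (r(d := c)) m"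
| "exec_instr (Add d a b) (Config i r m) = Config (Suc i) (r(d := r a + r b)) m"
| "exec_instr (Sub d a b) (Config i r m) = Config (Suc i) (r(d := r a - r b)) m"
| "exec_instr (Load d a) (Config i r m) = Config (Suc i) (r(d := m (r a))) m"
| "exec_instr (Store a b) (Config i r m) = Config (Suc i) r (m(r a := r b))"
| "exec_instr (JumpZero a l) (Config i r m) = Config (if r a = 0 then l else Suc i) r m"

definition halted :: "instr list \<Rightarrow> config \<Rightarrow> bool" where
  "halted prog s \<longleftrightarrow> length prog \<le> pc s"

definition step :: "instr list \<Rightarrow> config \<Rightarrow> config" where
  "step prog s = (if halted prog s then s else exec_instr (prog ! pc s) s)"

text \<open>The input is placed in the first memory cells; everything else is initially zero.\<close>

definition init_config :: "nat list \<Rightarrow> config" where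
  "init_config inp = Config 0 (\<lambda>_. 0) (\<lambda>i. if i < length inp then inp ! i else 0)"

text \<open>On input \<open>inp\<close>, \<open>prog\<close> halts after at most \<open>t\<close> instructions with \<open>out\<close> in register 0.\<close>

definition computes_within :: "instr list \<Rightarrow> nat list \<Rightarrow> nat \<Rightarrow> nat \<Rightarrow> bool" where
  "computes_within prog inp out t \<longleftrightarrow>
     (\<exists>k\<le>t. let s = (step prog ^^ k) (init_config inp) in halted prog s \<and> reg s 0 = out)"

section \<open>Games as inputs\<close>

text \<open>
  The vertices are numbered by an arbitrary enumeration \<open>vs\<close> of the board. The input consists of
  the numbers of vertices, of winning sets and of pairs of the order, followed by the winning sets
  (each preceded by its size) and by the pairs of the order, both listed in arbitrary order without
  repetition. The chains and the parameters \<open>w\<close> and \<open>h\<close> are not part of the input.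
\<close>

definition encodes_game ::
    "nat list \<Rightarrow> 'a set \<Rightarrow> 'a set set \<Rightarrow> 'a rel \<Rightarrow> bool" where
  "encodes_game inp X F P \<longleftrightarrow>
     (\<exists>(vs :: 'a list) (Fs :: nat list list) (Ps :: (nat \<times> nat) list).
        distinct vs \<and> set vs = X \<and>
        (\<forall>S\<in>set Fs. distinct S \<and> set S \<subseteq> {..<length vs}) \<and>
        distinct (map set Fs) \<and> F = (\<lambda>S. (!) vs ` set S) ` set Fs \<and>
        distinct Ps \<and> set Ps \<subseteq> {..<length vs} \<times> {..<length vs} \<and>
        P = map_prod ((!) vs) ((!) vs) ` set Ps \<and>
        inp = [length vs, length Fs, length Ps]
              @ concat (map (\<lambda>S. length S # S) Fs)
              @ concat (map (\<lambda>(i, j). [i, j]) Ps))"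

fun player_code :: "player \<Rightarrow> nat" where
  "player_code Maker = 1"
| "player_code Breaker = 0"

end

(*
  Once Maker has claimed x, every vertex y with {x, y} a winning set is marked: claiming it wins.
  Vertices are told apart by the parity of the number k of vertices above them in their chain,
  compared with the parity of the number of unclaimed vertices when Maker is to move, which is
  invariant. If k has the wrong parity and the vertex is marked, then Maker wins by waiting: it is
  Breaker who will have to claim its predecessor. If y is marked with the right parity, then the
  part of the chain from the predecessor of y on can be split off, because Maker may leave it for
  last and will then own every second vertex of it. Hence all marks above y are irrelevant, and a
  position is determined by the number of unclaimed vertices and by the lowest mark of each chain:
  there are at most (h + 1)^(2 w) positions, and each is evaluated in time O(h^2), by scanning the
  winning sets for each of the at most w^2 pairs of a move and a reply.

  The machine program is the compilation of a program all of whose loops have bounds fixed in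
  advance, so that its running time is bounded by a syntactic induction.
*)

theory Submission
  imports Defs
begin

section \<open>The game on chains\<close>

text \<open>Splitting off a part of chain \<open>A\<close> at a mark \<open>(A, y)\<close> needs a
  richer game than the given one. The part consists of the \<open>y + 2\<close> vertices
  \<open>(A, 0)\<close>, ..., \<open>(A, y + 1)\<close>. Breaker cannot open it, since claiming
  \<open>(A, y + 1)\<close> hands Maker the mark; if \<open>y + 2\<close> is odd, it therefore gives
  Maker a spare move. Hence \<open>V\<close> carries lower ends \<open>lb\<close> of the chains and
  an optional pass \<open>q\<close>.

  The vertices of the part that Maker counts on have neighbours too. An edge between two of them
  wins outright (\<open>V0_bad_edge\<close>), other neighbours are treated as marked from the start
  (\<open>truncation_marks\<close>), and for odd \<open>y\<close> an edge to another chain already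
  wins by itself (\<open>V0_cross\<close>).

  The truncated game is only a means of comparison and is never evaluated: losing it with the
  smaller set of marks refutes the larger set in the full game, and winning it wins the full game
  with the smaller set.\<close>

definition lower :: "(nat \<Rightarrow> nat) \<Rightarrow> nat \<Rightarrow> nat \<Rightarrow> nat" where
  "lower r c = r(c := r c - 1)"

section \<open>Positions of the chain game, its truncated variants, monotonicity in the
  marks\<close>

locale chain_game =
  fixes w :: nat and adj :: "nat \<times> nat \<Rightarrow> nat \<times> nat \<Rightarrow> bool"
  assumes adj_sym: "adj x y \<Longrightarrow> adj y x"
    and adj_irrefl: "\<not> adj x x"
begin

definition tot :: "(nat \<Rightarrow> nat) \<Rightarrow> nat" where
  "tot r = sum r {..<w}"

definition open_chains :: "(nat \<Rightarrow> nat) \<Rightarrow> (nat \<Rightarrow> nat) \<Rightarrow> nat set" where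
  "open_chains lb r = {c. c < w \<and> lb c < r c}"

lemma tot_lower: "c < w \<Longrightarrow> 0 < r c \<Longrightarrow> Suc (tot (lower r c)) = tot r"
  unfolding tot_def lower_def
  by (subst (1 2) sum.remove[of _ c]) auto

lemma tot_upd: "c < w \<Longrightarrow> tot (r(c := x)) + r c = tot r + x"
  unfolding tot_def
  by (subst (1 2) sum.remove[of _ c]) (auto intro!: sum.cong)

lemma tot_single: "c < w \<Longrightarrow> (\<And>e. e < w \<Longrightarrow> e \<noteq> c \<Longrightarrow> r e = 0) \<Longrightarrow> tot r = r c"
  unfolding tot_def by (subst sum.remove[of _ c]) auto

lemma tot_pair: "c < w \<Longrightarrow> d < w \<Longrightarrow> c \<noteq> d \<Longrightarrow> (\<And>e. e < w \<Longrightarrow> e \<noteq> c \<Longrightarrow> e \<noteq> d \<Longrightarrow> r e = 0) \<Longrightarrow> tot r = r c + r d"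
  unfolding tot_def by (subst sum.remove[of _ c], simp, simp, subst sum.remove[of _ d]) auto

lemma lower_apply: "lower r c e = (if e = c then r c - 1 else r e)"
  by (simp add: lower_def)

lemma open_chainsD: "c \<in> open_chains lb r \<Longrightarrow> c < w \<and> lb c < r c"
  by (simp add: open_chains_def)

text \<open>
  The vertex \<open>(c, k)\<close> is the one of chain \<open>c\<close> with \<open>k\<close> vertices above it; it is unclaimed iff
  \<open>k < r c\<close>. Maker is to move and wins by claiming a vertex of \<open>K\<close>. Chain \<open>c\<close> is played only down
  to \<open>k = lb c\<close>. If \<open>q = Some A\<close>, then Maker may pass once, but only after chain \<open>A\<close> has been
  played.
\<close>

function V :: "(nat \<Rightarrow> nat) \<Rightarrow> nat option \<Rightarrow> (nat \<Rightarrow> nat) \<Rightarrow> (nat \<times> nat) set \<Rightarrow> bool" where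
  "V lb q r K \<longleftrightarrow>
     (\<exists>c\<in>open_chains lb r. (c, r c - 1) \<in> K \<or>
        open_chains lb (lower r c) \<noteq> {} \<and>
        (\<forall>d\<in>open_chains lb (lower r c).
           V lb q (lower (lower r c) d) (K \<union> Collect (adj (c, r c - 1))))) \<or>
     (\<exists>A\<in>set_option q. r A = lb A \<and> open_chains lb r \<noteq> {} \<and>
        (\<forall>d\<in>open_chains lb r. V lb None (lower r d) K))"
  by pat_completeness auto
termination
proof (relation "measure (\<lambda>(lb, q, r, K). tot r)", goal_cases)
  case (2 lb q r K c d)
  then show ?case
    using tot_lower[of c r] tot_lower[of d "lower r c"] by (auto dest!: open_chainsD)
next
  case (3 lb q r K A d)
  then show ?case
    using tot_lower[of d r] by (auto dest!: open_chainsD)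
qed auto

declare V.simps [simp del]

text \<open>The position with Breaker to move. The first conjunct matters on an exhausted board,
  where the universal condition is vacuous although Maker has not won.\<close>

definition VB :: "(nat \<Rightarrow> nat) \<Rightarrow> nat option \<Rightarrow> (nat \<Rightarrow> nat) \<Rightarrow> (nat \<times> nat) set \<Rightarrow> bool" where
  "VB lb q r K \<longleftrightarrow> open_chains lb r \<noteq> {} \<and> (\<forall>d\<in>open_chains lb r. V lb q (lower r d) K)"

lemma V_iff:
  "V lb q r K \<longleftrightarrow>
     (\<exists>c\<in>open_chains lb r. (c, r c - 1) \<in> K \<or>
        VB lb q (lower r c) (K \<union> Collect (adj (c, r c - 1)))) \<or>
     (\<exists>A. q = Some A \<and> r A = lb A \<and> VB lb None r K)"
  by (subst V.simps) (auto simp: VB_def)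

text \<open>Restricting the hypothesis to unclaimed vertices with \<open>lb c \<le> k\<close> gives
  more than monotonicity: marks on claimed vertices, or in the closed part of a chain, can be
  discarded by the same lemma.\<close>

lemma V_mono:
  assumes "\<And>c k. c < w \<Longrightarrow> lb c \<le> k \<Longrightarrow> k < r c \<Longrightarrow> (c, k) \<in> K \<Longrightarrow> (c, k) \<in> K'"
    and "V lb q r K"
  shows "V lb q r K'"
  using assms
proof (induction lb q r K arbitrary: K' rule: V.induct)
  case (1 lb q r K)
  have low: "\<And>r c e. lower r c e \<le> r e" by (simp add: lower_apply)
  from \<open>V lb q r K\<close>[unfolded V_iff[of lb q r K]] show ?case
  proof (elim disjE bexE exE conjE)
    fix c assume c: "c \<in> open_chains lb r" and m: "(c, r c - 1) \<in> K"
    then have "(c, r c - 1) \<in> K'" using "1.prems"(1)[of c "r c - 1"] by (auto dest!: open_chainsD)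
    then show ?thesis using c by (subst V_iff) auto
  next
    fix c assume c: "c \<in> open_chains lb r"
      and v: "VB lb q (lower r c) (K \<union> Collect (adj (c, r c - 1)))"
    have "VB lb q (lower r c) (K' \<union> Collect (adj (c, r c - 1)))"
      unfolding VB_def
    proof (intro conjI ballI)
      show "open_chains lb (lower r c) \<noteq> {}" using v by (simp add: VB_def)
      fix d assume d: "d \<in> open_chains lb (lower r c)"
      show "V lb q (lower (lower r c) d) (K' \<union> Collect (adj (c, r c - 1)))"
      proof (rule "1.IH"(1)[OF c d])
        show "V lb q (lower (lower r c) d) (K \<union> Collect (adj (c, r c - 1)))"
          using v d by (simp add: VB_def)
        fix c' k assume "c' < w" "lb c' \<le> k" "k < lower (lower r c) d c'"
          "(c', k) \<in> K \<union> Collect (adj (c, r c - 1))"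
        then show "(c', k) \<in> K' \<union> Collect (adj (c, r c - 1))"
          using "1.prems"(1)[of c' k] low[of "lower r c" d c'] low[of r c c'] by auto
      qed
    qed
    then show ?thesis using c by (subst V_iff) auto
  next
    fix A assume A: "q = Some A" "r A = lb A" "VB lb None r K"
    have "VB lb None r K'"
      unfolding VB_def
    proof (intro conjI ballI)
      show "open_chains lb r \<noteq> {}" using A by (simp add: VB_def)
      fix d assume d: "d \<in> open_chains lb r"
      have *: "V lb None (lower r d) K" using A(3) d by (simp add: VB_def)
      show "V lb None (lower r d) K'"
        by (rule "1.IH"(2)[of A d K', OF _ d _ *]) 
           (use A "1.prems"(1) low[of r d] in \<open>auto intro: less_le_trans\<close>)
    qed
    then show ?thesis using A by (subst V_iff) auto
  qed
qed

lemma VB_mono: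
  assumes "\<And>c k. c < w \<Longrightarrow> lb c \<le> k \<Longrightarrow> k < r c \<Longrightarrow> (c, k) \<in> K \<Longrightarrow> (c, k) \<in> K'"
    and "VB lb q r K"
  shows "VB lb q r K'"
  unfolding VB_def
proof (intro conjI ballI)
  show "open_chains lb r \<noteq> {}" using assms(2) by (simp add: VB_def)
  fix d assume d: "d \<in> open_chains lb r"
  show "V lb q (lower r d) K'"
    by (rule V_mono[where K = K]) (use assms d in \<open>auto simp: VB_def lower_apply split: if_splits\<close>)
qed

section \<open>Wins by waiting: wrong parity, edges inside a chain, edges between chains\<close>

abbreviation V0 :: "(nat \<Rightarrow> nat) \<Rightarrow> (nat \<times> nat) set \<Rightarrow> bool" where
  "V0 \<equiv> V (\<lambda>_. 0) None"

abbreviation VB0 :: "(nat \<Rightarrow> nat) \<Rightarrow> (nat \<times> nat) set \<Rightarrow> bool" where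
  "VB0 \<equiv> VB (\<lambda>_. 0) None"

lemma V0_top: "c < w \<Longrightarrow> 0 < r c \<Longrightarrow> (c, r c - 1) \<in> K \<Longrightarrow> V0 r K"
  by (subst V_iff) (auto simp: open_chains_def)

lemma V0_move:
  "c < w \<Longrightarrow> 0 < r c \<Longrightarrow> VB0 (lower r c) (K \<union> Collect (adj (c, r c - 1))) \<Longrightarrow> V0 r K"
  by (subst V_iff) (auto simp: open_chains_def)

lemma VB0I:
  "a < w \<Longrightarrow> 0 < r a \<Longrightarrow> (\<And>d. d < w \<Longrightarrow> 0 < r d \<Longrightarrow> V0 (lower r d) K) \<Longrightarrow> VB0 r K"
  by (auto simp: VB_def open_chains_def)

lemma V0_cases:
  assumes "V0 r K"
  obtains c where "c < w" "0 < r c" "(c, r c - 1) \<in> K"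
  | c where "c < w" "0 < r c" "VB0 (lower r c) (K \<union> Collect (adj (c, r c - 1)))"
  using assms by (subst (asm) V_iff) (auto simp: open_chains_def)

lemma tot_lower2:
  assumes "c < w" "0 < r c" "d < w" "0 < lower r c d"
  shows "tot r = tot (lower (lower r c) d) + 2"
  using tot_lower[of c r] tot_lower[of d "lower r c"] assms by simp

text \<open>
  Maker plays elsewhere as long as she can. By parity, it is Breaker who eventually has to claim
  the predecessor of \<open>(c, k)\<close>.
\<close>

lemma V0_wait:
  assumes "c < w" "k < r c" "odd (k + tot r)"
    and "\<And>r' K'. r' c = Suc k \<Longrightarrow> (\<And>e. r' e \<le> r e) \<Longrightarrow> odd (k + tot r') \<Longrightarrow> K \<subseteq> K' \<Longrightarrow> V0 r' K'"
  shows "V0 r K"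
  using assms
proof (induction "tot r" arbitrary: r K rule: less_induct)
  case less
  show ?case
  proof (cases "r c = Suc k")
    case True
    then show ?thesis using less.prems by auto
  next
    case False
    \<comment> \<open>Every move is safe except claiming the predecessor \<open>(c, k + 1)\<close>,
      after which Breaker could claim \<open>(c, k)\<close>. Maker would be forced to do so only if
      nothing but chain \<open>c\<close> with \<open>r c = k + 2\<close> were left; then
      \<open>tot r = k + 2\<close>, against the parity hypothesis.\<close>
    obtain e where e: "e < w" "0 < r e" "e = c \<longrightarrow> k + 2 < r c"
    proof (cases "\<exists>e<w. e \<noteq> c \<and> 0 < r e")
      case False
      then have "tot r = r c" using less.prems by (intro tot_single) auto
      then have "r c \<noteq> k + 2" using less.prems by auto
      then show ?thesis using less.prems False that[of c] \<open>r c \<noteq> Suc k\<close> by auto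
    qed (use that in auto)
    show ?thesis
    proof (rule V0_move[of e r, OF e(1,2)], rule VB0I[of c])
      show "c < w" by fact
      show "0 < lower r e c" using less.prems False e by (auto simp: lower_apply)
      fix d assume d: "d < w" "0 < lower r e d"
      note t = tot_lower2[OF e(1,2) d]
      show "V0 (lower (lower r e) d) (K \<union> Collect (adj (e, r e - 1)))"
      proof (rule less.hyps)
        fix r' K' assume *: "r' c = Suc k" "\<And>ea. r' ea \<le> lower (lower r e) d ea" "odd (k + tot r')"
          "K \<union> Collect (adj (e, r e - 1)) \<subseteq> K'"
        show "V0 r' K'"
        proof (rule less.prems(4))
          fix x have "lower (lower r e) d x \<le> r x" by (simp add: lower_apply)
          then show "r' x \<le> r x" using *(2)[of x] by simp
        qed (use * in auto)
      qed (use t less.prems False e in \<open>auto simp: lower_apply\<close>)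
    qed
  qed
qed

lemma V0_bad:
  assumes "c < w" "k < r c" "odd (k + tot r)" "(c, k) \<in> K"
  shows "V0 r K"
proof (rule V0_wait[OF assms(1-3)])
  fix r' K' assume "r' c = Suc k" "K \<subseteq> K'"
  then show "V0 r' K'" using assms by (intro V0_top[of c]) auto
qed

text \<open>Waiting yields \<open>(c, k)\<close>, and claiming it marks \<open>(c, k')\<close>,
  which has the wrong parity as well. Equal parity gives \<open>k' + 2 \<le> k\<close>, so that
  Breaker's immediate reply cannot be \<open>(c, k')\<close>.\<close>

lemma V0_bad_edge:
  assumes "c < w" "k < r c" "k' < k" "odd (k + tot r)" "odd (k' + tot r)" "adj (c, k) (c, k')"
  shows "V0 r K"
proof (rule V0_wait[of c k])
  fix r' K' assume *: "r' c = Suc k" "\<And>e. r' e \<le> r e" "odd (k + tot r')" "K \<subseteq> K'"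
  show "V0 r' K'"
  proof (rule V0_move[of c], goal_cases)
    case 3
    show ?case
    proof (rule VB0I[of c], goal_cases)
      case (3 d)
      have t: "tot r' = tot (lower (lower r' c) d) + 2"
        by (rule tot_lower2) (use * 3 assms in auto)
      have "even (k + k')" using assms by auto
      then have "k' + 2 \<le> k" using assms(3) by presburger
      then show ?case
        using t * assms by (intro V0_bad[of c k']) (auto simp: lower_apply)
    qed (use * assms in \<open>auto simp: lower_apply\<close>)
  qed (use * assms in auto)
qed (use assms in auto)

text \<open>The waiting in \<open>V0_cross\<close> ends here, because playing in \<open>C\<close>
  would expose \<open>(C, kz)\<close> to Breaker. Maker runs down \<open>A\<close> instead, where
  the vertices on her turn have even \<open>k\<close>. Either she reaches \<open>(A, ku)\<close> and
  thereby marks \<open>(C, kz)\<close>, or Breaker claims the predecessor of \<open>(C, kz)\<close>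
  and she answers with \<open>(C, kz)\<close>, marking \<open>(A, ku)\<close>. Both marks have the
  wrong parity, as the total is odd.\<close>

lemma V0_cross_endgame:
  assumes "A < w" "C < w" "A \<noteq> C" "odd (r A)" "ku < r A" "even ku" "even kz" "r C = kz + 2"
    "\<And>e. e < w \<Longrightarrow> e \<noteq> A \<Longrightarrow> e \<noteq> C \<Longrightarrow> r e = 0" "adj (A, ku) (C, kz)"
  shows "V0 r K"
  using assms
proof (induction "r A" arbitrary: r K rule: less_induct)
  case less
  have t: "tot r = r A + r C" by (rule tot_pair) (use less.prems in auto)
  show ?case
  proof (rule V0_move[of A], goal_cases)
    case 3
    show ?case
    proof (rule VB0I[of C], goal_cases)
      case (3 d)
      have t2: "tot r = tot (lower (lower r A) d) + 2"
        by (rule tot_lower2) (use less.prems 3 in auto)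
      have d: "d = A \<or> d = C"
        using 3 less.prems(9)[of d] by (auto simp: lower_apply split: if_splits)
      show ?case
      proof (cases "ku = r A - 1")
        case True
        show ?thesis
          by (rule V0_bad[of C kz]) (use less.prems t t2 True d in \<open>auto simp: lower_apply\<close>)
      next
        case False
        then have ku: "ku + 3 \<le> r A" using less.prems by presburger
        show ?thesis
        proof (cases "d = A")
          case True
          show ?thesis
            by (rule less.hyps) (use less.prems ku True in \<open>auto simp: lower_apply\<close>)
        next
          case False
          then have d: "d = C" using d by simp
          let ?r = "lower (lower r A) d"
          show ?thesis
          proof (rule V0_move[of C], goal_cases)
            case 3
            show ?case
            proof (rule VB0I[of A], goal_cases)
              case (3 e)
              have t3: "tot ?r = tot (lower (lower ?r C) e) + 2"
                by (rule tot_lower2) (use less.prems 3 ku d in \<open>auto simp: lower_apply\<close>)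
              have "odd (ku + x)" if "r A + (kz + 2) = x + 2 + 2" for x
                using that less.prems(4,6,7) by presburger
              then have "odd (ku + tot (lower (lower ?r C) e))"
                using less.prems(8) t t2 t3 by simp
              then show ?case
                by (intro V0_bad[of A ku])
                   (use less.prems d ku adj_sym in \<open>auto simp: lower_apply\<close>)
            qed (use less.prems ku d in \<open>auto simp: lower_apply\<close>)
          qed (use less.prems ku d in \<open>auto simp: lower_apply\<close>)
        qed
      qed
    qed (use less.prems in \<open>auto simp: lower_apply\<close>)
  qed (use less.prems in \<open>auto simp: lower_apply\<close>)
qed

text \<open>With \<open>(A, ky)\<close> marked, Breaker loses at once by claiming
  \<open>(A, ky + 1)\<close>, and Maker avoids it too, so \<open>(A, ku)\<close> stays unclaimed
  while she waits for \<open>(C, kz)\<close>. Claiming that vertex marks \<open>(A, ku)\<close>,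
  which has the wrong parity.\<close>

lemma V0_cross:
  assumes "A < w" "C < w" "A \<noteq> C" "(A, ky) \<in> K" "odd ky" "odd (tot r)" "ku \<le> ky + 1" "even ku"
    "adj (A, ku) (C, kz)" "ky + 2 \<le> r A" "kz < r C"
  shows "V0 r K"
  using assms
proof (induction "tot r" arbitrary: r K rule: less_induct)
  case less
  show ?case
  proof (cases "r C = kz + 1")
    case True
    show ?thesis
    proof (rule V0_move[of C], goal_cases)
      case 3
      show ?case
      proof (rule VB0I[of A], goal_cases)
        case (3 d)
        have t: "tot r = tot (lower (lower r C) d) + 2"
          by (rule tot_lower2) (use less.prems 3 in auto)
        show ?case
        proof (cases "d = A \<and> r A = ky + 2")
          case True
          then show ?thesis
            by (intro V0_top[of A]) (use less.prems in \<open>auto simp: lower_apply\<close>)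
        next
          case False
          show ?thesis
            by (rule V0_bad[of A ku])
               (use less.prems t True False adj_sym in \<open>auto simp: lower_apply\<close>)
        qed
      qed (use less.prems in \<open>auto simp: lower_apply\<close>)
    qed (use less.prems in \<open>auto simp: lower_apply\<close>)
  next
    case False
    show ?thesis
    proof (cases "\<exists>e<w. 0 < r e \<and> (e = A \<longrightarrow> ky + 2 < r A) \<and> (e = C \<longrightarrow> kz + 2 < r C)")
      case True
      then obtain e where e: "e < w" "0 < r e" "e = A \<longrightarrow> ky + 2 < r A" "e = C \<longrightarrow> kz + 2 < r C"
        by blast
      show ?thesis
      proof (rule V0_move[of e r, OF e(1,2)], rule VB0I[of A], goal_cases)
        case (3 d)
        have t: "tot r = tot (lower (lower r e) d) + 2"
          by (rule tot_lower2) (use less.prems 3 e in auto)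
        show ?case
        proof (cases "d = A \<and> lower r e A = ky + 2")
          case True
          then show ?thesis
            by (intro V0_top[of A]) (use less.prems in \<open>auto simp: lower_apply\<close>)
        next
          case F: False
          have rA: "ky + 2 \<le> lower r e A" using less.prems e by (auto simp: lower_apply)
          show ?thesis
          proof (rule less.hyps)
            show "ky + 2 \<le> lower (lower r e) d A"
              using F rA lower_apply[of "lower r e" d A] by (auto split: if_splits)
          qed (use less.prems t False F e in \<open>auto simp: lower_apply\<close>)
        qed
      qed (use less.prems e in \<open>auto simp: lower_apply\<close>)
    next
      case F: False
      \<comment> \<open>No waiting move is left: only \<open>A\<close> and \<open>C\<close> are
        unfinished, and each continues with a predecessor that Maker must not claim. Since
        \<open>ky\<close> and \<open>tot r\<close> are odd, \<open>kz\<close> is even, as the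
        endgame requires.\<close>
      have rA: "r A = ky + 2" and rC: "r C = kz + 2"
        using F less.prems False by (fastforce, fastforce)
      have z: "r e = 0" if "e < w" "e \<noteq> A" "e \<noteq> C" for e using F that by auto
      have t: "tot r = r A + r C" by (rule tot_pair) (use less.prems z in auto)
      show ?thesis
        by (rule V0_cross_endgame[of A C r ku kz]) (use less.prems rA rC t z in auto)
    qed
  qed
qed


text \<open>Maker answers each move of Breaker in the even rest of chain \<open>A\<close> in that rest.\<close>

lemma V_even_rest:
  assumes "A < w" "even (r A)"
  shows "(V ((\<lambda>_. 0)(A := l)) None (r(A := l)) K \<longrightarrow> V0 r K) \<and>
         (VB ((\<lambda>_. 0)(A := l)) None (r(A := l)) K \<longrightarrow> VB0 r K)"
  using assms
proof (induction "tot r" arbitrary: r K rule: less_induct)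
  case less
  let ?lb = "(\<lambda>_. 0)(A := l)"
  have IH: "V ?lb None (r'(A := l)) K \<Longrightarrow> V0 r' K" "VB ?lb None (r'(A := l)) K \<Longrightarrow> VB0 r' K"
    if "tot r' < tot r" "even (r' A)" for r' K
    using less.hyps[OF that(1) less.prems(1) that(2)] by blast+
  have comm: "lower (r(A := l)) c = (lower r c)(A := l)" if "c \<noteq> A" for c
    using that by (auto simp: lower_def fun_eq_iff)
  show ?case
  proof (intro conjI impI)
    assume "V ?lb None (r(A := l)) K"
    then consider
      c where "c \<in> open_chains ?lb (r(A := l))" "(c, (r(A := l)) c - 1) \<in> K" |
      c where "c \<in> open_chains ?lb (r(A := l))"
        "VB ?lb None (lower (r(A := l)) c) (K \<union> Collect (adj (c, (r(A := l)) c - 1)))"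
      by (subst (asm) V_iff) auto
    then show "V0 r K"
    proof cases
      case (1 c)
      then show ?thesis by (intro V0_top[of c]) (auto simp: open_chains_def split: if_splits)
    next
      case (2 c)
      then have c: "c \<noteq> A" "c < w" "0 < r c" by (auto simp: open_chains_def split: if_splits)
      show ?thesis
      proof (rule V0_move[of c r, OF c(2,3)], rule IH(2))
        show "tot (lower r c) < tot r" using tot_lower[of c r] c by simp
        show "even (lower r c A)" using c less.prems by (simp add: lower_apply)
        show "VB ?lb None ((lower r c)(A := l)) (K \<union> Collect (adj (c, r c - 1)))"
          using 2(2) c comm by simp
      qed
    qed
  next
    assume VB: "VB ?lb None (r(A := l)) K"
    then obtain a where "a \<in> open_chains ?lb (r(A := l))" by (auto simp: VB_def)
    then have a: "a < w" "0 < r a" by (auto simp: open_chains_def split: if_splits)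
    show "VB0 r K"
    proof (rule VB0I[of a r, OF a])
      fix d assume d: "d < w" "0 < r d"
      show "V0 (lower r d) K"
      proof (cases "d = A")
        case False
        show ?thesis
          by (rule IH(1))
             (use VB d tot_lower[of d r] d False less.prems comm in
               \<open>auto simp: lower_apply VB_def open_chains_def\<close>)
      next
        case True
        have r2: "lower r A A \<noteq> 0"
          using d True less.prems by (cases "r A") (auto simp: lower_apply intro: odd_pos)
        show ?thesis unfolding True
        proof (rule V0_move[of A], goal_cases)
          case 3
          have t: "tot r = tot (lower (lower r A) A) + 2"
            by (rule tot_lower2) (use less.prems d True r2 in auto)
          show ?case
          proof (rule IH(2))
            have eq: "(lower (lower r A) A)(A := l) = r(A := l)"
              by (auto simp: lower_def fun_eq_iff)
            show "VB ?lb None ((lower (lower r A) A)(A := l))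
              (K \<union> Collect (adj (A, lower r A A - 1)))"
              unfolding eq by (rule VB_mono[OF _ VB]) auto
          qed (use t less.prems r2 in \<open>auto simp: lower_apply\<close>)
        qed (use less.prems r2 in auto)
      qed
    qed
  qed
qed

section \<open>Cutting off the upper part of a chain at a mark\<close>

lemma V0_odd_rest:
  assumes "A < w" "odd (r A)" "VB ((\<lambda>_. 0)(A := l)) None (r(A := l)) K"
  shows "V0 r K"
\<comment> \<open>Claiming the next vertex of \<open>A\<close> acts as a pass in the other chains
  and leaves an even rest.\<close>
proof (rule V0_move[of A], goal_cases)
  case 3
  have eq: "(lower r A)(A := l) = r(A := l)" by (auto simp: lower_def fun_eq_iff)
  show ?case
    by (rule V_even_rest[THEN conjunct2, THEN mp, of A _ l])
       (use assms in \<open>auto simp: eq lower_apply intro: VB_mono[OF _ assms(3)]\<close>)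
qed (use assms in \<open>auto intro: odd_pos\<close>)

text \<open>The condition \<open>odd (k + y)\<close> singles out \<open>(A, y + 1)\<close> and every
  second vertex above it. They have the wrong parity when \<open>(A, y)\<close> has the right one,
  so each of them wins as soon as it is marked; counting their neighbours as marked at once
  anticipates this.\<close>

definition truncation_marks :: "nat \<Rightarrow> nat \<Rightarrow> (nat \<times> nat) set" where
  "truncation_marks A y = {z. \<exists>k\<le>y + 1. odd (k + y) \<and> adj (A, k) z}"

definition truncation_pass :: "nat \<Rightarrow> nat \<Rightarrow> nat option" where
  "truncation_pass A y = (if odd y then Some A else None)"

text \<open>
  If \<open>(A, y)\<close> is marked, then Breaker can never claim its predecessor \<open>(A, y + 1)\<close>. Maker may as
  well postpone it, with the effect that she owns every second vertex from there on: chain \<open>A\<close> may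
  be cut below \<open>(A, y + 1)\<close>. If the number of vertices cut off is odd, then claiming them amounts
  to one pass, available to Maker once the rest of the chain has been claimed.
\<close>

lemma V0_if_truncated:
  assumes "A < w" "(A, y) \<in> K" "even (y + tot r)" "y + 2 \<le> r A"
    and "\<And>c k. odd y \<Longrightarrow> c < w \<Longrightarrow> c \<noteq> A \<Longrightarrow> k < r c \<Longrightarrow> (c, k) \<notin> truncation_marks A y"
    and "V ((\<lambda>_. 0)(A := y + 2)) (truncation_pass A y) r (K \<union> truncation_marks A y)"
  shows "V0 r K"
  using assms
proof (induction "tot r" arbitrary: r K rule: less_induct)
  case less
  let ?lb = "(\<lambda>_. 0)(A := y + 2)" and ?q = "truncation_pass A y" and ?M = "truncation_marks A y"
  \<comment> \<open>One round of the full game. If Breaker's reply is \<open>(A, y + 1)\<close>,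
    then Maker claims the marked \<open>(A, y)\<close>; hence only replies that exist in the
    truncated game have to be considered.\<close>
  have play: "V0 r K"
    if c: "c \<in> open_chains ?lb r"
      and IH: "\<And>d. d < w \<Longrightarrow> 0 < lower r c d \<Longrightarrow> d \<in> open_chains ?lb (lower r c) \<Longrightarrow>
        y + 2 \<le> lower (lower r c) d A \<Longrightarrow> tot r = tot (lower (lower r c) d) + 2 \<Longrightarrow>
        V0 (lower (lower r c) d) (K \<union> Collect (adj (c, r c - 1)))" for c
  proof -
    have cw: "c < w" "0 < r c" "c = A \<Longrightarrow> y + 2 < r A"
      using c by (auto simp: open_chains_def split: if_splits)
    have rA: "y + 2 \<le> lower r c A" using cw less.prems by (auto simp: lower_apply)
    show ?thesis
    proof (rule V0_move[of c r, OF cw(1,2)], rule VB0I[of A])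
      fix d assume d: "d < w" "0 < lower r c d"
      show "V0 (lower (lower r c) d) (K \<union> Collect (adj (c, r c - 1)))"
      proof (cases "d = A \<and> lower r c A = y + 2")
        case True
        then show ?thesis
          by (intro V0_top[of A]) (use less.prems in \<open>auto simp: lower_apply\<close>)
      next
        case False
        then show ?thesis
          using rA d
          by (intro IH tot_lower2 cw)
             (auto simp: open_chains_def lower_apply[of "lower r c" d])
      qed
    qed (use less.prems rA in auto)
  qed
  from less.prems(6)
  consider (top) c where "c \<in> open_chains ?lb r" "(c, r c - 1) \<in> K" |
    (virtual) c where "c \<in> open_chains ?lb r" "(c, r c - 1) \<in> ?M" |
    (move) c where "c \<in> open_chains ?lb r"
      "VB ?lb ?q (lower r c) (K \<union> ?M \<union> Collect (adj (c, r c - 1)))" |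
    (pass) "odd y" "r A = y + 2" "VB ?lb None r (K \<union> ?M)"
    by (subst (asm) V_iff) (auto simp: truncation_pass_def split: if_splits)
  then show ?case
  proof cases
    case top
    then show ?thesis by (intro V0_top[of c]) (auto simp: open_chains_def)
  next
    case virtual
    \<comment> \<open>The vertex is marked in the truncated game only. Claiming it marks some
      \<open>(A, k)\<close> of the wrong parity in the full game, and \<open>V0_bad\<close>
      applies.\<close>
    then obtain k where k: "k \<le> y + 1" "odd (k + y)" "adj (A, k) (c, r c - 1)"
      by (auto simp: truncation_marks_def)
    show ?thesis
    proof (rule play[OF virtual(1)])
      fix d
      assume "y + 2 \<le> lower (lower r c) d A" "tot r = tot (lower (lower r c) d) + 2"
      then show "V0 (lower (lower r c) d) (K \<union> Collect (adj (c, r c - 1)))"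
        by (intro V0_bad[of A k]) (use less.prems k adj_sym in auto)
    qed
  next
    case move
    show ?thesis
    proof (rule play[OF move(1)])
      fix d
      assume d: "y + 2 \<le> lower (lower r c) d A" "tot r = tot (lower (lower r c) d) + 2"
        "d \<in> open_chains ?lb (lower r c)"
      show "V0 (lower (lower r c) d) (K \<union> Collect (adj (c, r c - 1)))"
      proof (rule less.hyps)
        fix c' k assume "odd y" "c' < w" "c' \<noteq> A" "k < lower (lower r c) d c'"
        then show "(c', k) \<notin> ?M"
          using less.prems(5)[of c' k] by (auto simp: lower_apply split: if_splits)
      next
        show "V ?lb ?q (lower (lower r c) d) (K \<union> Collect (adj (c, r c - 1)) \<union> ?M)"
          using move(2) d(3) by (auto simp: VB_def Un_ac)
      qed (use d less.prems in auto)
    qed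
  next
    case pass
    have "VB ?lb None r K"
      by (rule VB_mono[OF _ pass(3)])
         (use pass less.prems(5) in \<open>auto split: if_splits\<close>)
    then show ?thesis
      using V0_odd_rest[of A r "y + 2" K] pass less.prems
      by (metis fun_upd_triv odd_add even_numeral)
  qed
qed

text \<open>Breaker follows his refutation of the truncated game and answers in the cut part
  whenever Maker plays there. The vertices \<open>(A, k)\<close> of that part with
  \<open>even (k + y)\<close> fall to him, so \<open>K\<close> may contain marks on them: this
  freedom is what makes marks above \<open>(A, y)\<close> irrelevant. The parity disjunct holds
  until Maker claims the last vertex of an odd cut part; afterwards \<open>r A = 0\<close> and the
  pass is spent. The maximum keeps chain \<open>A\<close> of the truncated game at its end while the
  real chain shrinks further.\<close>

lemma not_V0_if_not_truncated:
  assumes "A < w"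
    and "\<And>k k'. k \<le> y + 1 \<Longrightarrow> k' \<le> y + 1 \<Longrightarrow> odd (k + y) \<Longrightarrow> odd (k' + y) \<Longrightarrow> \<not> adj (A, k) (A, k')"
    and "\<And>k. k \<le> y + 1 \<Longrightarrow> k < r A \<Longrightarrow> odd (k + y) \<Longrightarrow> (A, k) \<notin> K"
    and "\<And>c k. c < w \<Longrightarrow> k < r c \<Longrightarrow> (c = A \<Longrightarrow> y + 2 \<le> k) \<Longrightarrow>
           (c, k) \<in> K \<union> truncation_marks A y \<Longrightarrow> (c, k) \<in> K'"
    and "r A = 0 \<and> q = None \<or>
         (y + 2 \<le> r A \<or> even (r A + y)) \<and> even (y + tot r) \<and> q = truncation_pass A y"
    and "\<not> V ((\<lambda>_. 0)(A := y + 2)) q (r(A := max (r A) (y + 2))) K'"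
  shows "\<not> V0 r K"
  using assms
proof (induction "tot r" arbitrary: r q K K' rule: less_induct)
  case less
  let ?l = "y + 2"
  let ?lb = "(\<lambda>_. 0)(A := ?l)" and ?M = "truncation_marks A y"
  define rh where "rh = r(A := max (r A) ?l)"
  note nV = less.prems(6)[folded rh_def]
  show ?case
  proof
    assume "V0 r K"
    then obtain c where c: "c < w" "0 < r c"
      and V: "(c, r c - 1) \<in> K \<or> VB0 (lower r c) (K \<union> Collect (adj (c, r c - 1)))"
      by (auto elim: V0_cases)
    let ?N = "Collect (adj (c, r c - 1))"
    show False
    proof (cases "c = A \<longrightarrow> ?l < r A")
      case True
      have c': "c \<in> open_chains ?lb rh" "rh c = r c"
        using c True by (auto simp: open_chains_def rh_def)
      have "(c, r c - 1) \<notin> K'" using nV c' by (subst (asm) V_iff) auto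
      moreover from this have "(c, r c - 1) \<notin> K" "(c, r c - 1) \<notin> ?M"
        using less.prems(4)[of c "r c - 1"] c True by fastforce+
      ultimately have VB: "VB0 (lower r c) (K \<union> ?N)" and nM: "(c, r c - 1) \<notin> ?M"
        using V by auto
      have nN: "(A, k) \<notin> ?N" if "k \<le> y + 1" "odd (k + y)" for k
        using nM that adj_sym by (auto simp: truncation_marks_def)
      have nVB: "\<not> VB ?lb q (lower rh c) (K' \<union> ?N)"
        using nV c' by (subst (asm) V_iff) auto
      show False
      proof (cases "open_chains ?lb (lower rh c) = {}")
        case True
        \<comment> \<open>The truncated game is over but Breaker still has to move, so he would have
          to open the cut part. Parity excludes this: \<open>tot r\<close> would be one more than a
          number of the parity of \<open>y\<close>, against \<open>even (y + tot r)\<close>.\<close>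
        obtain d where d: "d < w" "0 < lower r c d" using VB by (auto simp: VB_def open_chains_def)
        have d_A: "d = A"
        proof (rule ccontr)
          assume "d \<noteq> A"
          then have "d \<in> open_chains ?lb (lower rh c)"
            using d by (auto simp: open_chains_def lower_apply rh_def split: if_splits)
          then show False using True by simp
        qed
        have z: "lower rh c e = 0" if "e < w" "e \<noteq> A" for e
          using True that by (auto simp: open_chains_def)
        have "A \<notin> open_chains ?lb (lower rh c)" using True by simp
        then have "lower rh c A \<le> ?l" using less.prems(1) by (simp add: open_chains_def)
        moreover have "?l \<le> lower rh c A"
          using \<open>c = A \<longrightarrow> ?l < r A\<close> by (auto simp: lower_apply rh_def max_def)
        ultimately have rA: "lower rh c A = ?l" by simp
        have "tot (lower rh c) = ?l" using tot_single[of A "lower rh c"] z rA less.prems(1) by simp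
        then have t1: "tot rh = ?l + 1" using tot_lower[of c rh] c c' by simp
        have t2: "tot rh + r A = tot r + max (r A) ?l"
          unfolding rh_def by (rule tot_upd) (rule less.prems)
        have "0 < r A" using d d_A by (auto simp: lower_apply split: if_splits)
        then have "(?l \<le> r A \<or> even (r A + y)) \<and> even (y + tot r)" using less.prems(5) by auto
        then show False
        proof (cases "?l \<le> r A")
          case True
          then have "tot r = y + 3" using t1 t2 by simp
          then show False
            using \<open>(?l \<le> r A \<or> even (r A + y)) \<and> even (y + tot r)\<close> by presburger
        next
          case False
          then have "even (r A + y)" "even (y + tot r)" "max (r A) ?l = ?l"
            using \<open>(?l \<le> r A \<or> even (r A + y)) \<and> even (y + tot r)\<close> by auto
          then show False using t1 t2 by presburger
        qed
      next
        case False
        then obtain d where d: "d \<in> open_chains ?lb (lower rh c)"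
          "\<not> V ?lb q (lower (lower rh c) d) (K' \<union> ?N)"
          using nVB by (auto simp: VB_def)
        have d_w: "d < w" "0 < lower r c d"
          using d(1) by (auto simp: open_chains_def lower_apply rh_def max_def split: if_splits)
        have V2: "V0 (lower (lower r c) d) (K \<union> ?N)"
          using VB d_w by (auto simp: VB_def open_chains_def)
        have t: "tot r = tot (lower (lower r c) d) + 2" by (rule tot_lower2) (use c d_w in auto)
        have "\<not> V0 (lower (lower r c) d) (K \<union> ?N)"
        proof (rule less.hyps)
          have dA: "?l < lower rh c A" if "d = A" using d(1) that by (auto simp: open_chains_def)
          have "(lower (lower r c) d)(A := max (lower (lower r c) d A) ?l) = lower (lower rh c) d"
            using True dA
            by (auto simp: lower_apply rh_def fun_eq_iff max_def split: if_splits)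
          then show "\<not> V ?lb q ((lower (lower r c) d)(A := max (lower (lower r c) d A) ?l)) (K' \<union> ?N)"
            using d(2) by simp
          have "lower (lower r c) d A = r A \<or> ?l \<le> lower (lower r c) d A"
            using True dA by (auto simp: lower_apply rh_def split: if_splits)
          moreover have "lower (lower r c) d A \<le> r A" by (simp add: lower_apply)
          ultimately show "lower (lower r c) d A = 0 \<and> q = None \<or>
            (?l \<le> lower (lower r c) d A \<or> even (lower (lower r c) d A + y)) \<and>
            even (y + tot (lower (lower r c) d)) \<and> q = truncation_pass A y"
            using less.prems(5) t by auto
        next
          fix k assume k: "k \<le> y + 1" "k < lower (lower r c) d A" "odd (k + y)"
          then have "k < r A" by (auto simp: lower_apply split: if_splits)
          then show "(A, k) \<notin> K \<union> ?N" using less.prems(3) k nN by auto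
        next
          fix c' k assume "c' < w" "k < lower (lower r c) d c'" "c' = A \<Longrightarrow> y + 2 \<le> k"
            "(c', k) \<in> K \<union> ?N \<union> ?M"
          then show "(c', k) \<in> K' \<union> ?N"
            using less.prems(4)[of c' k] by (auto simp: lower_apply split: if_splits)
        qed (use t less.prems in auto)
        then show False using V2 by simp
      qed
    next
      case False
      \<comment> \<open>Maker plays in the cut part. As Breaker always answers there, she only gets
        vertices \<open>(A, k)\<close> with \<open>odd (k + y)\<close>, whose neighbours are marked
        in the truncated game from the outset.\<close>
      then have c_A: "c = A" and rA: "r A \<le> ?l" "0 < r A" using c by auto
      then have "(?l \<le> r A \<or> even (r A + y)) \<and> even (y + tot r) \<and> q = truncation_pass A y"
        using less.prems(5) by auto
      moreover from this have "even (r A + y)" using rA by (cases "r A = ?l") auto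
      ultimately have ph: "even (r A + y)" "even (y + tot r)" "q = truncation_pass A y" by auto
      have odd1: "odd (r A - 1 + y)" using ph rA by auto
      have rh: "rh = r(A := ?l)" using rA by (simp add: rh_def max_def)
      have "(A, r A - 1) \<notin> K" using less.prems(3)[of "r A - 1"] rA odd1 by auto
      then have VB: "VB0 (lower r A) (K \<union> ?N)" using V c_A by auto
      have N_M: "?N \<subseteq> ?M" using rA odd1 c_A by (auto simp: truncation_marks_def intro!: exI[of _ "r A - 1"])
      have nN: "(A, k) \<notin> ?N" if "k \<le> y + 1" "odd (k + y)" for k
        using less.prems(2)[of "r A - 1" k] that rA odd1 c_A by auto
      show False
      proof (cases "r A = 1")
        case False
        then have r2: "2 \<le> r A" using rA by simp
        have V2: "V0 (lower (lower r A) A) (K \<union> ?N)"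
          using VB r2 less.prems(1) by (auto simp: VB_def open_chains_def lower_apply)
        have t: "tot r = tot (lower (lower r A) A) + 2"
          by (rule tot_lower2) (use c c_A r2 in \<open>auto simp: lower_apply\<close>)
        have "\<not> V0 (lower (lower r A) A) (K \<union> ?N)"
        proof (rule less.hyps)
          have "(lower (lower r A) A)(A := max (lower (lower r A) A A) ?l) = rh"
            using rA by (auto simp: lower_apply rh fun_eq_iff max_def)
          then show "\<not> V ?lb q ((lower (lower r A) A)(A := max (lower (lower r A) A A) ?l)) K'"
            using nV by simp
          show "lower (lower r A) A A = 0 \<and> q = None \<or>
            (?l \<le> lower (lower r A) A A \<or> even (lower (lower r A) A A + y)) \<and>
            even (y + tot (lower (lower r A) A)) \<and> q = truncation_pass A y"
            using ph t r2 by (auto simp: lower_apply)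
        next
          fix k assume k: "k \<le> y + 1" "k < lower (lower r A) A A" "odd (k + y)"
          then have "k < r A" by (auto simp: lower_apply split: if_splits)
          then show "(A, k) \<notin> K \<union> ?N" using less.prems(3) k nN by auto
        next
          fix c' k assume "c' < w" "k < lower (lower r A) A c'" "c' = A \<Longrightarrow> y + 2 \<le> k"
            "(c', k) \<in> K \<union> ?N \<union> ?M"
          then show "(c', k) \<in> K'"
            using less.prems(4)[of c' k] N_M by (auto simp: lower_apply split: if_splits)
        qed (use t less.prems in auto)
        then show False using V2 by simp
      next
        case True
        \<comment> \<open>Maker claims the last vertex of an odd cut part, so Breaker cannot answer
          in it. In the truncated game this is her pass, and he continues with his refutation of the
          position after it.\<close>
        then have q: "q = Some A" using ph by (auto simp: truncation_pass_def)
        have nVB: "\<not> VB ?lb None rh K'"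
          using nV q rh by (subst (asm) V_iff) auto
        obtain d0 where "d0 < w" "0 < lower r A d0"
          using VB by (auto simp: VB_def open_chains_def)
        then have "d0 \<in> open_chains ?lb rh"
          using True by (auto simp: open_chains_def lower_apply rh split: if_splits)
        then obtain d where d: "d \<in> open_chains ?lb rh" "\<not> V ?lb None (lower rh d) K'"
          using nVB by (auto simp: VB_def)
        have dA: "d \<noteq> A" "d < w" "0 < r d" using d(1) by (auto simp: open_chains_def rh split: if_splits)
        have V2: "V0 (lower (lower r A) d) (K \<union> ?N)"
          using VB dA by (auto simp: VB_def open_chains_def lower_apply)
        have t: "tot r = tot (lower (lower r A) d) + 2"
          by (rule tot_lower2) (use c c_A dA in \<open>auto simp: lower_apply\<close>)
        have "\<not> V0 (lower (lower r A) d) (K \<union> ?N)"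
        proof (rule less.hyps)
          have "(lower (lower r A) d)(A := max (lower (lower r A) d A) ?l) = lower rh d"
            using True dA by (auto simp: lower_apply rh fun_eq_iff max_def)
          then show "\<not> V ?lb None ((lower (lower r A) d)(A := max (lower (lower r A) d A) ?l)) K'"
            using d by simp
          show "lower (lower r A) d A = 0 \<and> None = None \<or>
            (?l \<le> lower (lower r A) d A \<or> even (lower (lower r A) d A + y)) \<and>
            even (y + tot (lower (lower r A) d)) \<and> None = truncation_pass A y"
            using True dA by (auto simp: lower_apply)
        next
          fix k assume k: "k \<le> y + 1" "k < lower (lower r A) d A" "odd (k + y)"
          then show "(A, k) \<notin> K \<union> ?N" using True dA by (auto simp: lower_apply split: if_splits)
        next
          fix c' k assume "c' < w" "k < lower (lower r A) d c'" "c' = A \<Longrightarrow> y + 2 \<le> k"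
            "(c', k) \<in> K \<union> ?N \<union> ?M"
          then show "(c', k) \<in> K'"
            using less.prems(4)[of c' k] N_M by (auto simp: lower_apply split: if_splits)
        qed (use t less.prems in auto)
        then show False using V2 by simp
      qed
    qed
  qed
qed

text \<open>The truncated game mediates: \<open>V0_if_truncated\<close> is applied to
  \<open>K'\<close> and \<open>not_V0_if_not_truncated\<close> to \<open>K\<close>. If Maker does
  not win with \<open>K'\<close>, then none of the situations of \<open>V0_bad\<close>,
  \<open>V0_bad_edge\<close> and \<open>V0_cross\<close> is present, which yields the side
  conditions of both.\<close>

lemma V0_drop:
  assumes "A < w" "(A, y) \<in> K'" "even (y + tot r)" "y < r A" "V0 r K"
    and "\<And>c k. (c, k) \<in> K \<Longrightarrow> (c, k) \<notin> K' \<Longrightarrow> c = A \<and> k < y \<and> even (k + y)"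
  shows "V0 r K'"
proof (rule ccontr)
  assume n: "\<not> V0 r K'"
  let ?M = "truncation_marks A y"
  have "r A \<noteq> y + 1" using n V0_top[of A r K'] assms by auto
  then have rA: "y + 2 \<le> r A" using assms by simp
  have bad: "(A, k) \<notin> K'" if "k < r A" "odd (k + y)" for k
    using n V0_bad[of A k r K'] assms that by auto
  have edge: "\<not> adj (A, k) (A, k')"
    if "k \<le> y + 1" "k' \<le> y + 1" "odd (k + y)" "odd (k' + y)" for k k'
  proof
    assume a: "adj (A, k) (A, k')"
    then have "k \<noteq> k'" using adj_irrefl by auto
    then consider "k' < k" | "k < k'" by linarith
    then show False
    proof cases
      case 1
      then show False using V0_bad_edge[of A k r k' K'] a n assms that rA by auto
    next
      case 2
      then show False using V0_bad_edge[of A k' r k K'] adj_sym[OF a] n assms that rA by auto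
    qed
  qed
  have cross: "(c, k) \<notin> ?M" if "odd y" "c < w" "c \<noteq> A" "k < r c" for c k
  proof
    assume "(c, k) \<in> ?M"
    then obtain ku where "ku \<le> y + 1" "odd (ku + y)" "adj (A, ku) (c, k)"
      by (auto simp: truncation_marks_def)
    then show False using V0_cross[of A c y K' r ku k] n assms that rA by auto
  qed
  have nV: "\<not> V ((\<lambda>_. 0)(A := y + 2)) (truncation_pass A y) r (K' \<union> ?M)"
    using V0_if_truncated[of A y K' r] n assms cross rA by blast
  have "\<not> V0 r K"
  proof (rule not_V0_if_not_truncated[of A y r K "K' \<union> ?M" "truncation_pass A y"])
    show "\<not> V ((\<lambda>_. 0)(A := y + 2)) (truncation_pass A y) (r(A := max (r A) (y + 2))) (K' \<union> ?M)"
      using nV rA by (simp add: max_def fun_upd_idem)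
    fix k assume "k < r A" "odd (k + y)"
    then show "(A, k) \<notin> K" using assms(6)[of A k] bad[of k] by auto
  next
    fix c k assume "c = A \<Longrightarrow> y + 2 \<le> k" "(c, k) \<in> K \<union> ?M"
    then show "(c, k) \<in> K' \<union> ?M" using assms(6)[of c k] by fastforce
  qed (use assms edge rA in auto)
  then show False using assms by simp
qed

section \<open>One mark per chain\<close>

definition first_marks :: "(nat \<times> nat) set \<Rightarrow> (nat \<times> nat) set" where
  "first_marks K = {(c, k) \<in> K. \<forall>k'. (c, k') \<in> K \<longrightarrow> k' \<le> k}"

text \<open>A chain is claimed in the order of decreasing \<open>k\<close>, so its mark with the
  largest \<open>k\<close> is reached first. As all marks have the right parity,
  \<open>V0_drop\<close> removes the others one at a time.\<close>

lemma V0_first_marks: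
  assumes "finite K" "\<And>c k. (c, k) \<in> K \<Longrightarrow> c < w \<and> k < r c \<and> even (k + tot r)"
  shows "V0 r K \<longleftrightarrow> V0 r (first_marks K)"
  using assms
proof (induction "card K" arbitrary: K rule: less_induct)
  case less
  show ?case
  proof (cases "first_marks K = K")
    case False
    have "first_marks K \<subseteq> K" by (auto simp: first_marks_def)
    with False obtain x where "x \<in> K" "x \<notin> first_marks K" by blast
    then obtain c k k' where k: "(c, k) \<in> K" "(c, k') \<in> K" "k < k'"
      by (cases x) (auto simp: first_marks_def not_le)
    let ?K = "K - {(c, k)}"
    have "first_marks ?K = first_marks K"
    proof (intro equalityI subrelI)
      fix a b assume "(a, b) \<in> first_marks ?K"
      then have ab: "(a, b) \<in> K" "\<And>j. (a, j) \<in> K \<Longrightarrow> (a, j) \<noteq> (c, k) \<Longrightarrow> j \<le> b"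
        by (auto simp: first_marks_def)
      have "j \<le> b" if "(a, j) \<in> K" for j
        using that ab(2)[of j] ab(2)[of k'] k by fastforce
      then show "(a, b) \<in> first_marks K" using ab by (auto simp: first_marks_def)
    next
      fix a b assume "(a, b) \<in> first_marks K"
      then show "(a, b) \<in> first_marks ?K" using k by (fastforce simp: first_marks_def)
    qed
    moreover have "V0 r ?K \<longleftrightarrow> V0 r (first_marks ?K)"
      using less.prems k card_Diff1_less[OF less.prems(1) k(1)]
      by (intro less.hyps) auto
    moreover have "V0 r ?K \<longleftrightarrow> V0 r K"
    proof
      assume "V0 r K"
      then show "V0 r ?K"
      proof (rule V0_drop[of c k', rotated 4])
        fix c' j assume "(c', j) \<in> K" "(c', j) \<notin> ?K"
        then have "c' = c" "j = k" by auto
        then show "c' = c \<and> j < k' \<and> even (j + k')"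
          using less.prems(2)[OF k(1)] less.prems(2)[OF k(2)] k by auto
      qed (use k less.prems(2)[OF k(2)] in auto)
    qed (auto elim: V_mono[rotated])
    ultimately show ?thesis by simp
  qed simp
qed


end

text \<open>
  The states of the dynamic program: \<open>r c\<close> vertices of chain \<open>c\<close> are unclaimed, and the lowest
  marked one among them is the one with \<open>u c - 1\<close> vertices above it (none if \<open>u c = 0\<close>).
\<close>

locale chain_game_dp = chain_game +
  fixes n :: nat
  assumes adj_chain: "adj x y \<Longrightarrow> fst y < w"
begin

section \<open>The recursion on compressed positions\<close>

definition hits_bad :: "nat \<Rightarrow> (nat \<Rightarrow> nat) \<Rightarrow> (nat \<Rightarrow> nat) \<Rightarrow> bool" where
  "hits_bad c r r' \<longleftrightarrow> (\<exists>e k. adj (c, r c - 1) (e, k) \<and> k < r' e \<and> odd (k + n))"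

text \<open>\<open>u d = lower r c d\<close> says that Breaker's reply is the marked vertex of chain
  \<open>d\<close>. The entry then starts again from 0 even if other vertices of \<open>d\<close>
  had been marked earlier: they were forgotten in a previous compression, which
  \<open>V0_first_marks\<close> justifies.\<close>

definition next_marks ::
    "nat \<Rightarrow> nat \<Rightarrow> (nat \<Rightarrow> nat) \<Rightarrow> (nat \<Rightarrow> nat) \<Rightarrow> nat \<Rightarrow> nat" where
  "next_marks c d r u e =
     Max (insert (if e = d \<and> u d = lower r c d then 0 else u e)
       {Suc k | k. k < lower (lower r c) d e \<and> adj (c, r c - 1) (e, k)})"

function W :: "(nat \<Rightarrow> nat) \<Rightarrow> (nat \<Rightarrow> nat) \<Rightarrow> bool" where
  "W r u \<longleftrightarrow>
     (\<exists>c\<in>open_chains (\<lambda>_. 0) r. u c = r c \<or>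
        open_chains (\<lambda>_. 0) (lower r c) \<noteq> {} \<and>
        (\<forall>d\<in>open_chains (\<lambda>_. 0) (lower r c).
           hits_bad c r (lower (lower r c) d) \<or> W (lower (lower r c) d) (next_marks c d r u)))"
  by pat_completeness auto
termination
proof (relation "measure (\<lambda>(r, u). tot r)", goal_cases)
  case (2 r u c d)
  then show ?case
    using tot_lower[of c r] tot_lower[of d "lower r c"] by (auto dest!: open_chainsD)
qed auto

declare W.simps [simp del]

definition marks :: "(nat \<Rightarrow> nat) \<Rightarrow> (nat \<times> nat) set" where
  "marks u = {(c, k). c < w \<and> u c = Suc k}"

lemma next_marks_finite: "finite {Suc k | k. k < (a :: nat) \<and> Q k}"
  by (rule finite_subset[of _ "Suc ` {..<a}"]) auto

lemma next_marks_le: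
  assumes "u e \<le> r e" "e = c \<Longrightarrow> u e < r e" "0 < lower r c d"
  shows "next_marks c d r u e \<le> lower (lower r c) d e"
  unfolding next_marks_def
  by (subst Max_le_iff[OF finite.insertI[OF next_marks_finite]])
     (use assms in \<open>auto simp: lower_apply split: if_splits\<close>)

lemma next_marks_cases:
  assumes "next_marks c d r u e = Suc k"
  shows "u e = Suc k \<or> k < lower (lower r c) d e \<and> adj (c, r c - 1) (e, k)"
proof -
  have "next_marks c d r u e \<in> insert (if e = d \<and> u d = lower r c d then 0 else u e)
       {Suc k | k. k < lower (lower r c) d e \<and> adj (c, r c - 1) (e, k)}"
    unfolding next_marks_def by (rule Max_in) (simp_all add: next_marks_finite)
  then show ?thesis using assms by (auto split: if_splits)
qed

lemma marks_next:
  assumes "\<And>c. c < w \<Longrightarrow> u c \<le> r c" "u c < r c" "d < w" "0 < lower r c d"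
  shows "marks (next_marks c d r u) =
    first_marks {(e, k) \<in> marks u \<union> Collect (adj (c, r c - 1)). k < lower (lower r c) d e}"
    (is "_ = first_marks ?K")
proof -
  have ge: "Suc k \<le> next_marks c d r u e" if "(e, k) \<in> ?K" for e k
    unfolding next_marks_def
  proof (rule Max_ge[OF finite.insertI[OF next_marks_finite]])
    show "Suc k \<in> insert (if e = d \<and> u d = lower r c d then 0 else u e)
       {Suc k | k. k < lower (lower r c) d e \<and> adj (c, r c - 1) (e, k)}"
      using that assms(4)
      by (auto simp: marks_def lower_apply[of "lower r c"] split: if_splits)
  qed
  have mem: "(e, k) \<in> ?K" if "next_marks c d r u e = Suc k" "e < w" for e k
  proof -
    have "k < lower (lower r c) d e"
      using next_marks_le[of u e r c d] that assms by auto
    then show ?thesis using next_marks_cases[OF that(1)] that(2) by (auto simp: marks_def)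
  qed
  have lt: "e < w" if "(e, k) \<in> ?K" for e k using that adj_chain by (auto simp: marks_def)
  show ?thesis
  proof (intro equalityI subrelI)
    fix e k assume "(e, k) \<in> marks (next_marks c d r u)"
    then have *: "next_marks c d r u e = Suc k" "e < w" by (auto simp: marks_def)
    then show "(e, k) \<in> first_marks ?K" using mem[OF *] ge[of e] unfolding first_marks_def by force
  next
    fix e k assume "(e, k) \<in> first_marks ?K"
    then have k: "(e, k) \<in> ?K" "\<And>j. (e, j) \<in> ?K \<Longrightarrow> j \<le> k" by (auto simp: first_marks_def)
    obtain j where j: "next_marks c d r u e = Suc j" using ge[OF k(1)] by (metis Suc_le_D)
    have "next_marks c d r u e = Suc k"
      using k(2)[OF mem[OF j lt[OF k(1)]]] ge[OF k(1)] j by simp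
    then show "(e, k) \<in> marks (next_marks c d r u)" using lt[OF k(1)] by (simp add: marks_def)
  qed
qed

text \<open>\<open>V\<close> keeps all marks, \<open>W\<close> only the lowest one of each chain;
  \<open>V0_first_marks\<close> reconciles them after every round. It demands that all marks have
  the right parity, which is what the failure of \<open>hits_bad\<close> ensures for the new ones. A
  round removes two vertices, so the fixed number \<open>n\<close> can stand for the current
  total.\<close>

theorem W_iff_V0:
  assumes "even (tot r + n)" "\<And>c. c < w \<Longrightarrow> u c \<le> r c"
    and "\<And>c k. (c, k) \<in> marks u \<Longrightarrow> even (k + n)"
  shows "W r u \<longleftrightarrow> V0 r (marks u)"
  using assms
proof (induction r u rule: W.induct)
  case (1 r u)
  let ?N = "\<lambda>c. Collect (adj (c, r c - 1))"
  have top: "u c = r c \<longleftrightarrow> (c, r c - 1) \<in> marks u" if "c \<in> open_chains (\<lambda>_. 0) r" for c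
    using that by (auto simp: marks_def dest!: open_chainsD)
  have rec: "hits_bad c r (lower (lower r c) d) \<or> W (lower (lower r c) d) (next_marks c d r u)
      \<longleftrightarrow> V0 (lower (lower r c) d) (marks u \<union> ?N c)"
    if c: "c \<in> open_chains (\<lambda>_. 0) r" "u c \<noteq> r c" and d: "d \<in> open_chains (\<lambda>_. 0) (lower r c)" for c d
  proof -
    let ?r = "lower (lower r c) d"
    let ?K = "{(e, k) \<in> marks u \<union> ?N c. k < ?r e}"
    have cw: "c < w" "0 < r c" "u c < r c" using c "1.prems"(2)[of c] by (auto dest!: open_chainsD)
    have dw: "d < w" "0 < lower r c d" using d by (auto dest!: open_chainsD)
    have t: "tot r = tot ?r + 2" by (rule tot_lower2) (use cw dw in auto)
    have lt: "e < w" if "(e, k) \<in> ?K" for e k using that adj_chain by (auto simp: marks_def)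
    have K: "V0 ?r (marks u \<union> ?N c) \<longleftrightarrow> V0 ?r ?K"
      by (intro iffI; erule V_mono[rotated]) auto
    show ?thesis
    proof (cases "hits_bad c r ?r")
      case True
      \<comment> \<open>The parity is tested after Breaker's reply, since he may just have claimed
        the newly marked vertex; only a mark that survives the reply wins.\<close>
      then obtain e k where "adj (c, r c - 1) (e, k)" "k < ?r e" "odd (k + n)"
        by (auto simp: hits_bad_def)
      then have "V0 ?r (marks u \<union> ?N c)"
        using adj_chain[of _ "(e, k)"] t "1.prems"(1) by (intro V0_bad[of e k]) auto
      then show ?thesis using True by simp
    next
      case False
      have good: "even (k + n)" if "(e, k) \<in> ?K" for e k
        using that False "1.prems"(3)[of e k] unfolding hits_bad_def by auto
      have "finite ?K"
        by (rule finite_subset[of _ "Sigma {..<w} (\<lambda>e. {..<?r e})"]) (use lt in auto)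
      then have "V0 ?r ?K \<longleftrightarrow> V0 ?r (first_marks ?K)"
      proof (rule V0_first_marks)
        fix e k assume ek: "(e, k) \<in> ?K"
        show "e < w \<and> k < ?r e \<and> even (k + tot ?r)"
          using lt[OF ek] good[OF ek] ek t "1.prems"(1) by auto
      qed
      also have "first_marks ?K = marks (next_marks c d r u)"
        by (rule marks_next[symmetric]) (use "1.prems" cw dw in auto)
      also have "V0 ?r \<dots> \<longleftrightarrow> W ?r (next_marks c d r u)"
      proof (rule "1.IH"[OF c(1) d, symmetric])
        show "even (tot ?r + n)" using t "1.prems"(1) by simp
        show "next_marks c d r u e \<le> ?r e" if "e < w" for e
          by (rule next_marks_le) (use "1.prems"(2)[OF that] cw dw in auto)
        show "even (k + n)" if "(e, k) \<in> marks (next_marks c d r u)" for e k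
          using that next_marks_cases[of c d r u e k] False "1.prems"(3)[of e k]
          by (auto simp: marks_def hits_bad_def)
      qed
      finally show ?thesis using False K by simp
    qed
  qed
  have "V0 r (marks u) \<longleftrightarrow> (\<exists>c\<in>open_chains (\<lambda>_. 0) r. (c, r c - 1) \<in> marks u \<or>
        VB0 (lower r c) (marks u \<union> ?N c))"
    by (subst V_iff) simp
  also have "\<dots> \<longleftrightarrow> W r u"
    unfolding W.simps[of r u] VB_def
  proof (intro bex_cong refl)
    fix c assume c: "c \<in> open_chains (\<lambda>_. 0) r"
    show "((c, r c - 1) \<in> marks u \<or> open_chains (\<lambda>_. 0) (lower r c) \<noteq> {} \<and>
            (\<forall>d\<in>open_chains (\<lambda>_. 0) (lower r c). V0 (lower (lower r c) d) (marks u \<union> ?N c))) \<longleftrightarrow>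
          (u c = r c \<or> open_chains (\<lambda>_. 0) (lower r c) \<noteq> {} \<and>
            (\<forall>d\<in>open_chains (\<lambda>_. 0) (lower r c).
              hits_bad c r (lower (lower r c) d) \<or> W (lower (lower r c) d) (next_marks c d r u)))"
      using top[OF c] rec[OF c] by (cases "u c = r c") (simp_all cong: ball_cong)
  qed
  finally show ?case by simp
qed

text \<open>The entry into the recursion: the marks present before the first move are arbitrary, so
  their parities are tested and the set is compressed before \<open>W\<close> takes over.\<close>

corollary V0_decide:
  assumes "even (tot r + n)" "finite K" "\<And>c k. (c, k) \<in> K \<Longrightarrow> c < w \<and> k < r c"
    and "first_marks K = marks u" "\<And>c. c < w \<Longrightarrow> u c \<le> r c"
  shows "V0 r K \<longleftrightarrow> (\<exists>(c, k)\<in>K. odd (k + n)) \<or> W r u"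
proof (cases "\<exists>(c, k)\<in>K. odd (k + n)")
  case True
  then obtain c k where "(c, k) \<in> K" "odd (k + n)" by auto
  then have "V0 r K" using assms(1,3) by (intro V0_bad[of c k]) auto
  then show ?thesis using True by simp
next
  case False
  then have "V0 r K \<longleftrightarrow> V0 r (first_marks K)" using assms by (intro V0_first_marks) auto
  moreover have "first_marks K \<subseteq> K" by (auto simp: first_marks_def)
  ultimately show ?thesis using False W_iff_V0[of r u] assms by auto
qed

end

section \<open>Programs with bounded loops and their compilation\<close>

datatype exp = Var nat | Num nat | Plus exp exp | Minus exp exp | Arr nat exp

datatype com =
    Assign nat exp
  | Put nat exp exp
  | Seq com com
  | Cond exp com com
  | For nat nat com

type_synonym state = "(nat \<Rightarrow> nat) \<times> (nat \<Rightarrow> nat \<Rightarrow> nat)"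

primrec val :: "exp \<Rightarrow> state \<Rightarrow> nat" where
  "val (Var x) s = fst s x"
| "val (Num n) s = n"
| "val (Plus e f) s = val e s + val f s"
| "val (Minus e f) s = val e s - val f s"
| "val (Arr a e) s = snd s a (val e s)"

text \<open>
  \<open>For i x c\<close> runs \<open>c\<close> for \<open>i = 0, \<dots>, x - 1\<close>; the bound \<open>x\<close> is a variable that \<open>c\<close> must not modify.
\<close>

definition next_iter :: "nat \<Rightarrow> (state \<Rightarrow> state) \<Rightarrow> state \<Rightarrow> state" where
  "next_iter i f s = ((fst (f s))(i := Suc (fst (f s) i)), snd (f s))"

primrec exec :: "com \<Rightarrow> state \<Rightarrow> state" where
  "exec (Assign x e) s = ((fst s)(x := val e s), snd s)"
| "exec (Put a e f) s = (fst s, (snd s)(a := (snd s a)(val e s := val f s)))"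
| "exec (Seq c d) s = exec d (exec c s)"
| "exec (Cond e c d) s = (if val e s \<noteq> 0 then exec c s else exec d s)"
| "exec (For i x c) s = (next_iter i (exec c) ^^ fst s x) ((fst s)(i := 0), snd s)"

primrec vmods :: "com \<Rightarrow> nat set" where
  "vmods (Assign x e) = {x}"
| "vmods (Put a e f) = {}"
| "vmods (Seq c d) = vmods c \<union> vmods d"
| "vmods (Cond e c d) = vmods c \<union> vmods d"
| "vmods (For i x c) = insert i (vmods c)"

primrec amods :: "com \<Rightarrow> nat set" where
  "amods (Assign x e) = {}"
| "amods (Put a e f) = {a}"
| "amods (Seq c d) = amods c \<union> amods d"
| "amods (Cond e c d) = amods c \<union> amods d"
| "amods (For i x c) = amods c"

primrec bounds :: "com \<Rightarrow> nat set" where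
  "bounds (Assign x e) = {}"
| "bounds (Put a e f) = {}"
| "bounds (Seq c d) = bounds c \<union> bounds d"
| "bounds (Cond e c d) = bounds c \<union> bounds d"
| "bounds (For i x c) = insert x (bounds c)"

lemma exec_frame: "(\<forall>x. x \<notin> vmods c \<longrightarrow> fst (exec c s) x = fst s x) \<and>
    (\<forall>a. a \<notin> amods c \<longrightarrow> snd (exec c s) a = snd s a)"
proof (induction c arbitrary: s)
  case (For i x c)
  have "(\<forall>y. y \<notin> insert i (vmods c) \<longrightarrow> fst ((next_iter i (exec c) ^^ k) s) y = fst s y) \<and>
    (\<forall>a. a \<notin> amods c \<longrightarrow> snd ((next_iter i (exec c) ^^ k) s) a = snd s a)" for k s
    by (induction k) (use For in \<open>auto simp: next_iter_def\<close>)
  then show ?case by auto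
qed auto

lemma vframe: "x \<notin> vmods c \<Longrightarrow> fst (exec c s) x = fst s x"
  and aframe: "a \<notin> amods c \<Longrightarrow> snd (exec c s) a = snd s a"
  using exec_frame by auto

text \<open>
  Variables are kept in the registers below 50. Register 50 contains the address \<open>B\<close> at which the
  interleaved arrays start, and the registers from 51 on serve as a stack for the evaluation of
  expressions. Array 0 is the input, array \<open>a > 0\<close> has its entry \<open>i\<close> at address \<open>B + 16 i + a\<close>.
  Reading the input beyond \<open>B\<close> is redirected to address \<open>B\<close>, which is never written to.
\<close>

primrec comp_exp :: "exp \<Rightarrow> nat \<Rightarrow> instr list" where
  "comp_exp (Var x) d = [Const d 0, Add d d x]"
| "comp_exp (Num n) d = [Const d n]"
| "comp_exp (Plus e f) d = comp_exp e d @ comp_exp f (Suc d) @ [Add d d (Suc d)]"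
| "comp_exp (Minus e f) d = comp_exp e d @ comp_exp f (Suc d) @ [Sub d d (Suc d)]"
| "comp_exp (Arr a e) d = comp_exp e d @
     (if a = 0 then [Sub (Suc d) d 50, Sub d d (Suc d), Load d d]
      else [Add d d d, Add d d d, Add d d d, Add d d d, Const (Suc d) a, Add d d (Suc d),
            Add d d 50, Load d d])"

primrec wf_exp :: "exp \<Rightarrow> bool" where
  "wf_exp (Var x) \<longleftrightarrow> x < 50"
| "wf_exp (Num n) \<longleftrightarrow> True"
| "wf_exp (Plus e f) \<longleftrightarrow> wf_exp e \<and> wf_exp f"
| "wf_exp (Minus e f) \<longleftrightarrow> wf_exp e \<and> wf_exp f"
| "wf_exp (Arr a e) \<longleftrightarrow> a < 16 \<and> wf_exp e"

primrec clen :: "com \<Rightarrow> nat" where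
  "clen (Assign x e) = length (comp_exp e 51) + 2"
| "clen (Put a e f) = length (comp_exp e 51) + 8 + length (comp_exp f 52)"
| "clen (Seq c d) = clen c + clen d"
| "clen (Cond e c d) = length (comp_exp e 51) + 3 + clen c + clen d"
| "clen (For i x c) = clen c + 7"

text \<open>Jump targets are absolute, hence the start address \<open>p\<close>. An unconditional
  jump is a \<open>JumpZero\<close> on register 51 after that register has been set to 0.\<close>

primrec comp :: "com \<Rightarrow> nat \<Rightarrow> instr list" where
  "comp (Assign x e) p = comp_exp e 51 @ [Const x 0, Add x x 51]"
| "comp (Put a e f) p = comp_exp e 51 @
     [Add 51 51 51, Add 51 51 51, Add 51 51 51, Add 51 51 51, Const 52 a, Add 51 51 52,
      Add 51 51 50] @ comp_exp f 52 @ [Store 51 52]"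
| "comp (Seq c d) p = comp c p @ comp d (p + clen c)"
| "comp (Cond e c d) p = comp_exp e 51 @
     [JumpZero 51 (p + length (comp_exp e 51) + 3 + clen c)] @
     comp c (p + length (comp_exp e 51) + 1) @
     [Const 51 0, JumpZero 51 (p + length (comp_exp e 51) + 3 + clen c + clen d)] @
     comp d (p + length (comp_exp e 51) + 3 + clen c)"
| "comp (For i x c) p =
     [Const i 0, Sub 51 x i, JumpZero 51 (p + clen c + 7)] @ comp c (p + 3) @
     [Const 51 1, Add i i 51, Const 51 0, JumpZero 51 (p + 1)]"

lemma length_comp [simp]: "length (comp c p) = clen c"
  by (induction c arbitrary: p) auto

primrec wf_com :: "com \<Rightarrow> bool" where
  "wf_com (Assign x e) \<longleftrightarrow> x < 50 \<and> wf_exp e"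
| "wf_com (Put a e f) \<longleftrightarrow> 0 < a \<and> a < 16 \<and> wf_exp e \<and> wf_exp f"
| "wf_com (Seq c d) \<longleftrightarrow> wf_com c \<and> wf_com d"
| "wf_com (Cond e c d) \<longleftrightarrow> wf_exp e \<and> wf_com c \<and> wf_com d"
| "wf_com (For i x c) \<longleftrightarrow> i < 50 \<and> x < 50 \<and> i \<notin> vmods c \<and> wf_com c"

text \<open>In a loop, 6 counts the two instructions of the test and the four that increment the
  counter and jump back; 3 counts the initialisation and the final test. Adding the costs of both
  branches instead of taking their maximum affects only constant factors.\<close>

primrec cost :: "com \<Rightarrow> (nat \<Rightarrow> nat) \<Rightarrow> nat" where
  "cost (Assign x e) \<beta> = length (comp_exp e 51) + 2"
| "cost (Put a e f) \<beta> = length (comp_exp e 51) + 8 + length (comp_exp f 52)"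
| "cost (Seq c d) \<beta> = cost c \<beta> + cost d \<beta>"
| "cost (Cond e c d) \<beta> = length (comp_exp e 51) + 3 + cost c \<beta> + cost d \<beta>"
| "cost (For i x c) \<beta> = 3 + \<beta> x * (cost c \<beta> + 6)"

section \<open>Correctness and running time of compiled code\<close>

definition represents :: "nat \<Rightarrow> state \<Rightarrow> (nat \<Rightarrow> nat) \<Rightarrow> (nat \<Rightarrow> nat) \<Rightarrow> bool" where
  "represents B s r m \<longleftrightarrow> (\<forall>x<50. r x = fst s x) \<and> r 50 = B \<and>
     (\<forall>i<B. m i = snd s 0 i) \<and> (\<forall>i\<ge>B. snd s 0 i = 0) \<and> m B = 0 \<and>
     (\<forall>a i. 0 < a \<longrightarrow> a < 16 \<longrightarrow> m (B + 16 * i + a) = snd s a i)"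

lemma represents_scratch [simp]:
  "50 < x \<Longrightarrow> represents B s (r(x := v)) m = represents B s r m"
  unfolding represents_def by auto

lemma represents_var:
  "represents B s r m \<Longrightarrow> x < 50 \<Longrightarrow> represents B ((fst s)(x := v), snd s) (r(x := v)) m"
  unfolding represents_def by auto

lemma represents_cong:
  "represents B s r m \<Longrightarrow> (\<And>x. x < 51 \<Longrightarrow> r' x = r x) \<Longrightarrow> represents B s r' m"
  unfolding represents_def by auto

text \<open>\<open>i - (i - B)\<close> is the minimum of \<open>i\<close> and \<open>B\<close>. It
  is the address used by compiled reads of array 0; cell \<open>B\<close> contains 0, which agrees
  with the value of array 0 from \<open>B\<close> on.\<close>

lemma representsD:
  assumes "represents B s r m"
  shows "x < 50 \<Longrightarrow> r x = fst s x" "r 50 = B" "m (i - (i - B)) = snd s 0 i"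
    "0 < a \<Longrightarrow> a < 16 \<Longrightarrow> m (B + 16 * i + a) = snd s a i"
  using assms by (auto simp: represents_def not_less) (metis diff_diff_cancel diff_is_0_eq' leI minus_nat.diff_0 nat_less_le)

definition embedded :: "instr list \<Rightarrow> nat \<Rightarrow> instr list \<Rightarrow> bool" where
  "embedded prog p code \<longleftrightarrow> p + length code \<le> length prog \<and> take (length code) (drop p prog) = code"

lemma embedded_append [simp]:
  "embedded prog p (xs @ ys) \<longleftrightarrow> embedded prog p xs \<and> embedded prog (p + length xs) ys"
  unfolding embedded_def by (auto simp: take_add add.commute append_eq_append_conv)

lemma embedded_Cons [simp]:
  "embedded prog p (x # xs) \<longleftrightarrow> p < length prog \<and> prog ! p = x \<and> embedded prog (Suc p) xs"
  unfolding embedded_def by (auto simp: Cons_nth_drop_Suc[symmetric])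

lemma embedded_Nil [simp]: "embedded prog p [] \<longleftrightarrow> p \<le> length prog"
  unfolding embedded_def by auto

lemma seven_Suc: "(7 :: nat) = Suc (Suc (Suc (Suc (Suc (Suc (Suc 0))))))"
  by simp

definition reach :: "instr list \<Rightarrow> nat \<Rightarrow> config \<Rightarrow> (config \<Rightarrow> bool) \<Rightarrow> bool" where
  "reach prog t C P \<longleftrightarrow> (\<exists>k\<le>t. P ((step prog ^^ k) C))"

lemma reach_0: "P C \<Longrightarrow> reach prog t C P"
  unfolding reach_def by (intro exI[of _ 0]) auto

lemma reach_trans:
  assumes "reach prog t C Q" "\<And>C'. Q C' \<Longrightarrow> reach prog u C' P" "t + u \<le> v"
  shows "reach prog v C P"
proof -
  obtain k where k: "k \<le> t" "Q ((step prog ^^ k) C)" using assms(1) by (auto simp: reach_def)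
  obtain l where l: "l \<le> u" "P ((step prog ^^ l) ((step prog ^^ k) C))"
    using assms(2)[OF k(2)] by (auto simp: reach_def)
  then show ?thesis using k assms(3)
    by (auto simp: reach_def funpow_add intro!: exI[of _ "l + k"])
qed

lemma reach_step:
  assumes "pc C < length prog" "reach prog t (exec_instr (prog ! pc C) C) P"
  shows "reach prog (Suc t) C P"
proof -
  have "step prog C = exec_instr (prog ! pc C) C" using assms(1) by (simp add: step_def halted_def)
  then show ?thesis
    using assms(2) unfolding reach_def
    by (metis Suc_le_mono comp_apply funpow_Suc_right)
qed

fun is_jump :: "instr \<Rightarrow> bool" where
  "is_jump (JumpZero a l) \<longleftrightarrow> True"
| "is_jump _ \<longleftrightarrow> False"

text \<open>Since only the last instruction may jump, the program counter runs through the block and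
  its effect is a \<open>fold\<close>, which simplification can execute symbolically.\<close>

lemma reach_code:
  assumes "embedded prog (pc C) code" "\<forall>x\<in>set (butlast code). \<not> is_jump x"
    and "P (fold exec_instr code C)" "length code \<le> t"
  shows "reach prog t C P"
  using assms
proof (induction code arbitrary: C t)
  case Nil
  then show ?case by (simp add: reach_0)
next
  case (Cons x xs)
  obtain u where t: "t = Suc u" using Cons.prems(4) by (cases t) auto
  have "reach prog u (exec_instr x C) P"
  proof (cases "xs = []")
    case True
    then show ?thesis using Cons.prems by (simp add: reach_0)
  next
    case False
    have "pc (exec_instr x C) = Suc (pc C)"
      using Cons.prems(2) False by (cases C; cases x) auto
    then show ?thesis
      using Cons.prems False t by (intro Cons.IH) auto
  qed
  then show ?case using Cons.prems(1) unfolding t by (intro reach_step) auto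
qed

lemma reach_mono: "reach prog t C P \<Longrightarrow> t \<le> t' \<Longrightarrow> (\<And>C. P C \<Longrightarrow> Q C) \<Longrightarrow> reach prog t' C Q"
  unfolding reach_def by (meson le_trans)

text \<open>Temporaries live in register \<open>d\<close> and beyond, as on a stack. The conclusion
  that registers below \<open>d\<close> are preserved lets the first operand survive the evaluation
  of the second one at \<open>Suc d\<close>.\<close>

lemma reach_comp_exp:
  assumes "represents B s r m" "wf_exp e" "50 < d" "embedded prog i (comp_exp e d)"
  shows "reach prog (length (comp_exp e d)) (Config i r m)
    (\<lambda>C. \<exists>r'. C = Config (i + length (comp_exp e d)) r' m \<and> r' d = val e s \<and> (\<forall>x<d. r' x = r x))"
  using assms
proof (induction e arbitrary: i r d)
  case (Var x)
  then show ?case by (intro reach_code[where code = "[Const d 0, Add d d x]"]) (auto simp: representsD)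
next
  case (Num n)
  then show ?case by (intro reach_code[where code = "[Const d n]"]) auto
next
  case (Plus e f)
  show ?case
  proof (rule reach_trans[OF Plus.IH(1)[where i = i and r = r and d = d]])
    fix C
    assume "\<exists>r'. C = Config (i + length (comp_exp e d)) r' m \<and> r' d = val e s \<and> (\<forall>x<d. r' x = r x)"
    then obtain r' where C: "C = Config (i + length (comp_exp e d)) r' m" "r' d = val e s"
      "\<forall>x<d. r' x = r x" by auto
    have rep: "represents B s r' m" by (rule represents_cong[of B s r]) (use Plus.prems C in auto)
    show "reach prog (length (comp_exp f (Suc d)) + 1) C (\<lambda>C. \<exists>r'.
      C = Config (i + length (comp_exp (Plus e f) d)) r' m \<and> r' d = val (Plus e f) s \<and>
      (\<forall>x<d. r' x = r x))"
      unfolding C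
      by (rule reach_trans[OF Plus.IH(2)[where d = "Suc d"]])
         (use Plus.prems C rep in \<open>auto intro!: reach_code[where code = "[Add d d (Suc d)]"]\<close>)
  qed (use Plus.prems in auto)
next
  case (Minus e f)
  show ?case
  proof (rule reach_trans[OF Minus.IH(1)[where i = i and r = r and d = d]])
    fix C
    assume "\<exists>r'. C = Config (i + length (comp_exp e d)) r' m \<and> r' d = val e s \<and> (\<forall>x<d. r' x = r x)"
    then obtain r' where C: "C = Config (i + length (comp_exp e d)) r' m" "r' d = val e s"
      "\<forall>x<d. r' x = r x" by auto
    have rep: "represents B s r' m" by (rule represents_cong[of B s r]) (use Minus.prems C in auto)
    show "reach prog (length (comp_exp f (Suc d)) + 1) C (\<lambda>C. \<exists>r'.
      C = Config (i + length (comp_exp (Minus e f) d)) r' m \<and> r' d = val (Minus e f) s \<and>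
      (\<forall>x<d. r' x = r x))"
      unfolding C
      by (rule reach_trans[OF Minus.IH(2)[where d = "Suc d"]])
         (use Minus.prems C rep in \<open>auto intro!: reach_code[where code = "[Sub d d (Suc d)]"]\<close>)
  qed (use Minus.prems in auto)
next
  case (Arr a e)
  show ?case
  proof (rule reach_trans[OF Arr.IH[where i = i and r = r and d = d]])
    fix C
    assume "\<exists>r'. C = Config (i + length (comp_exp e d)) r' m \<and> r' d = val e s \<and> (\<forall>x<d. r' x = r x)"
    then obtain r' where C: "C = Config (i + length (comp_exp e d)) r' m" "r' d = val e s"
      "\<forall>x<d. r' x = r x" by auto
    have rep: "represents B s r' m" by (rule represents_cong[of B s r]) (use Arr.prems C in auto)
    have r50: "r' 50 = B" using rep by (rule representsD)
    have inp: "m (val e s - (val e s - B)) = snd s 0 (val e s)" using rep by (rule representsD)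
    have arr: "m (16 * val e s + a + B) = snd s a (val e s)" if "0 < a"
      using representsD(4)[OF rep that, of "val e s"] Arr.prems by (simp add: ac_simps)
    show "reach prog (if a = 0 then 3 else 8) C (\<lambda>C. \<exists>r'.
      C = Config (i + length (comp_exp (Arr a e) d)) r' m \<and> r' d = val (Arr a e) s \<and>
      (\<forall>x<d. r' x = r x))"
    proof (cases "a = 0")
      case True
      then show ?thesis
        using Arr.prems C r50 inp unfolding C(1)
        by (intro reach_code[where code = "[Sub (Suc d) d 50, Sub d d (Suc d), Load d d]"]) auto
    next
      case False
      \<comment> \<open>The four doublings multiply the index by 16, the distance of consecutive
        entries of an array.\<close>
      let ?v = "val e s"
      have "?v + ?v + (?v + ?v) + (?v + ?v + (?v + ?v)) +
          (?v + ?v + (?v + ?v) + (?v + ?v + (?v + ?v))) + a + B = 16 * ?v + a + B" by simp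
      then have m: "m (?v + ?v + (?v + ?v) + (?v + ?v + (?v + ?v)) +
          (?v + ?v + (?v + ?v) + (?v + ?v + (?v + ?v))) + a + B) = snd s a ?v"
        using arr False by (simp only:)
      show ?thesis
        using Arr.prems C r50 m False unfolding C(1)
        by (intro reach_code[where code = "[Add d d d, Add d d d, Add d d d, Add d d d,
            Const (Suc d) a, Add d d (Suc d), Add d d 50, Load d d]"]) auto
    qed
  qed (use Arr.prems in auto)
qed

definition located :: "nat \<Rightarrow> nat \<Rightarrow> state \<Rightarrow> config \<Rightarrow> bool" where
  "located p B s C \<longleftrightarrow> pc C = p \<and> represents B s (reg C) (mem C)"

lemma locatedE:
  assumes "located p B s C"
  obtains r m where "C = Config p r m" "represents B s r m"
  using assms by (cases C) (auto simp: located_def)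

lemma located_Config [simp]: "located p B s (Config q r m) \<longleftrightarrow> q = p \<and> represents B s r m"
  by (auto simp: located_def)

lemma reach_test:
  assumes "located p B s C" "wf_exp e" "embedded prog p (comp_exp e 51)"
  shows "reach prog (length (comp_exp e 51)) C (\<lambda>C. \<exists>r m.
    C = Config (p + length (comp_exp e 51)) r m \<and> represents B s r m \<and> r 51 = val e s)"
proof -
  obtain r m where C: "C = Config p r m" "represents B s r m" using assms(1) by (rule locatedE)
  show ?thesis unfolding C
    by (rule reach_mono[OF reach_comp_exp[OF C(2) assms(2) _ assms(3)]])
       (auto intro: represents_cong[OF C(2)])
qed

definition correct :: "com \<Rightarrow> state \<Rightarrow> nat \<Rightarrow> bool" where
  "correct c s t \<longleftrightarrow> (\<forall>prog p B C. embedded prog p (comp c p) \<longrightarrow> located p B s C \<longrightarrow>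
     reach prog t C (located (p + clen c) B (exec c s)))"

lemma correctD:
  "correct c s t \<Longrightarrow> embedded prog p (comp c p) \<Longrightarrow> located p B s C \<Longrightarrow>
   reach prog t C (located (p + clen c) B (exec c s))"
  unfolding correct_def by blast

lemma correct_mono: "correct c s t \<Longrightarrow> t \<le> u \<Longrightarrow> correct c s u"
  unfolding correct_def by (blast intro: reach_mono)

lemma correct_Seq:
  assumes "correct c s t" "correct d (exec c s) u"
  shows "correct (Seq c d) s (t + u)"
  unfolding correct_def
proof (intro allI impI)
  fix prog p B C assume emb: "embedded prog p (comp (Seq c d) p)" and C: "located p B s C"
  have "reach prog t C (located (p + clen c) B (exec c s))"
    using correctD[OF assms(1) _ C] emb by simp
  then show "reach prog (t + u) C (located (p + clen (Seq c d)) B (exec (Seq c d) s))"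
    by (rule reach_trans[OF _ correctD[OF assms(2), THEN reach_mono]])
       (use emb in \<open>auto simp: add.assoc\<close>)
qed

lemma correct_Assign:
  assumes "x < 50" "wf_exp e"
  shows "correct (Assign x e) s (length (comp_exp e 51) + 2)"
  unfolding correct_def
proof (intro allI impI)
  fix prog p B C assume emb: "embedded prog p (comp (Assign x e) p)" and C: "located p B s C"
  show "reach prog (length (comp_exp e 51) + 2) C
    (located (p + clen (Assign x e)) B (exec (Assign x e) s))"
    by (rule reach_trans[OF reach_test[OF C assms(2)]])
       (use emb assms in
        \<open>auto intro!: reach_code[where code = "[Const x 0, Add x x 51]"] represents_var\<close>)
qed

lemma array_address_inj:
  assumes "(B :: nat) + 16 * i + a = B + 16 * j + b" "a < 16" "b < 16"
  shows "i = j \<and> a = b"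
proof -
  have eq: "16 * i + a = 16 * j + b" using assms(1) by simp
  then have "(16 * i + a) div 16 = (16 * j + b) div 16" by simp
  then have "i = j" using assms(2,3) by simp
  then show ?thesis using eq by simp
qed

lemma represents_array:
  assumes "represents B s r m" "0 < a" "a < 16"
  shows "represents B (fst s, (snd s)(a := (snd s a)(i := v))) r (m(B + 16 * i + a := v))"
  unfolding represents_def
proof (intro conjI allI impI)
  fix b j assume b: "0 < b" "b < (16 :: nat)"
  show "(m(B + 16 * i + a := v)) (B + 16 * j + b) =
    snd (fst s, (snd s)(a := (snd s a)(i := v))) b j"
  proof (cases "b = a \<and> j = i")
    case False
    then have "B + 16 * j + b \<noteq> B + 16 * i + a" using array_address_inj[of B j b] b assms(3) by blast
    then show ?thesis using assms(1) b False by (auto simp: represents_def)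
  qed simp
qed (use assms in \<open>auto simp: represents_def\<close>)

lemma correct_Put:
  assumes "0 < a" "a < 16" "wf_exp e" "wf_exp f"
  shows "correct (Put a e f) s (length (comp_exp e 51) + 8 + length (comp_exp f 52))"
  unfolding correct_def
proof (intro allI impI)
  fix prog p B C assume emb: "embedded prog p (comp (Put a e f) p)" and C: "located p B s C"
  let ?l = "length (comp_exp e 51)" and ?k = "length (comp_exp f 52)"
  let ?P = "located (p + clen (Put a e f)) B (exec (Put a e f) s)"
  let ?addr = "B + 16 * val e s + a"
  show "reach prog (?l + 8 + ?k) C ?P"
  proof (rule reach_trans[OF reach_test[OF C assms(3)]])
    fix C' assume "\<exists>r m. C' = Config (p + ?l) r m \<and> represents B s r m \<and> r 51 = val e s"
    then obtain r m where C': "C' = Config (p + ?l) r m" "represents B s r m" "r 51 = val e s" by auto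
    have "reach prog 7 C'
      (\<lambda>C. \<exists>r. C = Config (p + ?l + 7) r m \<and> represents B s r m \<and> r 51 = ?addr)"
      unfolding C' using C' emb representsD(2)[OF C'(2)]
      by (intro reach_code[where code = "[Add 51 51 51, Add 51 51 51, Add 51 51 51, Add 51 51 51,
        Const 52 a, Add 51 51 52, Add 51 51 50]"]) auto
    then show "reach prog (7 + (?k + 1)) C' ?P"
    proof (rule reach_trans)
      fix C assume "\<exists>r. C = Config (p + ?l + 7) r m \<and> represents B s r m \<and> r 51 = ?addr"
      then obtain r where C: "C = Config (p + ?l + 7) r m" "represents B s r m" "r 51 = ?addr"
        by auto
      have embf: "embedded prog (p + ?l + 7) (comp_exp f 52)"
        using emb by (simp add: seven_Suc)
      show "reach prog (?k + 1) C ?P"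
        unfolding C
      proof (rule reach_trans[OF reach_comp_exp[OF C(2) assms(4) _ embf]])
        fix C' assume "\<exists>r'. C' = Config (p + ?l + 7 + ?k) r' m \<and> r' 52 = val f s \<and> (\<forall>x<52. r' x = r x)"
        then obtain r' where C': "C' = Config (p + ?l + 7 + ?k) r' m" "r' 52 = val f s"
          "\<forall>x<52. r' x = r x" by auto
        have rep: "represents B s r' m" by (rule represents_cong[OF C(2)]) (use C' in auto)
        show "reach prog 1 C' ?P"
          unfolding C' using emb C C' represents_array[OF rep assms(1,2)]
          by (intro reach_code[where code = "[Store 51 52]"]) (auto simp: seven_Suc)
      qed auto
    qed auto
  qed (use emb in auto)
qed

lemma correct_Cond:
  assumes "wf_exp e" "correct c s t" "correct d s u"
  shows "correct (Cond e c d) s (length (comp_exp e 51) + 3 + t + u)"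
  unfolding correct_def
proof (intro allI impI)
  fix prog p B C assume emb: "embedded prog p (comp (Cond e c d) p)" and C: "located p B s C"
  let ?l = "length (comp_exp e 51)"
  let ?P = "located (p + clen (Cond e c d)) B (exec (Cond e c d) s)"
  show "reach prog (?l + 3 + t + u) C ?P"
  proof (rule reach_trans[OF reach_test[OF C assms(1)]])
    fix C' assume "\<exists>r m. C' = Config (p + ?l) r m \<and> represents B s r m \<and> r 51 = val e s"
    then obtain r m where C': "C' = Config (p + ?l) r m" "represents B s r m" "r 51 = val e s" by auto
    have emb1: "embedded prog (pc C') [JumpZero 51 (p + ?l + 3 + clen c)]" using emb C' by simp
    show "reach prog (3 + t + u) C' ?P"
    proof (cases "val e s = 0")
      case True
      have "reach prog 1 C' (located (p + ?l + 3 + clen c) B s)"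
        by (rule reach_code[OF emb1]) (use C' True in auto)
      then show ?thesis
        by (rule reach_trans[OF _ correctD[OF assms(3), THEN reach_mono]])
           (use emb True in \<open>auto simp: numeral_3_eq_3 add.assoc\<close>)
    next
      case False
      have "reach prog 1 C' (located (p + ?l + 1) B s)"
        by (rule reach_code[OF emb1]) (use C' False in auto)
      then have "reach prog (1 + t) C' (located (p + ?l + 1 + clen c) B (exec c s))"
        by (rule reach_trans[OF _ correctD[OF assms(2)]]) (use emb in auto)
      then show ?thesis
      proof (rule reach_trans)
        fix C assume "located (p + ?l + 1 + clen c) B (exec c s) C"
        then obtain r m where "C = Config (p + ?l + 1 + clen c) r m" "represents B (exec c s) r m"
          by (rule locatedE)
        then show "reach prog 2 C ?P"
          using emb False
          by (intro reach_code[where code =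
            "[Const 51 0, JumpZero 51 (p + ?l + 3 + clen c + clen d)]"]) (auto simp: ac_simps)
      qed simp
    qed
  qed (use emb in auto)
qed

text \<open>The body runs in states other than \<open>s\<close>, so its time bound is demanded for
  every state that agrees with \<open>s\<close> on the variables left alone by the loop. The bounds
  of inner loops are among these variables when the lemma is applied.\<close>

lemma correct_For:
  assumes "i < 50" "x < 50" "i \<noteq> x" "i \<notin> vmods c" "x \<notin> vmods c"
    and "\<And>s'. fst s' x = fst s x \<Longrightarrow> (\<forall>y. y \<noteq> i \<longrightarrow> y \<notin> vmods c \<longrightarrow> fst s' y = fst s y) \<Longrightarrow> correct c s' t"
  shows "correct (For i x c) s (3 + fst s x * (t + 6))"
  unfolding correct_def
proof (intro allI impI)
  fix prog p B C assume emb: "embedded prog p (comp (For i x c) p)" and C: "located p B s C"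
  let ?s0 = "((fst s)(i := 0), snd s)"
  let ?it = "next_iter i (exec c)"
  have emb1: "embedded prog p [Const i 0]"
    and emb2: "embedded prog (p + 1) [Sub 51 x i, JumpZero 51 (p + clen c + 7)]"
    and emb3: "embedded prog (p + 3) (comp c (p + 3))"
    and emb4: "embedded prog (p + 3 + clen c) [Const 51 1, Add i i 51, Const 51 0, JumpZero 51 (p + 1)]"
    using emb by (auto simp: numeral_3_eq_3)
  \<comment> \<open>\<open>j\<close> counts the iterations still to come, starting from the test at
    \<open>p + 1\<close>; the summand 2 pays for the final test.\<close>
  have head: "reach prog (2 + j * (t + 6)) C (located (p + clen c + 7) B ((?it ^^ j) s'))"
    if "located (p + 1) B s' C" "fst s' i + j = fst s x" "fst s' x = fst s x"
      "\<forall>y. y \<noteq> i \<longrightarrow> y \<notin> vmods c \<longrightarrow> fst s' y = fst s y" for j s' C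
    using that
  proof (induction j arbitrary: s' C)
    case 0
    obtain r m where C: "C = Config (p + 1) r m" "represents B s' r m"
      using 0(1) by (rule locatedE)
    show ?case
      by (rule reach_code[where code = "[Sub 51 x i, JumpZero 51 (p + clen c + 7)]"])
         (use C emb2 0 representsD(1)[OF C(2)] assms in auto)
  next
    case (Suc j)
    obtain r m where C: "C = Config (p + 1) r m" "represents B s' r m"
      using Suc.prems(1) by (rule locatedE)
    have "reach prog 2 C (located (p + 3) B s')"
      by (rule reach_code[where code = "[Sub 51 x i, JumpZero 51 (p + clen c + 7)]"])
         (use C emb2 Suc.prems representsD(1)[OF C(2)] assms in auto)
    then have "reach prog (2 + t) C (located (p + 3 + clen c) B (exec c s'))"
      by (rule reach_trans[OF _ correctD[OF assms(6)]]) (use emb3 Suc.prems in auto)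
    then have "reach prog (6 + t) C (located (p + 1) B (?it s'))"
    proof (rule reach_trans)
      fix C assume "located (p + 3 + clen c) B (exec c s') C"
      then obtain r m where C: "C = Config (p + 3 + clen c) r m" "represents B (exec c s') r m"
        by (rule locatedE)
      show "reach prog 4 C (located (p + 1) B (?it s'))"
        by (rule reach_code[where code = "[Const 51 1, Add i i 51, Const 51 0, JumpZero 51 (p + 1)]"])
           (use emb4 C assms(1) representsD(1)[OF C(2)] in \<open>auto simp: next_iter_def intro!: represents_var\<close>)
    qed simp
    then show ?case
    proof (rule reach_trans)
      fix C assume C: "located (p + 1) B (?it s') C"
      have "reach prog (2 + j * (t + 6)) C (located (p + clen c + 7) B ((?it ^^ j) (?it s')))"
        by (rule Suc.IH[OF C])
           (use Suc.prems assms(3-5) vframe in \<open>auto simp: next_iter_def\<close>)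
      then show "reach prog (2 + j * (t + 6)) C (located (p + clen c + 7) B ((?it ^^ Suc j) s'))"
        by (simp add: funpow_Suc_right del: funpow.simps)
    qed simp
  qed
  obtain r m where Cf: "C = Config p r m" "represents B s r m" using C by (rule locatedE)
  have "reach prog 1 C (located (p + 1) B ?s0)"
    by (rule reach_code[where code = "[Const i 0]"])
       (use Cf emb1 assms(1) in \<open>auto intro: represents_var\<close>)
  then show "reach prog (3 + fst s x * (t + 6)) C
    (located (p + clen (For i x c)) B (exec (For i x c) s))"
    by (rule reach_trans[OF _ reach_mono[OF head[where j = "fst s x"]]])
       (use assms(3) in \<open>auto simp: ac_simps\<close>)
qed
text \<open>Loop bounds are not modified inside \<open>c\<close>, so their values in the initial
  state limit all loops, however deeply nested, and the time depends only on the syntax and on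
  \<open>\<beta>\<close>.\<close>

theorem correct_cost:
  assumes "wf_com c" "bounds c \<inter> vmods c = {}" "\<And>x. x \<in> bounds c \<Longrightarrow> fst s x \<le> \<beta> x"
  shows "correct c s (cost c \<beta>)"
  using assms
proof (induction c arbitrary: s)
  case (Assign x e)
  then show ?case using correct_Assign[of x e s] by simp
next
  case (Put a e f)
  then show ?case using correct_Put[of a e f s] by simp
next
  case (Seq c d)
  have "fst (exec c s) x \<le> \<beta> x" if "x \<in> bounds d" for x
  proof -
    have "x \<notin> vmods c" using Seq.prems(2) that by auto
    then show ?thesis using vframe[of x c s] Seq.prems(3)[of x] that by simp
  qed
  with Seq show ?case by (simp add: correct_Seq Int_Un_distrib Int_Un_distrib2)
next
  case (Cond e c d)
  then have "correct c s (cost c \<beta>)" "correct d s (cost d \<beta>)"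
    by (auto simp: Int_Un_distrib Int_Un_distrib2)
  then show ?case using correct_Cond[of e c s _ d] Cond.prems by simp
next
  case (For i x c)
  have "correct (For i x c) s (3 + fst s x * (cost c \<beta> + 6))"
  proof (rule correct_For)
    fix s' :: state assume s': "fst s' x = fst s x" "\<forall>y. y \<noteq> i \<longrightarrow> y \<notin> vmods c \<longrightarrow> fst s' y = fst s y"
    show "correct c s' (cost c \<beta>)"
    proof (rule For.IH)
      fix y assume y: "y \<in> bounds c"
      then have "y \<noteq> i" "y \<notin> vmods c" using For.prems(2) by auto
      then show "fst s' y \<le> \<beta> y" using s' For.prems(3) y by auto
    qed (use For.prems in auto)
  qed (use For.prems in auto)
  then show ?case by (rule correct_mono) (use For.prems in auto)
qed

text \<open>Puts the arrays behind the input, the length of which is at most \<open>3 + 3 m\<^sub>1 + 2 m\<^sub>2\<close>.\<close>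

definition prelude :: "instr list" where
  "prelude = [Const 51 1, Load 52 51, Const 51 2, Load 53 51, Add 50 52 52, Add 50 50 52,
     Add 50 50 53, Add 50 50 53, Const 51 3, Add 50 50 51]"

definition input :: "nat list \<Rightarrow> nat \<Rightarrow> nat" where
  "input inp i = (if i < length inp then inp ! i else 0)"

definition init_state :: "nat list \<Rightarrow> state" where
  "init_state inp = (\<lambda>_. 0, \<lambda>a i. if a = 0 then input inp i else 0)"

text \<open>The number 10 is the length of \<open>prelude\<close>: it is both the address at which
  the compiled program starts and the time spent before it.\<close>

theorem compile_correct:
  assumes "correct c (init_state inp) t"
    and "length inp \<le> 3 + 3 * input inp 1 + 2 * input inp 2"
  shows "computes_within (prelude @ comp c 10) inp (fst (exec c (init_state inp)) 0) (10 + t)"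
proof -
  let ?prog = "prelude @ comp c 10" and ?s = "init_state inp"
  let ?B = "3 + 3 * input inp 1 + 2 * input inp 2"
  have emb: "embedded ?prog 0 prelude" "embedded ?prog 10 (comp c 10)"
    by (auto simp: embedded_def prelude_def)
  have "reach ?prog 10 (init_config inp) (located 10 ?B ?s)"
  proof (rule reach_code[where code = prelude])
    have "represents ?B ?s ((\<lambda>_. 0)(50 := ?B)) (input inp)"
      using assms(2) by (auto simp: represents_def init_state_def input_def)
    then show "located 10 ?B ?s (fold exec_instr prelude (init_config inp))"
      by (simp add: prelude_def init_config_def input_def[symmetric, abs_def])
         (auto elim!: represents_cong)
  qed (use emb(1) in \<open>auto simp: prelude_def init_config_def\<close>)
  then have "reach ?prog (10 + t) (init_config inp) (located (10 + clen c) ?B (exec c ?s))"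
    by (rule reach_trans[OF _ correctD[OF assms(1) emb(2)]]) auto
  then obtain k where "k \<le> 10 + t"
    "located (10 + clen c) ?B (exec c ?s) ((step ?prog ^^ k) (init_config inp))"
    by (auto simp: reach_def)
  then show ?thesis
    unfolding computes_within_def Let_def
    by (intro exI[of _ k]) (auto simp: located_def represents_def halted_def prelude_def)
qed

section \<open>Dynamic programming over the states of the game\<close>

text \<open>The second hypothesis makes the invariant insensitive to the loop counter. The rule
  tracks the counter itself, so that \<open>I\<close> need not mention it.\<close>

lemma exec_For_inv:
  assumes "i \<notin> vmods c"
    and "\<And>k s v. I k s \<Longrightarrow> I k ((fst s)(i := v), snd s)"
    and "I 0 s"
    and "\<And>k s'. k < fst s x \<Longrightarrow> fst s' i = k \<Longrightarrow> I k s' \<Longrightarrow> I (Suc k) (exec c s')"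
  shows "I (fst s x) (exec (For i x c) s)"
proof -
  let ?s = "((fst s)(i := 0), snd s)"
  have "I j ((next_iter i (exec c) ^^ j) ?s) \<and> fst ((next_iter i (exec c) ^^ j) ?s) i = j"
    if "j \<le> fst s x" for j
    using that
  proof (induction j)
    case 0
    show ?case
    proof
      show "I 0 ((next_iter i (exec c) ^^ 0) ?s)"
        using assms(2)[OF assms(3), of 0] by (simp only: funpow.simps id_apply)
    qed simp
  next
    case (Suc j)
    define t where "t = (next_iter i (exec c) ^^ j) ?s"
    have t: "I j t" "fst t i = j"
      unfolding t_def using Suc.IH[OF Suc_leD[OF Suc.prems]] by blast+
    then have "I (Suc j) (exec c t)" using assms(4)[of j t] Suc.prems by simp
    then have "I (Suc j) (next_iter i (exec c) t)" unfolding next_iter_def by (rule assms(2))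
    moreover have "fst (next_iter i (exec c) t) i = Suc j"
      using t vframe[OF assms(1)] by (simp add: next_iter_def)
    ultimately show ?case by (simp only: funpow.simps comp_apply t_def)
  qed
  then show ?thesis by simp
qed

declare exec.simps(5) [simp del]

section \<open>The code of the dynamic program\<close>

abbreviation (input) "vN \<equiv> 28 :: nat"
abbreviation (input) "vM \<equiv> 2 :: nat"
abbreviation (input) "vR \<equiv> 3 :: nat"
abbreviation (input) "vW \<equiv> 4 :: nat"
abbreviation (input) "vS \<equiv> 5 :: nat"
abbreviation (input) "vWW \<equiv> 6 :: nat"
abbreviation (input) "vNN \<equiv> 7 :: nat"
abbreviation (input) "vP \<equiv> 8 :: nat"
abbreviation (input) "vJ \<equiv> 9 :: nat"
abbreviation (input) "vV \<equiv> 10 :: nat"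
abbreviation (input) "vI \<equiv> 11 :: nat"
abbreviation (input) "vX \<equiv> 12 :: nat"
abbreviation (input) "vQ \<equiv> 13 :: nat"
abbreviation (input) "vT \<equiv> 14 :: nat"
abbreviation (input) "vC \<equiv> 15 :: nat"
abbreviation (input) "vD \<equiv> 16 :: nat"
abbreviation (input) "vE \<equiv> 17 :: nat"
abbreviation (input) "vKV \<equiv> 18 :: nat"
abbreviation (input) "vAny \<equiv> 19 :: nat"
abbreviation (input) "vAll \<equiv> 20 :: nat"
abbreviation (input) "vRes \<equiv> 21 :: nat"
abbreviation (input) "vHit \<equiv> 22 :: nat"
abbreviation (input) "vX1 \<equiv> 23 :: nat"
abbreviation (input) "vX2 \<equiv> 24 :: nat"
abbreviation (input) "vCode \<equiv> 25 :: nat"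
abbreviation (input) "vWon \<equiv> 26 :: nat"
abbreviation (input) "vNop \<equiv> 27 :: nat"

abbreviation (input) "aCh \<equiv> 15 :: nat"
abbreviation (input) "aK \<equiv> 2 :: nat"
abbreviation (input) "aH \<equiv> 3 :: nat"
abbreviation (input) "aStr \<equiv> 4 :: nat"
abbreviation (input) "aD \<equiv> 5 :: nat"
abbreviation (input) "aNU \<equiv> 6 :: nat"
abbreviation (input) "aPar \<equiv> 7 :: nat"
abbreviation (input) "aTab \<equiv> 8 :: nat"
abbreviation (input) "aSz \<equiv> 9 :: nat"
abbreviation (input) "aE1 \<equiv> 10 :: nat"
abbreviation (input) "aE2 \<equiv> 11 :: nat"
abbreviation (input) "aP1 \<equiv> 12 :: nat"
abbreviation (input) "aP2 \<equiv> 13 :: nat"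

abbreviation (input) "nop \<equiv> Assign vNop (Num 0)"

text \<open>Subtraction is truncated, so the sum of the two differences is the distance of the
  values.\<close>

definition eqE :: "exp \<Rightarrow> exp \<Rightarrow> exp" where
  "eqE e f = Minus (Num 1) (Plus (Minus e f) (Minus f e))"

lemma val_eqE [simp]: "val (eqE e f) s = (if val e s = val f s then 1 else 0)"
  by (auto simp: eqE_def)

abbreviation (input) "ltE e f \<equiv> Minus f e"

fun seqs :: "com list \<Rightarrow> com" where
  "seqs [] = nop"
| "seqs [c] = c"
| "seqs (c # cs) = Seq c (seqs cs)"

text \<open>Treats an edge in the direction from \<open>vX1\<close> to \<open>vX2\<close>, so
  \<open>scan_edges\<close> runs it twice per winning set. Parities are looked up in a table because
  expressions cannot divide.\<close>

definition try_edge :: com where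
  "try_edge =
     Cond (eqE (Arr aCh (Var vX1)) (Var vC))
       (Cond (eqE (Arr aK (Var vX1)) (Var vKV))
         (Cond (ltE (Arr aK (Var vX2)) (Arr aD (Plus (Var vW) (Arr aCh (Var vX2)))))
           (Seq (Cond (Arr aPar (Plus (Arr aK (Var vX2)) (Var vN))) (Assign vHit (Num 1)) nop)
             (Cond (ltE (Arr aNU (Arr aCh (Var vX2))) (Plus (Arr aK (Var vX2)) (Num 1)))
               (Put aNU (Arr aCh (Var vX2)) (Plus (Arr aK (Var vX2)) (Num 1))) nop)) nop) nop) nop"

definition scan_edges :: com where
  "scan_edges = For vJ vM (Cond (eqE (Arr aSz (Var vJ)) (Num 2))
     (seqs [Assign vX1 (Arr aE1 (Var vJ)), Assign vX2 (Arr aE2 (Var vJ)), try_edge,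
            Assign vX1 (Arr aE2 (Var vJ)), Assign vX2 (Arr aE1 (Var vJ)), try_edge]) nop)"

text \<open>The common form of \<open>next_marks\<close> and of the initial marks. With the set
  \<open>Q\<close> of new marks as a parameter, a scan of the winning sets can insert them one at a
  time.\<close>

definition max_marks ::
    "(nat \<Rightarrow> nat) \<Rightarrow> (nat \<Rightarrow> nat) \<Rightarrow> (nat \<times> nat) set \<Rightarrow> nat \<Rightarrow> nat" where
  "max_marks b r Q e = Max (insert (b e) {Suc k | k. k < r e \<and> (e, k) \<in> Q})"

lemma max_marks_empty [simp]: "max_marks b r {} e = b e"
  by (simp add: max_marks_def)

lemma max_marks_insert:
  "max_marks b r (insert (e', k') Q) e =
     (if e = e' \<and> k' < r e then max (max_marks b r Q e) (Suc k') else max_marks b r Q e)"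
proof (cases "e = e' \<and> k' < r e")
  case True
  have fin: "finite {Suc k | k. k < r e \<and> (e, k) \<in> Q}"
    by (rule finite_subset[of _ "Suc ` {..<r e}"]) auto
  have eq: "insert (b e) {Suc k | k. k < r e \<and> (e, k) \<in> insert (e', k') Q} =
    insert (Suc k') (insert (b e) {Suc k | k. k < r e \<and> (e, k) \<in> Q})" using True by auto
  show ?thesis
    unfolding max_marks_def eq by (subst Max_insert) (use fin True in \<open>auto simp: max.commute\<close>)
next
  case False
  then have "{Suc k | k. k < r e \<and> (e, k) \<in> insert (e', k') Q} = {Suc k | k. k < r e \<and> (e, k) \<in> Q}"
    by auto
  then show ?thesis using False by (auto simp: max_marks_def)
qed

lemma max_marks_le:
  assumes "b e \<le> x" "r e \<le> x"
  shows "max_marks b r Q e \<le> x"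
proof -
  have fin: "finite {Suc k | k. k < r e \<and> (e, k) \<in> Q}"
    by (rule finite_subset[of _ "Suc ` {..<r e}"]) auto
  show ?thesis unfolding max_marks_def using assms fin by (subst Max_le_iff) auto
qed

lemma try_edge_mods: "vmods try_edge = {vHit, vNop}" "amods try_edge = {aNU}"
  by (auto simp: try_edge_def)

lemma scan_edges_mods: "vmods scan_edges = {vJ, vX1, vX2, vHit, vNop}" "amods scan_edges = {aNU}"
  by (auto simp: scan_edges_def try_edge_mods)

text \<open>
  Of the current state, \<open>u c\<close> is kept in entry \<open>c\<close> of the array \<open>aD\<close> and \<open>r c\<close> in entry \<open>w + c\<close>. The
  array \<open>aNU\<close> receives the new \<open>u\<close> after a move of Maker and a reply of Breaker.
\<close>

definition load_marks :: com where
  "load_marks = seqs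
     [For vE vW (Put aNU (Var vE) (Arr aD (Var vE))),
      Cond (eqE (Arr aD (Var vD)) (Plus (Arr aD (Plus (Var vW) (Var vD))) (Num 1)))
        (Put aNU (Var vD) (Num 0)) nop,
      Assign vHit (Num 0)]"

lemma load_marks_mods: "vmods load_marks = {vE, vHit, vNop}" "amods load_marks = {aNU}"
  by (auto simp: load_marks_def)

text \<open>Products of digits and weights are formed by repeated addition, the machine having no
  multiplication. All digits are at most \<open>n\<close>, which therefore serves as the loop
  bound.\<close>

definition encode :: com where
  "encode = Seq (Assign vCode (Num 0))
     (For vE vW (For vI vN (Seq
        (Cond (ltE (Var vI) (Arr aNU (Var vE)))
          (Assign vCode (Plus (Var vCode) (Arr aStr (Var vE)))) nop)
        (Cond (ltE (Var vI) (Arr aD (Plus (Var vW) (Var vE))))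
          (Assign vCode (Plus (Var vCode) (Arr aStr (Plus (Var vW) (Var vE))))) nop))))"

lemma encode_mods: "vmods encode = {vCode, vE, vI, vNop}" "amods encode = {}"
  by (auto simp: encode_def)

definition refute_move :: com where
  "refute_move = Cond (Plus (Var vHit) (Arr aTab (Var vCode))) nop (Assign vAll (Num 0))"

text \<open>The move is made in \<open>aD\<close> itself and undone at the end, so one decoded copy
  of the state serves all pairs of a move and a reply.\<close>

definition reply :: com where
  "reply = Cond (Arr aD (Plus (Var vW) (Var vD))) (seqs
     [Assign vAny (Num 1),
      Put aD (Plus (Var vW) (Var vD)) (Minus (Arr aD (Plus (Var vW) (Var vD))) (Num 1)),
      load_marks, scan_edges, encode,
      refute_move,
      Put aD (Plus (Var vW) (Var vD)) (Plus (Arr aD (Plus (Var vW) (Var vD))) (Num 1))]) nop"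

lemma reply_mods:
  "vmods reply = {vAny, vAll, vHit, vE, vJ, vX1, vX2, vI, vCode, vNop}" "amods reply = {aD, aNU}"
  by (auto simp: reply_def refute_move_def load_marks_mods scan_edges_mods encode_mods)

text \<open>\<open>vAny\<close> records whether Breaker has a reply at all. Without one the board is
  exhausted, and \<open>vAll\<close>, which is still 1, must not count as a win.\<close>

definition maker_move :: com where
  "maker_move = Cond (Arr aD (Plus (Var vW) (Var vC)))
     (Cond (eqE (Arr aD (Var vC)) (Arr aD (Plus (Var vW) (Var vC)))) (Assign vRes (Num 1))
       (seqs
         [Put aD (Plus (Var vW) (Var vC)) (Minus (Arr aD (Plus (Var vW) (Var vC))) (Num 1)),
          Assign vKV (Arr aD (Plus (Var vW) (Var vC))),
          Assign vAny (Num 0), Assign vAll (Num 1), For vD vW reply,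
          Cond (Var vAny) (Cond (Var vAll) (Assign vRes (Num 1)) nop) nop,
          Put aD (Plus (Var vW) (Var vC)) (Plus (Arr aD (Plus (Var vW) (Var vC))) (Num 1))])) nop"

lemma maker_move_mods:
  "vmods maker_move = {vKV, vRes, vD} \<union> vmods reply" "amods maker_move = {aD, aNU}"
  by (auto simp: maker_move_def reply_mods)

definition evaluate :: com where
  "evaluate = Seq (Assign vRes (Num 0)) (For vC vW maker_move)"

lemma evaluate_mods:
  "vmods evaluate = {vRes, vC} \<union> vmods maker_move" "amods evaluate = {aD, aNU}"
  by (auto simp: evaluate_def maker_move_mods)

text \<open>Digits are extracted from the largest weight downwards, with division by repeated
  subtraction.\<close>

definition decode :: com where
  "decode = Seq (Assign vX (Var vT)) (For vJ vWW (seqs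
     [Assign vQ (Minus (Minus (Var vWW) (Num 1)) (Var vJ)),
      Put aD (Var vQ) (Num 0),
      For vI vN (Cond (ltE (Var vX) (Arr aStr (Var vQ))) nop
        (Seq (Assign vX (Minus (Var vX) (Arr aStr (Var vQ))))
          (Put aD (Var vQ) (Plus (Arr aD (Var vQ)) (Num 1)))))]))"

lemma decode_mods: "vmods decode = {vX, vJ, vQ, vI, vNop}" "amods decode = {aD}"
  by (auto simp: decode_def)

definition fill_table :: com where
  "fill_table = For vT vS (seqs [decode, evaluate, Put aTab (Var vT) (Var vRes)])"

lemma fill_table_mods: "vmods fill_table = {vT} \<union> vmods decode \<union> vmods evaluate"
  "amods fill_table = {aD, aNU, aTab}"
  by (auto simp: fill_table_def evaluate_mods decode_mods)

text \<open>
  The tables computed from the input: vertex \<open>v < n\<close> belongs to chain \<open>ch v\<close>, with \<open>ab v\<close>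
  vertices above it. Chain \<open>c\<close> has height \<open>H c\<close>, winning set \<open>j\<close> has size \<open>sz j\<close> and its elements
  are \<open>e1 j\<close> and \<open>e2 j\<close>.
\<close>

locale game_tables =
  fixes n m w :: nat and ch ab sz e1 e2 H :: "nat \<Rightarrow> nat"
  assumes ch_less: "v < n \<Longrightarrow> ch v < w"
    and ab_less: "v < n \<Longrightarrow> ab v < H (ch v)"
    and coord_inj: "v < n \<Longrightarrow> v' < n \<Longrightarrow> ch v = ch v' \<Longrightarrow> ab v = ab v' \<Longrightarrow> v = v'"
    and H_le: "c < w \<Longrightarrow> H c \<le> n"
    and edge: "j < m \<Longrightarrow> sz j = 2 \<Longrightarrow> e1 j < n \<and> e2 j < n \<and> e1 j \<noteq> e2 j"
    and singleton: "j < m \<Longrightarrow> sz j = 1 \<Longrightarrow> e1 j < n"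
begin

abbreviation coord :: "nat \<Rightarrow> nat \<times> nat" where
  "coord v \<equiv> (ch v, ab v)"

text \<open>The adjacency known after \<open>l\<close> rounds of \<open>scan_edges\<close>, for use
  in its loop invariant.\<close>

definition adj_upto :: "nat \<Rightarrow> nat \<times> nat \<Rightarrow> nat \<times> nat \<Rightarrow> bool" where
  "adj_upto l x y \<longleftrightarrow> (\<exists>j<l. sz j = 2 \<and>
     (x = coord (e1 j) \<and> y = coord (e2 j) \<or> x = coord (e2 j) \<and> y = coord (e1 j)))"

definition adj :: "nat \<times> nat \<Rightarrow> nat \<times> nat \<Rightarrow> bool" where
  "adj = adj_upto m"

sublocale chain_game_dp w adj n
proof
  fix x y
  show "adj x y \<Longrightarrow> adj y x" by (auto simp: adj_def adj_upto_def)
  show "\<not> adj x x"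
  proof
    assume "adj x x"
    then obtain j where "j < m" "sz j = 2" "coord (e1 j) = coord (e2 j)"
      by (auto simp: adj_def adj_upto_def)
    then show False using coord_inj[of "e1 j" "e2 j"] edge[of j] by auto
  qed
  show "adj x y \<Longrightarrow> fst y < w" using edge ch_less by (auto simp: adj_def adj_upto_def)
qed

lemma next_marks_eq:
  "next_marks c d r u = max_marks (\<lambda>e. if e = d \<and> u d = lower r c d then 0 else u e)
     (lower (lower r c) d) (Collect (adj (c, r c - 1)))"
  by (auto simp: next_marks_def max_marks_def fun_eq_iff)

lemma adj_upto_0 [simp]: "Collect (adj_upto 0 x) = {}"
  by (simp add: adj_upto_def)

lemma adj_upto_Suc_iff: "adj_upto (Suc j) x y \<longleftrightarrow> adj_upto j x y \<or> sz j = 2 \<and>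
    (x = coord (e1 j) \<and> y = coord (e2 j) \<or> x = coord (e2 j) \<and> y = coord (e1 j))"
  unfolding adj_upto_def less_Suc_eq by blast

lemma adj_upto_Suc:
  "Collect (adj_upto (Suc j) x) =
     (let Q = Collect (adj_upto j x);
          Q = (if sz j = 2 \<and> coord (e1 j) = x then insert (coord (e2 j)) Q else Q)
      in if sz j = 2 \<and> coord (e2 j) = x then insert (coord (e1 j)) Q else Q)"
  by (auto simp: adj_upto_Suc_iff Let_def)

definition hits :: "(nat \<Rightarrow> nat) \<Rightarrow> (nat \<times> nat) set \<Rightarrow> bool" where
  "hits r Q \<longleftrightarrow> (\<exists>(e, k)\<in>Q. k < r e \<and> odd (k + n))"

lemma hits_bad_eq: "hits_bad c r r' \<longleftrightarrow> hits r' (Collect (adj (c, r c - 1)))"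
  by (auto simp: hits_bad_def hits_def)

text \<open>Weights of a mixed radix system with \<open>2 * w\<close> digits and radices
  \<open>H c + 1\<close>. The digits below \<open>w\<close> hold the marks \<open>u\<close>, the
  others the counts \<open>r\<close>, so \<open>stride (w + w)\<close> is the number of entries of
  the table.\<close>

primrec stride :: "nat \<Rightarrow> nat" where
  "stride 0 = 1"
| "stride (Suc j) = stride j * Suc (if j < w then H j else H (j - w))"

definition tables :: "state \<Rightarrow> bool" where
  "tables s \<longleftrightarrow> fst s vN = n \<and> fst s vM = m \<and> fst s vW = w \<and> fst s vWW = w + w \<and>
     (\<forall>v<n. snd s aCh v = ch v) \<and> (\<forall>v<n. snd s aK v = ab v) \<and>
     (\<forall>c<w. snd s aH c = H c) \<and>
     (\<forall>j<m. snd s aSz j = sz j \<and> snd s aE1 j = e1 j \<and> snd s aE2 j = e2 j) \<and>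
     (\<forall>i\<le>n + n. snd s aPar i = of_bool (odd i))"

lemma tables_cong:
  assumes "tables s" "\<And>x. x \<in> {vN, vM, vW, vWW} \<Longrightarrow> fst s' x = fst s x"
    "\<And>a. a \<in> {aCh, aK, aH, aSz, aE1, aE2, aPar} \<Longrightarrow> snd s' a = snd s a"
  shows "tables s'"
  using assms unfolding tables_def by (simp)

lemma tables_exec:
  assumes "tables s" "vmods c \<inter> {vN, vM, vW, vWW} = {}"
    "amods c \<inter> {aCh, aK, aH, aSz, aE1, aE2, aPar} = {}"
  shows "tables (exec c s)"
  by (rule tables_cong[OF assms(1)]; rule vframe aframe) (use assms in blast)+

lemma tables_var [simp]:
  "x \<notin> {vN, vM, vW, vWW} \<Longrightarrow> tables (f(x := v), a) \<longleftrightarrow> tables (f, a)"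
  unfolding tables_def by (auto)

section \<open>Evaluating one state\<close>

lemma exec_try_edge:
  assumes t: "tables s" and c: "fst s vC = c" "fst s vKV = kv"
    and x: "fst s vX1 = x1" "fst s vX2 = x2" "x1 < n" "x2 < n"
    and D: "\<And>e. e < w \<Longrightarrow> snd s aD (w + e) = r e"
    and NU: "\<And>e. e < w \<Longrightarrow> snd s aNU e = max_marks b r Q e"
    and hit: "fst s vHit = of_bool (hits r Q)"
  defines "Q' \<equiv> (if coord x1 = (c, kv) then insert (coord x2) Q else Q)"
  shows "(\<forall>e<w. snd (exec try_edge s) aNU e = max_marks b r Q' e) \<and>
    fst (exec try_edge s) vHit = of_bool (hits r Q')"
proof -
  have tab: "snd s aCh x1 = ch x1" "snd s aCh x2 = ch x2" "snd s aK x1 = ab x1" "snd s aK x2 = ab x2"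
    "fst s vN = n" "fst s vW = w" "snd s aD (w + ch x2) = r (ch x2)"
    "snd s aNU (ch x2) = max_marks b r Q (ch x2)"
    "snd s aPar (ab x2 + n) = of_bool (odd (ab x2 + n))"
    using t x D[of "ch x2"] NU[of "ch x2"] ch_less[of x2] ab_less[of x2] H_le[of "ch x2"]
    by (auto simp: tables_def)
  show ?thesis
  proof (cases "coord x1 = (c, kv) \<and> ab x2 < r (ch x2)")
    case True
    then have Q': "Q' = insert (coord x2) Q" by (simp add: Q'_def)
    have "hits r Q' \<longleftrightarrow> hits r Q \<or> odd (ab x2 + n)" using True by (auto simp: hits_def Q')
    then show ?thesis
      using True tab c x hit NU
      by (auto simp: try_edge_def Q' max_marks_insert max_def)
  next
    case False
    then have "hits r Q' = hits r Q" by (auto simp: hits_def Q'_def)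
    moreover have "max_marks b r Q' e = max_marks b r Q e" for e
      using False by (auto simp: Q'_def max_marks_insert)
    ultimately show ?thesis
      using False tab c x hit NU by (auto simp: try_edge_def)
  qed
qed

lemma exec_scan_edges:
  assumes t: "tables s" and c: "fst s vC = c" "fst s vKV = kv"
    and D: "\<And>e. e < w \<Longrightarrow> snd s aD (w + e) = r e"
    and NU: "\<And>e. e < w \<Longrightarrow> snd s aNU e = b e" and hit: "fst s vHit = 0"
  shows "(\<forall>e<w. snd (exec scan_edges s) aNU e = max_marks b r (Collect (adj (c, kv))) e) \<and>
    fst (exec scan_edges s) vHit = of_bool (hits r (Collect (adj (c, kv))))"
proof -
  let ?Q = "\<lambda>j. Collect (adj_upto j (c, kv))"
  define I where "I j s \<longleftrightarrow> tables s \<and> fst s vC = c \<and> fst s vKV = kv \<and>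
    (\<forall>e<w. snd s aD (w + e) = r e) \<and> (\<forall>e<w. snd s aNU e = max_marks b r (?Q j) e) \<and>
    fst s vHit = of_bool (hits r (?Q j))" for j s
  have "I (fst s vM) (exec scan_edges s)"
    unfolding scan_edges_def
  proof (rule exec_For_inv)
    show "I k ((fst s)(vJ := v), snd s)" if "I k s" for k s v
      using that by (simp add: I_def)
    show "I 0 s" using assms by (auto simp: I_def hits_def)
    fix j s' assume j: "j < fst s vM" "fst s' vJ = j" and I: "I j s'"
    have jm: "j < m" using j t by (auto simp: tables_def)
    have tj: "snd s' aSz j = sz j" "snd s' aE1 j = e1 j" "snd s' aE2 j = e2 j"
      using I jm by (auto simp: I_def tables_def)
    let ?body = "Cond (eqE (Arr aSz (Var vJ)) (Num 2))
     (seqs [Assign vX1 (Arr aE1 (Var vJ)), Assign vX2 (Arr aE2 (Var vJ)), try_edge,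
            Assign vX1 (Arr aE2 (Var vJ)), Assign vX2 (Arr aE1 (Var vJ)), try_edge]) nop"
    show "I (Suc j) (exec ?body s')"
    proof (cases "sz j = 2")
      case False
      then show ?thesis using I tj j by (simp add: I_def adj_upto_Suc Let_def)
    next
      case True
      have e: "e1 j < n" "e2 j < n" using edge[OF jm True] by auto
      define s1 where "s1 = ((fst s')(vX1 := e1 j, vX2 := e2 j), snd s')"
      define s2 where "s2 = exec try_edge s1"
      define Q1 where "Q1 = (if coord (e1 j) = (c, kv) then insert (coord (e2 j)) (?Q j) else ?Q j)"
      define s3 where "s3 = ((fst s2)(vX1 := e2 j, vX2 := e1 j), snd s2)"
      define s4 where "s4 = exec try_edge s3"
      have fr: "fst s2 x = fst s1 x" "fst s4 x = fst s3 x" if "x \<notin> {vHit, vNop}" for x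
        unfolding s2_def s4_def using that by (simp_all add: vframe try_edge_mods)
      have afr: "snd s2 x = snd s1 x" "snd s4 x = snd s3 x" if "x \<noteq> aNU" for x
        unfolding s2_def s4_def using that by (simp_all add: aframe try_edge_mods)
      have t1: "tables s1" using I by (simp add: I_def s1_def)
      have t2: "tables s2" unfolding s2_def
        by (rule tables_exec[OF t1]) (auto simp: try_edge_mods)
      have t3: "tables s3" using t2 by (simp add: s3_def)
      have t4: "tables s4" unfolding s4_def
        by (rule tables_exec[OF t3]) (auto simp: try_edge_mods)
      have 2: "(\<forall>e<w. snd s2 aNU e = max_marks b r Q1 e) \<and> fst s2 vHit = of_bool (hits r Q1)"
        unfolding s2_def Q1_def
        by (rule exec_try_edge[OF t1]) (use I e in \<open>simp_all add: I_def s1_def\<close>)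
      have "?Q (Suc j) = (if coord (e2 j) = (c, kv) then insert (coord (e1 j)) Q1 else Q1)"
        using True by (simp add: adj_upto_Suc Let_def Q1_def)
      then have 4: "(\<forall>e<w. snd s4 aNU e = max_marks b r (?Q (Suc j)) e) \<and>
        fst s4 vHit = of_bool (hits r (?Q (Suc j)))"
        unfolding s4_def
        by (simp only:) (rule exec_try_edge[OF t3],
            use I e 2 fr afr in \<open>simp_all add: I_def s3_def s1_def\<close>)
      have "exec ?body s' = s4"
        using True j tj fr(1)[of vJ] afr(1)[of aE1] afr(1)[of aE2]
        by (simp add: s4_def s3_def s2_def s1_def)
      then show ?thesis
        using 4 t4 I fr afr by (simp add: I_def s3_def s1_def)
    qed
  qed (auto simp: try_edge_mods)
  moreover have "fst s vM = m" using t by (simp add: tables_def)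
  ultimately show ?thesis by (simp add: I_def adj_def)
qed


text \<open>The reply has already been subtracted in \<open>aD\<close>, so it was the marked vertex
  of chain \<open>d\<close> exactly if \<open>u d\<close> is one more than the entry at
  \<open>w + d\<close>.\<close>

lemma exec_load_marks:
  assumes "fst s vW = w" "fst s vD = d" "d < w"
  shows "(\<forall>e<w. snd (exec load_marks s) aNU e =
      (if e = d \<and> snd s aD d = Suc (snd s aD (w + d)) then 0 else snd s aD e)) \<and>
    fst (exec load_marks s) vHit = 0"
proof -
  define s1 where "s1 = exec (For vE vW (Put aNU (Var vE) (Arr aD (Var vE)))) s"
  have "(\<forall>e<fst s vW. snd s1 aNU e = snd s aD e) \<and> snd s1 aD = snd s aD"
    unfolding s1_def
    by (rule exec_For_inv[where I = "\<lambda>k s'. (\<forall>e<k. snd s' aNU e = snd s aD e) \<and> snd s' aD = snd s aD"])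
       (auto simp: less_Suc_eq)
  moreover have "fst s1 vW = fst s vW" "fst s1 vD = fst s vD"
    unfolding s1_def by (simp_all add: vframe)
  ultimately show ?thesis
    using assms by (auto simp: load_marks_def s1_def[symmetric])
qed

definition code_of :: "(nat \<Rightarrow> nat) \<Rightarrow> (nat \<Rightarrow> nat) \<Rightarrow> nat" where
  "code_of r u = (\<Sum>e<w. u e * stride e) + (\<Sum>e<w. r e * stride (w + e))"

definition strides :: "state \<Rightarrow> bool" where
  "strides s \<longleftrightarrow> (\<forall>q<w + w. snd s aStr q = stride q)"

lemma exec_encode:
  assumes "tables s" "strides s"
    and NU: "\<And>e. e < w \<Longrightarrow> snd s aNU e = u e \<and> u e \<le> n"
    and D: "\<And>e. e < w \<Longrightarrow> snd s aD (w + e) = r e \<and> r e \<le> n"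
  shows "fst (exec encode s) vCode = code_of r u"
proof -
  let ?g = "\<lambda>e. u e * stride e + r e * stride (w + e)"
  let ?inner = "For vI vN (Seq
        (Cond (ltE (Var vI) (Arr aNU (Var vE)))
          (Assign vCode (Plus (Var vCode) (Arr aStr (Var vE)))) nop)
        (Cond (ltE (Var vI) (Arr aD (Plus (Var vW) (Var vE))))
          (Assign vCode (Plus (Var vCode) (Arr aStr (Plus (Var vW) (Var vE))))) nop))"
  have inner: "fst (exec ?inner s') vCode = fst s' vCode + ?g e"
    if e: "e < w" "fst s' vE = e" and s': "fst s' vN = n" "fst s' vW = w" "snd s' = snd s" for s' e
  proof -
    define I where "I i s'' \<longleftrightarrow> fst s'' vE = e \<and> fst s'' vW = w \<and> snd s'' = snd s \<and>
      fst s'' vCode = fst s' vCode + min i (u e) * stride e + min i (r e) * stride (w + e)" for i s''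
    have "I (fst s' vN) (exec ?inner s')"
    proof (rule exec_For_inv)
      show "I 0 s'" using e s' by (simp add: I_def)
      fix i s'' assume "fst s'' vI = i" "I i s''"
      then show "I (Suc i) (exec (Seq
        (Cond (ltE (Var vI) (Arr aNU (Var vE)))
          (Assign vCode (Plus (Var vCode) (Arr aStr (Var vE)))) nop)
        (Cond (ltE (Var vI) (Arr aD (Plus (Var vW) (Var vE))))
          (Assign vCode (Plus (Var vCode) (Arr aStr (Plus (Var vW) (Var vE))))) nop)) s'')"
        using NU[OF e(1)] D[OF e(1)] assms(2) e(1)
        by (auto simp: I_def strides_def min_def not_less_eq_eq)
    qed (auto simp: I_def)
    then show ?thesis using s' NU[OF e(1)] D[OF e(1)] by (auto simp: I_def min_absorb2)
  qed
  define s0 where "s0 = ((fst s)(vCode := 0), snd s)"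
  define I where "I k s' \<longleftrightarrow> fst s' vN = n \<and> fst s' vW = w \<and> snd s' = snd s \<and>
    fst s' vCode = (\<Sum>e<k. ?g e)" for k s'
  have s0: "fst s0 vN = n" "fst s0 vW = w" using assms(1) by (auto simp: tables_def s0_def)
  have "I (fst s0 vW) (exec (For vE vW ?inner) s0)"
  proof (rule exec_For_inv)
    show "I 0 s0" using s0 by (auto simp: I_def s0_def)
    fix k s' assume k: "k < fst s0 vW" "fst s' vE = k" and I: "I k s'"
    have fr: "fst (exec ?inner s') vN = fst s' vN" "fst (exec ?inner s') vW = fst s' vW"
      by (simp_all add: vframe)
    have "snd (exec ?inner s') a = snd s' a" for a by (rule aframe) simp
    then have "snd (exec ?inner s') = snd s'" by blast
    then show "I (Suc k) (exec ?inner s')"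
      using inner[of k s'] k s0 I fr by (simp add: I_def)
  qed (auto simp: I_def)
  then show ?thesis
    using s0 by (simp add: encode_def s0_def[symmetric] I_def code_of_def sum.distrib)
qed

text \<open>No relation between \<open>r\<close> and \<open>u\<close> is demanded, neither
  \<open>u e \<le> r e\<close> nor a parity: \<open>W\<close> is defined on senseless states as
  well, so the table is filled code by code without a test.\<close>

definition table_upto :: "nat \<Rightarrow> state \<Rightarrow> bool" where
  "table_upto l s \<longleftrightarrow> (\<forall>r u. (\<forall>e<w. r e \<le> H e \<and> u e \<le> H e) \<longrightarrow> code_of r u < l \<longrightarrow>
     snd s aTab (code_of r u) = of_bool (W r u))"

lemma exec_reply:
  assumes t: "tables s" "strides s" "table_upto l s"
    and c: "c < w" "fst s vC = c" "fst s vKV = r c - 1" "0 < r c"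
    and d: "d < w" "fst s vD = d"
    and u: "\<And>e. e < w \<Longrightarrow> snd s aD e = u e \<and> u e \<le> H e"
    and r: "\<And>e. e < w \<Longrightarrow> snd s aD (w + e) = lower r c e \<and> r e \<le> H e"
    and l: "\<And>u'. 0 < lower r c d \<Longrightarrow> (\<forall>e<w. u' e \<le> H e) \<Longrightarrow> code_of (lower (lower r c) d) u' < l"
  shows "snd (exec reply s) aD = snd s aD \<and>
    fst (exec reply s) vAny = (if 0 < lower r c d then 1 else fst s vAny) \<and>
    fst (exec reply s) vAll =
      (if 0 < lower r c d \<and> \<not> (hits_bad c r (lower (lower r c) d) \<or>
          W (lower (lower r c) d) (next_marks c d r u)) then 0 else fst s vAll)"
proof -
  have sW: "fst s vW = w" using t(1) by (simp add: tables_def)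
  show ?thesis
  proof (cases "0 < lower r c d")
    case False
    then show ?thesis using r[OF d(1)] d sW by (simp add: reply_def)
  next
    case True
    let ?r = "lower (lower r c) d"
    define s1 where "s1 = ((fst s)(vAny := 1), (snd s)(aD := (snd s aD)(w + d := snd s aD (w + d) - 1)))"
    define s2 where "s2 = exec load_marks s1"
    define s3 where "s3 = exec scan_edges s2"
    define s4 where "s4 = exec encode s3"
    have f2: "fst s2 x = fst s1 x" if "x \<notin> {vE, vHit, vNop}" for x
      unfolding s2_def by (rule vframe) (use that in \<open>simp add: load_marks_mods\<close>)
    have f3: "fst s3 x = fst s2 x" if "x \<notin> {vJ, vX1, vX2, vHit, vNop}" for x
      unfolding s3_def by (rule vframe) (use that in \<open>simp add: scan_edges_mods\<close>)
    have f4: "fst s4 x = fst s3 x" if "x \<notin> {vCode, vE, vI, vNop}" for x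
      unfolding s4_def by (rule vframe) (use that in \<open>simp add: encode_mods\<close>)
    have a2: "snd s2 a = snd s1 a" if "a \<noteq> aNU" for a
      unfolding s2_def by (rule aframe) (use that in \<open>simp add: load_marks_mods\<close>)
    have a3: "snd s3 a = snd s2 a" if "a \<noteq> aNU" for a
      unfolding s3_def by (rule aframe) (use that in \<open>simp add: scan_edges_mods\<close>)
    have a4: "snd s4 a = snd s3 a" for a
      unfolding s4_def by (rule aframe) (simp add: encode_mods)
    have t1: "tables s1"
      by (rule tables_cong[OF t(1)]) (auto simp: s1_def)
    have t2: "tables s2" unfolding s2_def
      by (rule tables_exec[OF t1]) (auto simp: load_marks_mods)
    have t3: "tables s3" unfolding s3_def
      by (rule tables_exec[OF t2]) (auto simp: scan_edges_mods)
    have D1: "snd s1 aD (w + e) = ?r e" if "e < w" for e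
      using r[OF that] r[OF d(1)] by (simp add: s1_def lower_apply[of "lower r c"])
    have U1: "snd s1 aD e = u e" if "e < w" for e
      using u[OF that] that by (simp add: s1_def)
    define b where "b = (\<lambda>e. if e = d \<and> u d = lower r c d then 0 else u e)"
    have 2: "(\<forall>e<w. snd s2 aNU e = b e) \<and> fst s2 vHit = 0"
      using exec_load_marks[of s1 d] sW d D1[OF d(1)] U1 True
      unfolding s2_def[symmetric] b_def by (auto simp: s1_def lower_apply[of "lower r c"])
    have 3: "(\<forall>e<w. snd s3 aNU e = max_marks b ?r (Collect (adj (c, r c - 1))) e) \<and>
      fst s3 vHit = of_bool (hits ?r (Collect (adj (c, r c - 1))))"
      unfolding s3_def
      by (rule exec_scan_edges[OF t2])
         (use 2 c f2 a2 D1 in \<open>auto simp: s1_def\<close>)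
    have nm: "next_marks c d r u = max_marks b ?r (Collect (adj (c, r c - 1)))"
      unfolding b_def by (rule next_marks_eq)
    have rH: "?r e \<le> H e" if "e < w" for e
      using r[OF that] by (auto simp: lower_apply)
    have uH: "next_marks c d r u e \<le> H e" if "e < w" for e
      unfolding nm by (rule max_marks_le) (use u[OF that] rH[OF that] in \<open>auto simp: b_def\<close>)
    have 4: "fst s4 vCode = code_of ?r (next_marks c d r u)"
      unfolding s4_def
    proof (rule exec_encode[OF t3])
      show "strides s3" using t(2) a2 a3 by (simp add: strides_def s1_def)
      show "snd s3 aNU e = next_marks c d r u e \<and> next_marks c d r u e \<le> n" if "e < w" for e
        using 3 uH[OF that] H_le[OF that] that by (auto simp: nm)
      show "snd s3 aD (w + e) = ?r e \<and> ?r e \<le> n" if "e < w" for e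
        using D1[OF that] a2[of aD] a3[of aD] rH[OF that] H_le[OF that] by auto
    qed
    have tab: "snd s4 aTab (fst s4 vCode) = of_bool (W ?r (next_marks c d r u))"
      using t(3) rH uH l[OF True, of "next_marks c d r u"] a2[of aTab] a3[of aTab] a4[of aTab]
      unfolding 4 by (simp add: table_upto_def s1_def)
    have hit4: "fst s4 vHit = of_bool (hits_bad c r ?r)"
      using f4[of vHit] 3 by (simp add: hits_bad_eq)
    have v4: "fst s4 vW = w" "fst s4 vD = d" "fst s4 vAny = 1" "fst s4 vAll = fst s vAll"
      using f2 f3 f4 sW d by (auto simp: s1_def)
    have D4: "snd s4 aD = (snd s aD)(w + d := snd s aD (w + d) - 1)"
      using a2[of aD] a3[of aD] a4[of aD] by (simp add: s1_def)
    have pos: "0 < snd s aD (w + d)" using r[OF d(1)] True by simp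
    define s5 where "s5 = exec refute_move s4"
    have 5: "snd s5 = snd s4" "fst s5 vW = w" "fst s5 vD = d" "fst s5 vAny = 1"
      "fst s5 vAll = (if hits_bad c r ?r \<or> W ?r (next_marks c d r u) then fst s vAll else 0)"
      using tab hit4 v4 by (auto simp: s5_def refute_move_def)
    have "exec reply s = exec (Put aD (Plus (Var vW) (Var vD))
        (Plus (Arr aD (Plus (Var vW) (Var vD))) (Num 1))) s5"
      using pos sW d(2) by (simp add: reply_def s5_def s4_def s3_def s2_def s1_def)
    then have "exec reply s = (fst s5, (snd s5)(aD := (snd s5 aD)(w + d := snd s5 aD (w + d) + 1)))"
      using 5(2,3) by simp
    then show ?thesis using 5 True D4 pos by auto
  qed
qed


definition winning_move :: "(nat \<Rightarrow> nat) \<Rightarrow> (nat \<Rightarrow> nat) \<Rightarrow> nat \<Rightarrow> bool" where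
  "winning_move r u c \<longleftrightarrow> 0 < r c \<and> (u c = r c \<or>
     (\<exists>d<w. 0 < lower r c d) \<and>
     (\<forall>d<w. 0 < lower r c d \<longrightarrow> hits_bad c r (lower (lower r c) d) \<or>
        W (lower (lower r c) d) (next_marks c d r u)))"

lemma W_iff: "W r u \<longleftrightarrow> (\<exists>c<w. winning_move r u c)"
  by (subst W.simps) (auto simp: open_chains_def winning_move_def)

lemma table_upto_cong: "snd s' aTab = snd s aTab \<Longrightarrow> table_upto l s \<Longrightarrow> table_upto l s'"
  by (simp add: table_upto_def)

lemma strides_cong: "snd s' aStr = snd s aStr \<Longrightarrow> strides s \<Longrightarrow> strides s'"
  by (simp add: strides_def)

lemma exec_maker_move:
  assumes t: "tables s" "strides s" "table_upto l s"
    and c: "c < w" "fst s vC = c"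
    and u: "\<And>e. e < w \<Longrightarrow> snd s aD e = u e \<and> u e \<le> H e"
    and r: "\<And>e. e < w \<Longrightarrow> snd s aD (w + e) = r e \<and> r e \<le> H e"
    and l: "\<And>d u'. d < w \<Longrightarrow> 0 < r c \<Longrightarrow> 0 < lower r c d \<Longrightarrow> (\<forall>e<w. u' e \<le> H e) \<Longrightarrow>
      code_of (lower (lower r c) d) u' < l"
  shows "snd (exec maker_move s) aD = snd s aD \<and>
    fst (exec maker_move s) vRes = (if winning_move r u c then 1 else fst s vRes)"
proof -
  have sW: "fst s vW = w" using t(1) by (simp add: tables_def)
  consider (zero) "r c = 0" | (top) "0 < r c" "u c = r c" | (move) "0 < r c" "u c \<noteq> r c" by auto
  then show ?thesis
  proof cases
    case zero
    then show ?thesis using r[OF c(1)] c sW by (simp add: maker_move_def winning_move_def)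
  next
    case top
    then show ?thesis
      using r[OF c(1)] u[OF c(1)] c sW by (simp add: maker_move_def winning_move_def)
  next
    case move
    let ?ok = "\<lambda>d. hits_bad c r (lower (lower r c) d) \<or> W (lower (lower r c) d) (next_marks c d r u)"
    let ?D = "(snd s aD)(w + c := r c - 1)"
    define s1 where "s1 = ((fst s)(vKV := r c - 1, vAny := 0, vAll := 1), (snd s)(aD := ?D))"
    define s2 where "s2 = exec (For vD vW reply) s1"
    define I where "I k s' \<longleftrightarrow> tables s' \<and> strides s' \<and> table_upto l s' \<and> fst s' vC = c \<and>
      fst s' vKV = r c - 1 \<and> fst s' vRes = fst s vRes \<and> snd s' aD = ?D \<and>
      fst s' vAny = of_bool (\<exists>d<k. 0 < lower r c d) \<and>
      fst s' vAll = of_bool (\<forall>d<k. 0 < lower r c d \<longrightarrow> ?ok d)" for k s'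
    have s1W: "fst s1 vW = w" using sW by (simp add: s1_def)
    have "I (fst s1 vW) s2"
      unfolding s2_def
    proof (rule exec_For_inv)
      have "tables s1" by (rule tables_cong[OF t(1)]) (auto simp: s1_def)
      then show "I 0 s1"
        using t c table_upto_cong[of s1 s l] strides_cong[of s1 s] by (simp add: I_def s1_def)
      show "I k ((fst s')(vD := v), snd s')" if "I k s'" for k s' v
        using that table_upto_cong[of "((fst s')(vD := v), snd s')" s' l]
          strides_cong[of "((fst s')(vD := v), snd s')" s'] by (simp add: I_def)
      fix k s' assume k: "k < fst s1 vW" "fst s' vD = k" and I: "I k s'"
      have kw: "k < w" using k s1W by simp
      have "snd (exec reply s') aD = snd s' aD \<and>
        fst (exec reply s') vAny = (if 0 < lower r c k then 1 else fst s' vAny) \<and>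
        fst (exec reply s') vAll = (if 0 < lower r c k \<and> \<not> ?ok k then 0 else fst s' vAll)"
      proof (rule exec_reply)
        show "snd s' aD e = u e \<and> u e \<le> H e" if "e < w" for e
          using u[OF that] I that by (simp add: I_def)
        show "snd s' aD (w + e) = lower r c e \<and> r e \<le> H e" if "e < w" for e
          using r[OF that] I that by (simp add: I_def lower_apply)
      qed (use I c kw k l move in \<open>auto simp: I_def\<close>)
      moreover have "tables (exec reply s')"
        by (rule tables_exec) (use I in \<open>auto simp: I_def reply_mods\<close>)
      moreover have "strides (exec reply s')" "table_upto l (exec reply s')"
        using I strides_cong[of "exec reply s'" s'] table_upto_cong[of "exec reply s'" s' l]
        by (simp_all add: I_def aframe reply_mods)
      moreover have "fst (exec reply s') vC = fst s' vC" "fst (exec reply s') vKV = fst s' vKV"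
        "fst (exec reply s') vRes = fst s' vRes"
        by (simp_all add: vframe reply_mods)
      ultimately show "I (Suc k) (exec reply s')"
        using I by (auto simp: I_def less_Suc_eq)
    qed (simp add: reply_mods)
    then have 2: "I w s2" using s1W by simp
    define s3 where "s3 = exec (Cond (Var vAny) (Cond (Var vAll) (Assign vRes (Num 1)) nop) nop) s2"
    have "winning_move r u c \<longleftrightarrow> (\<exists>d<w. 0 < lower r c d) \<and> (\<forall>d<w. 0 < lower r c d \<longrightarrow> ?ok d)"
      using move by (simp add: winning_move_def)
    then have 3: "snd s3 = snd s2" "fst s3 vW = w" "fst s3 vC = c"
      "fst s3 vRes = (if winning_move r u c then 1 else fst s vRes)"
      using 2 by (auto simp: s3_def I_def tables_def)
    have "exec maker_move s = exec (Put aD (Plus (Var vW) (Var vC))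
        (Plus (Arr aD (Plus (Var vW) (Var vC))) (Num 1))) s3"
      using r[OF c(1)] u[OF c(1)] c sW move
      by (simp add: maker_move_def s3_def s2_def s1_def)
    then have eq: "exec maker_move s = (fst s3, (snd s3)(aD := (snd s3 aD)(w + c := snd s3 aD (w + c) + 1)))"
      using 3(2,3) by simp
    have "snd s3 aD = ?D" using 2 3(1) by (simp add: I_def)
    then show ?thesis unfolding eq using 3(4) r[OF c(1)] move by (auto simp: fun_eq_iff)
  qed
qed

lemma exec_evaluate:
  assumes t: "tables s" "strides s" "table_upto l s"
    and u: "\<And>e. e < w \<Longrightarrow> snd s aD e = u e \<and> u e \<le> H e"
    and r: "\<And>e. e < w \<Longrightarrow> snd s aD (w + e) = r e \<and> r e \<le> H e"
    and l: "\<And>c d u'. c < w \<Longrightarrow> d < w \<Longrightarrow> 0 < r c \<Longrightarrow> 0 < lower r c d \<Longrightarrow> (\<forall>e<w. u' e \<le> H e) \<Longrightarrow>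
      code_of (lower (lower r c) d) u' < l"
  shows "fst (exec evaluate s) vRes = of_bool (W r u)"
proof -
  define s0 where "s0 = ((fst s)(vRes := 0), snd s)"
  define I where "I k s' \<longleftrightarrow> tables s' \<and> strides s' \<and> table_upto l s' \<and> snd s' aD = snd s aD \<and>
    fst s' vRes = of_bool (\<exists>c<k. winning_move r u c)" for k s'
  have "I (fst s0 vW) (exec (For vC vW maker_move) s0)"
  proof (rule exec_For_inv)
    show "I 0 s0"
      using t table_upto_cong[of s0 s l] strides_cong[of s0 s] by (simp add: I_def s0_def)
    show "I k ((fst s')(vC := v), snd s')" if "I k s'" for k s' v
      using that table_upto_cong[of "((fst s')(vC := v), snd s')" s' l]
        strides_cong[of "((fst s')(vC := v), snd s')" s'] by (simp add: I_def)
    fix k s' assume k: "k < fst s0 vW" "fst s' vC = k" and I: "I k s'"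
    have kw: "k < w" using k t(1) by (simp add: s0_def tables_def)
    have "snd (exec maker_move s') aD = snd s' aD \<and>
      fst (exec maker_move s') vRes = (if winning_move r u k then 1 else fst s' vRes)"
      by (rule exec_maker_move) (use I kw k u r l in \<open>auto simp: I_def\<close>)
    moreover have "tables (exec maker_move s')"
      by (rule tables_exec) (use I in \<open>auto simp: I_def maker_move_mods reply_mods\<close>)
    moreover have "strides (exec maker_move s')" "table_upto l (exec maker_move s')"
      using I strides_cong[of "exec maker_move s'" s'] table_upto_cong[of "exec maker_move s'" s' l]
      by (simp_all add: I_def aframe maker_move_mods)
    ultimately show "I (Suc k) (exec maker_move s')"
      using I by (auto simp: I_def less_Suc_eq)
  qed (simp add: maker_move_mods reply_mods)
  moreover have "fst s0 vW = w" using t(1) by (simp add: s0_def tables_def)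
  ultimately show ?thesis by (simp add: I_def evaluate_def s0_def W_iff)
qed

section \<open>Numbering the states and filling the table\<close>

abbreviation height :: "nat \<Rightarrow> nat" where
  "height q \<equiv> (if q < w then H q else H (q - w))"

lemma stride_pos [simp]: "0 < stride q"
  by (induction q) auto

lemma stride_dvd: "q \<le> q' \<Longrightarrow> stride q dvd stride q'"
  by (induction q' rule: dec_induct) auto

lemma stride_mono: "q \<le> q' \<Longrightarrow> stride q \<le> stride q'"
  by (rule dvd_imp_le[OF stride_dvd]) auto

definition digit :: "nat \<Rightarrow> nat \<Rightarrow> nat" where
  "digit t q = t mod stride (Suc q) div stride q"

lemma digit_le: "digit t q \<le> height q"
proof -
  have "t mod stride (Suc q) < stride q * Suc (height q)"
    using mod_less_divisor[of "stride (Suc q)" t] stride_pos[of "Suc q"] by (simp del: mult_Suc_right)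
  then show ?thesis unfolding digit_def by (simp add: div_less_iff_less_mult mult.commute less_Suc_eq_le[symmetric])
qed

lemma sum_digits: "(\<Sum>q<j. digit t q * stride q) = t mod stride j"
proof (induction j)
  case (Suc j)
  have "t mod stride (Suc j) mod stride j = t mod stride j"
    by (rule mod_mod_cancel) simp
  then show ?case
    using Suc div_mult_mod_eq[of "t mod stride (Suc j)" "stride j"]
    by (simp add: digit_def)
qed simp

lemma sum_digits_less:
  "(\<And>q. q < j \<Longrightarrow> f q \<le> height q) \<Longrightarrow> (\<Sum>q<j. f q * stride q) < stride j"
proof (induction j)
  case (Suc j)
  have "(\<Sum>q<Suc j. f q * stride q) < stride j + f j * stride j" using Suc by simp
  also have "\<dots> \<le> stride j + height j * stride j" using Suc.prems[of j] by simp
  finally show ?case by (simp add: algebra_simps)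
qed simp

lemma digit_sum:
  assumes "\<And>q. q < l \<Longrightarrow> f q \<le> height q" "q < l"
  shows "digit (\<Sum>q<l. f q * stride q) q = f q"
proof -
  have "(\<Sum>q<l. f q * stride q) mod stride j = (\<Sum>q<j. f q * stride q)" if "j \<le> l" for j
    using that
  proof (induction rule: inc_induct)
    case base
    then show ?case using sum_digits_less[of l f] assms by simp
  next
    case (step j)
    have "(\<Sum>q<l. f q * stride q) mod stride j = (\<Sum>q<l. f q * stride q) mod stride (Suc j) mod stride j"
      by (rule mod_mod_cancel[symmetric]) simp
    also have "\<dots> = (\<Sum>q<j. f q * stride q)"
      using step sum_digits_less[of j f] assms by simp
    finally show ?case .
  qed
  from this[of "Suc q"] show ?thesis
    using assms sum_digits_less[of q f] by (simp add: digit_def)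
qed

lemma sum_split: "(\<Sum>q<a + b. f q) = (\<Sum>q<a. f q) + (\<Sum>q<b. f (a + q))" for f :: "nat \<Rightarrow> nat"
  by (induction b) auto

lemma code_of_eq: "code_of r u = (\<Sum>q<w + w. (if q < w then u q else r (q - w)) * stride q)"
  by (simp add: code_of_def sum_split)

lemma digit_code_of:
  assumes "\<And>e. e < w \<Longrightarrow> r e \<le> H e \<and> u e \<le> H e" "e < w"
  shows "digit (code_of r u) e = u e" "digit (code_of r u) (w + e) = r e"
  using digit_sum[of "w + w" "\<lambda>q. if q < w then u q else r (q - w)" e]
    digit_sum[of "w + w" "\<lambda>q. if q < w then u q else r (q - w)" "w + e"] assms
  by (auto simp: code_of_eq)

lemma code_of_digit: "t < stride (w + w) \<Longrightarrow> code_of (\<lambda>e. digit t (w + e)) (digit t) = t"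
  using sum_digits[where j = "w + w" and t = t] by (simp add: code_of_def sum_split)

text \<open>The counts occupy the high digits. Losing a vertex of chain \<open>c\<close> lowers the
  code by at least \<open>stride (w + c)\<close>, while all the new marks together contribute less
  than \<open>stride w\<close>. Hence increasing codes are an order of evaluation in which the
  successors of a state precede it.\<close>

lemma code_of_less:
  assumes "c < w" "d < w" "0 < r c" "0 < lower r c d" "\<forall>e<w. u' e \<le> H e"
  shows "code_of (lower (lower r c) d) u' < code_of r u"
proof -
  let ?r = "lower (lower r c) d"
  have le: "?r e \<le> r e" for e by (simp add: lower_apply)
  have lt: "?r c < r c" using assms by (auto simp: lower_apply)
  have "(\<Sum>e<w. u' e * stride e) < stride w" using sum_digits_less[of w u'] assms(5) by simp
  also have "\<dots> \<le> stride (w + c)" by (rule stride_mono) simp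
  finally have 1: "(\<Sum>e<w. u' e * stride e) < stride (w + c)" .
  have "(\<Sum>e<w. ?r e * stride (w + e)) + stride (w + c) =
      (?r c + 1) * stride (w + c) + (\<Sum>e\<in>{..<w} - {c}. ?r e * stride (w + e))"
    using assms(1) by (subst sum.remove[of _ c]) auto
  also have "\<dots> \<le> r c * stride (w + c) + (\<Sum>e\<in>{..<w} - {c}. r e * stride (w + e))"
    using lt le by (intro add_mono sum_mono mult_right_mono) auto
  also have "\<dots> = (\<Sum>e<w. r e * stride (w + e))"
    using assms(1) by (subst (2) sum.remove[of _ c]) auto
  finally show ?thesis using 1 by (simp add: code_of_def)
qed

text \<open>A digit is at most a height and hence at most \<open>n\<close>, so \<open>n\<close>
  attempts at subtraction suffice for each digit; once the remainder is below the weight, further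
  attempts change nothing.\<close>

lemma exec_decode:
  assumes t: "tables s" "strides s" "fst s vT = t" "t < stride (w + w)"
  shows "\<forall>q<w + w. snd (exec decode s) aD q = digit t q"
proof -
  let ?inner = "For vI vN (Cond (ltE (Var vX) (Arr aStr (Var vQ))) nop
        (Seq (Assign vX (Minus (Var vX) (Arr aStr (Var vQ))))
          (Put aD (Var vQ) (Plus (Arr aD (Var vQ)) (Num 1)))))"
  have inner: "snd (exec ?inner s') aD = (snd s' aD)(q := x div stride q) \<and>
      fst (exec ?inner s') vX = x mod stride q"
    if s': "strides s'" "fst s' vN = n" "fst s' vQ = q" "fst s' vX = x" "snd s' aD q = 0"
      "q < w + w" "x div stride q \<le> n" for s' q x
  proof -
    define I where "I i s'' \<longleftrightarrow> strides s'' \<and> fst s'' vQ = q \<and>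
      snd s'' aD = (snd s' aD)(q := min i (x div stride q)) \<and>
      fst s'' vX + min i (x div stride q) * stride q = x" for i s''
    have "I (fst s' vN) (exec ?inner s')"
    proof (rule exec_For_inv)
      show "I 0 s'" using s' by (auto simp: I_def)
      fix i s'' assume I: "I i s''"
      let ?c = "Cond (ltE (Var vX) (Arr aStr (Var vQ))) nop
        (Seq (Assign vX (Minus (Var vX) (Arr aStr (Var vQ))))
          (Put aD (Var vQ) (Plus (Arr aD (Var vQ)) (Num 1))))"
      have str: "snd s'' aStr q = stride q" "fst s'' vQ = q"
        using I s'(6) by (auto simp: I_def strides_def)
      have st: "strides (exec ?c s'')"
        by (rule strides_cong[of _ s'']) (use I in \<open>auto simp: I_def aframe\<close>)
      have x: "x = x div stride q * stride q + x mod stride q" by simp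
      have m: "x mod stride q < stride q" by simp
      show "I (Suc i) (exec ?c s'')"
      proof (cases "i < x div stride q")
        case True
        then have "(Suc i) * stride q \<le> x div stride q * stride q" by (intro mult_right_mono) auto
        also have "\<dots> \<le> x" by (rule div_times_less_eq_dividend)
        finally have "stride q \<le> fst s'' vX" using True I by (simp add: I_def min_def)
        with True show ?thesis using I str st by (auto simp: I_def min_def)
      next
        case False
        then have "fst s'' vX + x div stride q * stride q = x" using I False
          by (simp add: I_def min_absorb2)
        then have "fst s'' vX < stride q" using x m by linarith
        with False show ?thesis using I str st by (auto simp: I_def min_absorb2)
      qed
    qed (auto simp: I_def strides_def)
    then have "I n (exec ?inner s')" using s' by simp
    then have D: "snd (exec ?inner s') aD = (snd s' aD)(q := x div stride q)"
      and "fst (exec ?inner s') vX + x div stride q * stride q = x"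
      using s'(7) by (auto simp: I_def min_absorb2)
    then have "fst (exec ?inner s') vX = x mod stride q"
      using div_mult_mod_eq[of x "stride q"] by linarith
    with D show ?thesis by blast
  qed
  define s0 where "s0 = ((fst s)(vX := t), snd s)"
  define I where "I j s' \<longleftrightarrow> tables s' \<and> strides s' \<and> fst s' vX = t mod stride (w + w - j) \<and>
    (\<forall>q<w + w. w + w - j \<le> q \<longrightarrow> snd s' aD q = digit t q)" for j s'
  let ?body = "seqs
     [Assign vQ (Minus (Minus (Var vWW) (Num 1)) (Var vJ)),
      Put aD (Var vQ) (Num 0), ?inner]"
  have "I (fst s0 vWW) (exec (For vJ vWW ?body) s0)"
  proof (rule exec_For_inv)
    show "I 0 s0" using t strides_cong[of s0 s] by (simp add: I_def s0_def)
    show "I k ((fst s')(vJ := v), snd s')" if "I k s'" for k s' v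
      using that strides_cong[of "((fst s')(vJ := v), snd s')" s'] by (simp add: I_def)
    fix j s' assume j: "j < fst s0 vWW" "fst s' vJ = j" and I: "I j s'"
    define q where "q = w + w - 1 - j"
    have jw: "j < w + w" using j t(1) by (simp add: s0_def tables_def)
    then have q: "w + w - j = Suc q" "q < w + w" "w + w - Suc j = q" by (auto simp: q_def)
    define s1 where "s1 = ((fst s')(vQ := q), (snd s')(aD := (snd s' aD)(q := 0)))"
    have t1: "tables s1" by (rule tables_cong[of s']) (use I in \<open>auto simp: I_def s1_def\<close>)
    have st1: "strides s1" by (rule strides_cong[of _ s']) (use I in \<open>auto simp: I_def s1_def\<close>)
    have x: "fst s1 vX = t mod stride (Suc q)" using I q by (simp add: I_def s1_def)
    have hn: "height q \<le> n" using H_le[of q] H_le[of "q - w"] q by auto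
    have 2: "snd (exec ?inner s1) aD = (snd s1 aD)(q := t mod stride (Suc q) div stride q) \<and>
      fst (exec ?inner s1) vX = t mod stride (Suc q) mod stride q"
    proof (rule inner[OF st1 _ _ x])
      show "t mod stride (Suc q) div stride q \<le> n"
        using digit_le[of t q] hn unfolding digit_def by (rule le_trans)
    qed (use t1 q in \<open>auto simp: s1_def tables_def\<close>)
    have m: "t mod stride (Suc q) mod stride q = t mod stride q" by (rule mod_mod_cancel) simp
    have e: "exec ?body s' = exec ?inner s1"
      using j I by (simp add: s1_def q_def I_def tables_def)
    have t2: "tables (exec ?inner s1)" by (rule tables_exec[OF t1]) auto
    have st2: "strides (exec ?inner s1)"
      by (rule strides_cong[OF _ st1]) (simp add: aframe)
    show "I (Suc j) (exec ?body s')"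
      unfolding e I_def
    proof (intro conjI allI impI t2 st2)
      show "fst (exec ?inner s1) vX = t mod stride (w + w - Suc j)" using 2 m q by simp
      fix q' assume q': "q' < w + w" "w + w - Suc j \<le> q'"
      show "snd (exec ?inner s1) aD q' = digit t q'"
      proof (cases "q' = q")
        case True
        then show ?thesis using 2 by (simp add: digit_def)
      next
        case False
        then have "Suc q \<le> q'" using q' q by simp
        then show ?thesis using 2 False I q q' by (simp add: I_def s1_def)
      qed
    qed
  qed auto
  moreover have "fst s0 vWW = w + w" using t(1) by (simp add: s0_def tables_def)
  ultimately show ?thesis using t(3) by (simp add: I_def decode_def s0_def)
qed

text \<open>Decoding a code yields functions that agree with \<open>r\<close> and \<open>u\<close>
  only below \<open>w\<close>. \<open>W\<close> looks no further: moves are taken in chains below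
  \<open>w\<close>, and neighbours lie there by \<open>adj_chain\<close>.\<close>

lemma W_cong:
  assumes "\<And>e. e < w \<Longrightarrow> r e = r' e \<and> u e = u' e"
  shows "W r u = W r' u'"
  using assms
proof (induction r u arbitrary: r' u' rule: W.induct)
  case (1 r u)
  have low: "lower f c e = lower g c e" if "f e = g e" for f g c e
    using that by (auto simp: lower_apply)
  have op: "open_chains (\<lambda>_. 0) f = open_chains (\<lambda>_. 0) g" if "\<And>e. e < w \<Longrightarrow> f e = g e" for f g
    using that by (auto simp: open_chains_def)
  have e: "r e = r' e" "u e = u' e" if "e < w" for e using "1.prems"[OF that] by auto
  have step: "(hits_bad c r (lower (lower r c) d) \<or> W (lower (lower r c) d) (next_marks c d r u)) \<longleftrightarrow>
     (hits_bad c r' (lower (lower r' c) d) \<or> W (lower (lower r' c) d) (next_marks c d r' u'))"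
    if c: "c \<in> open_chains (\<lambda>_. 0) r" and d: "d \<in> open_chains (\<lambda>_. 0) (lower r c)" for c d
  proof -
    have cd: "c < w" "d < w" using c d by (auto simp: open_chains_def)
    have l2: "lower (lower r c) d x = lower (lower r' c) d x" if "x < w" for x
      by (intro low e that)
    have lc: "lower r c d = lower r' c d" by (intro low e cd)
    have rc: "r c = r' c" "u d = u' d" by (rule e, rule cd)+
    have "hits_bad c r (lower (lower r c) d) = hits_bad c r' (lower (lower r' c) d)"
      unfolding hits_bad_def rc
    proof (intro iff_exI conj_cong refl)
      fix x y assume "adj (c, r' c - 1) (x, y)"
      then have "x < w" using adj_chain by force
      then show "y < lower (lower r c) d x \<longleftrightarrow> y < lower (lower r' c) d x" using l2 by simp
    qed
    moreover have "W (lower (lower r c) d) (next_marks c d r u) =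
      W (lower (lower r' c) d) (next_marks c d r' u')"
    proof (rule "1.IH"[OF c d])
      fix x assume x: "x < w"
      show "lower (lower r c) d x = lower (lower r' c) d x \<and>
        next_marks c d r u x = next_marks c d r' u' x"
        using l2[OF x] e(2)[OF x] rc lc unfolding next_marks_def by simp
    qed
    ultimately show ?thesis by simp
  qed
  have o1: "open_chains (\<lambda>_. 0) r = open_chains (\<lambda>_. 0) r'" by (rule op) (rule e)
  have o2: "open_chains (\<lambda>_. 0) (lower r c) = open_chains (\<lambda>_. 0) (lower r' c)" for c
    by (rule op) (rule low, rule e)
  show ?case
    unfolding W.simps[of r u] W.simps[of r' u'] o1[symmetric] o2[symmetric]
  proof (intro bex_cong refl)
    fix c assume c: "c \<in> open_chains (\<lambda>_. 0) r"
    then have "(u c = r c) = (u' c = r' c)" using e by (simp add: open_chains_def)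
    moreover have "(\<forall>d\<in>open_chains (\<lambda>_. 0) (lower r c). hits_bad c r (lower (lower r c) d) \<or>
        W (lower (lower r c) d) (next_marks c d r u)) \<longleftrightarrow>
      (\<forall>d\<in>open_chains (\<lambda>_. 0) (lower r c). hits_bad c r' (lower (lower r' c) d) \<or>
        W (lower (lower r' c) d) (next_marks c d r' u'))"
      by (intro ball_cong refl step[OF c])
    ultimately show "(u c = r c \<or> open_chains (\<lambda>_. 0) (lower r c) \<noteq> {} \<and>
        (\<forall>d\<in>open_chains (\<lambda>_. 0) (lower r c). hits_bad c r (lower (lower r c) d) \<or>
          W (lower (lower r c) d) (next_marks c d r u))) \<longleftrightarrow>
      (u' c = r' c \<or> open_chains (\<lambda>_. 0) (lower r c) \<noteq> {} \<and>
        (\<forall>d\<in>open_chains (\<lambda>_. 0) (lower r c). hits_bad c r' (lower (lower r' c) d) \<or>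
          W (lower (lower r' c) d) (next_marks c d r' u')))"
      by simp
  qed
qed

theorem exec_fill_table:
  assumes "tables s" "strides s" "fst s vS = stride (w + w)"
  shows "table_upto (stride (w + w)) (exec fill_table s)"
proof -
  define I where "I k s' \<longleftrightarrow> tables s' \<and> strides s' \<and> table_upto k s'" for k s'
  have "I (fst s vS) (exec fill_table s)"
    unfolding fill_table_def
  proof (rule exec_For_inv)
    show "I 0 s" using assms by (simp add: I_def table_upto_def)
    show "I k ((fst s')(vT := v), snd s')" if "I k s'" for k s' v
      using that strides_cong[of "((fst s')(vT := v), snd s')" s']
        table_upto_cong[of "((fst s')(vT := v), snd s')" s'] by (simp add: I_def)
    fix t s' assume t: "t < fst s vS" "fst s' vT = t" and I: "I t s'"
    have tw: "t < stride (w + w)" using t assms by simp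
    let ?r = "\<lambda>e. digit t (w + e)" and ?u = "digit t"
    define s1 where "s1 = exec decode s'"
    define s2 where "s2 = exec evaluate s1"
    have t1: "tables s1" unfolding s1_def
      by (rule tables_exec) (use I in \<open>auto simp: I_def decode_mods\<close>)
    have st1: "strides s1" unfolding s1_def
      by (rule strides_cong[of _ s']) (use I in \<open>auto simp: I_def decode_mods aframe\<close>)
    have tb1: "table_upto t s1" unfolding s1_def
      by (rule table_upto_cong[of _ s']) (use I in \<open>auto simp: I_def decode_mods aframe\<close>)
    have D: "\<forall>q<w + w. snd s1 aD q = digit t q"
      unfolding s1_def by (rule exec_decode) (use I t tw in \<open>auto simp: I_def\<close>)
    have W2: "fst s2 vRes = of_bool (W ?r ?u)"
      unfolding s2_def
    proof (rule exec_evaluate[OF t1 st1 tb1])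
      show "snd s1 aD e = ?u e \<and> ?u e \<le> H e" if "e < w" for e
        using D digit_le[of t e] that by simp
      show "snd s1 aD (w + e) = ?r e \<and> ?r e \<le> H e" if "e < w" for e
        using D digit_le[of t "w + e"] that by simp
      show "code_of (lower (lower ?r c) d) u' < t"
        if "c < w" "d < w" "0 < ?r c" "0 < lower ?r c d" "\<forall>e<w. u' e \<le> H e" for c d u'
        using code_of_less[OF that, of ?u] code_of_digit[OF tw] by simp
    qed
    have t2: "tables s2" unfolding s2_def
      by (rule tables_exec[OF t1]) (auto simp: evaluate_mods maker_move_mods reply_mods)
    have st2: "strides s2" unfolding s2_def
      by (rule strides_cong[OF _ st1]) (auto simp: evaluate_mods aframe)
    have tb2: "table_upto t s2" unfolding s2_def
      by (rule table_upto_cong[OF _ tb1]) (auto simp: evaluate_mods aframe)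
    have "fst s1 vT = t"
      unfolding s1_def using t by (simp add: vframe decode_mods)
    then have vT: "fst s2 vT = t"
      unfolding s2_def by (simp add: vframe evaluate_mods maker_move_mods reply_mods)
    have e: "exec (seqs [decode, evaluate, Put aTab (Var vT) (Var vRes)]) s' =
      (fst s2, (snd s2)(aTab := (snd s2 aTab)(t := fst s2 vRes)))"
      using vT by (simp add: s2_def s1_def)
    show "I (Suc t) (exec (seqs [decode, evaluate, Put aTab (Var vT) (Var vRes)]) s')"
      unfolding e I_def
    proof (intro conjI)
      show "tables (fst s2, (snd s2)(aTab := (snd s2 aTab)(t := fst s2 vRes)))"
        by (rule tables_cong[OF t2]) auto
      show "strides (fst s2, (snd s2)(aTab := (snd s2 aTab)(t := fst s2 vRes)))"
        by (rule strides_cong[OF _ st2]) auto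
      show "table_upto (Suc t) (fst s2, (snd s2)(aTab := (snd s2 aTab)(t := fst s2 vRes)))"
        unfolding table_upto_def
      proof (intro allI impI)
        fix r u assume v: "\<forall>e<w. r e \<le> H e \<and> u e \<le> H e" and c: "code_of r u < Suc t"
        show "snd (fst s2, (snd s2)(aTab := (snd s2 aTab)(t := fst s2 vRes))) aTab (code_of r u) =
          of_bool (W r u)"
        proof (cases "code_of r u = t")
          case True
          have "W ?r ?u = W r u"
            by (rule W_cong) (use digit_code_of[of r u] v True in auto)
          then show ?thesis using True W2 by simp
        next
          case False
          then show ?thesis using tb2 v c by (simp add: table_upto_def)
        qed
      qed
    qed
  qed (auto simp: evaluate_mods maker_move_mods reply_mods decode_mods)
  then show ?thesis using assms(3) by (simp add: I_def)
qed

end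

section \<open>Strides and the final answer\<close>

definition set_strides :: com where
  "set_strides = seqs
     [Assign vS (Num 1),
      For vJ vW (Seq (Put aStr (Var vJ) (Var vS))
        (For vI vN (Cond (ltE (Var vI) (Arr aH (Var vJ)))
          (Assign vS (Plus (Var vS) (Arr aStr (Var vJ)))) nop))),
      For vJ vW (Seq (Put aStr (Plus (Var vW) (Var vJ)) (Var vS))
        (For vI vN (Cond (ltE (Var vI) (Arr aH (Var vJ)))
          (Assign vS (Plus (Var vS) (Arr aStr (Plus (Var vW) (Var vJ))))) nop)))]"

lemma set_strides_mods: "vmods set_strides = {vS, vJ, vI, vNop}" "amods set_strides = {aStr}"
  by (auto simp: set_strides_def)

text \<open>An empty winning set decides the game at once, and singletons are the marks before the
  first move; one of the wrong parity also decides, by \<open>V0_bad\<close>. Sets of size 2 act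
  only after one of their elements has been claimed.\<close>

definition init_marks :: com where
  "init_marks = seqs
     [For vE vW (Seq (Put aNU (Var vE) (Num 0))
        (Put aD (Plus (Var vW) (Var vE)) (Arr aH (Var vE)))),
      Assign vWon (Num 0),
      For vJ vM (Cond (eqE (Arr aSz (Var vJ)) (Num 0)) (Assign vWon (Num 1))
        (Cond (eqE (Arr aSz (Var vJ)) (Num 1)) (seqs
           [Assign vX (Arr aE1 (Var vJ)),
            Cond (Arr aPar (Plus (Arr aK (Var vX)) (Var vN))) (Assign vWon (Num 1)) nop,
            Cond (ltE (Arr aNU (Arr aCh (Var vX))) (Plus (Arr aK (Var vX)) (Num 1)))
              (Put aNU (Arr aCh (Var vX)) (Plus (Arr aK (Var vX)) (Num 1))) nop]) nop))]"

lemma init_marks_mods: "vmods init_marks = {vE, vWon, vJ, vX, vNop}" "amods init_marks = {aNU, aD}"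
  by (auto simp: init_marks_def)

definition answer :: com where
  "answer = seqs [init_marks, encode,
     Cond (Plus (Var vWon) (Arr aTab (Var vCode))) (Assign 0 (Num 1)) (Assign 0 (Num 0))]"

context game_tables
begin

text \<open>\<open>vS\<close> grows into the next weight: multiplication by \<open>H c + 1\<close>
  is the \<open>H c\<close>-fold addition of the current weight to itself. Its final value is the
  number of states.\<close>

lemma exec_set_strides:
  assumes t: "tables s"
  shows "strides (exec set_strides s) \<and> fst (exec set_strides s) vS = stride (w + w)"
proof -
  let ?in = "\<lambda>e. For vI vN (Cond (ltE (Var vI) (Arr aH (Var vJ)))
          (Assign vS (Plus (Var vS) (Arr aStr e))) nop)"
  have inner: "fst (exec (?in e) s') vS = stride (Suc q) \<and> snd (exec (?in e) s') = snd s'"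
    if e: "e = Var vJ \<and> q = j \<or> e = Plus (Var vW) (Var vJ) \<and> q = w + j" and j: "j < w" "fst s' vJ = j"
      and s': "tables s'" "snd s' aStr q = stride q" "fst s' vS = stride q" for s' e q j
  proof -
    have H: "height q = H j" using e j by auto
    define I where "I i s'' \<longleftrightarrow> fst s'' vW = w \<and> fst s'' vJ = j \<and> snd s'' = snd s' \<and>
      fst s'' vS = stride q + min i (H j) * stride q" for i s''
    have "I (fst s' vN) (exec (?in e) s')"
    proof (rule exec_For_inv)
      show "I 0 s'" using j s' by (simp add: I_def tables_def)
      fix i s'' assume "fst s'' vI = i" "I i s''"
      then show "I (Suc i) (exec (Cond (ltE (Var vI) (Arr aH (Var vJ)))
          (Assign vS (Plus (Var vS) (Arr aStr e))) nop) s'')"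
        using e j s' by (auto simp: I_def min_def tables_def not_less_eq_eq)
    qed (auto simp: I_def)
    moreover have "fst s' vN = n" using s' by (simp add: tables_def)
    ultimately show ?thesis using H_le[OF j(1)] H by (simp add: I_def min_absorb2)
  qed
  define s0 where "s0 = ((fst s)(vS := 1), snd s)"
  define I where "I d k s' \<longleftrightarrow> tables s' \<and> (\<forall>q<d + k. snd s' aStr q = stride q) \<and>
    fst s' vS = stride (d + k)" for d k s'
  have t0: "tables s0" using t by (simp add: s0_def)
  define s1 where "s1 = exec (For vJ vW (Seq (Put aStr (Var vJ) (Var vS)) (?in (Var vJ)))) s0"
  have "I 0 (fst s0 vW) s1"
    unfolding s1_def
  proof (rule exec_For_inv)
    show "I 0 0 s0" using t0 by (simp add: I_def) (simp add: s0_def)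
    show "I 0 k ((fst s')(vJ := v), snd s')" if "I 0 k s'" for k s' v
      using that by (simp add: I_def)
    fix j s' assume j: "j < fst s0 vW" "fst s' vJ = j" and I: "I 0 j s'"
    define s2 where "s2 = (fst s', (snd s')(aStr := (snd s' aStr)(j := stride j)))"
    have t2: "tables s2" by (rule tables_cong[of s']) (use I in \<open>auto simp: I_def s2_def\<close>)
    have jw: "j < w" using j t0 by (simp add: tables_def)
    have 2: "fst (exec (?in (Var vJ)) s2) vS = stride (Suc j) \<and> snd (exec (?in (Var vJ)) s2) = snd s2"
      by (rule inner[of _ j j]) (use I j jw t2 in \<open>auto simp: I_def s2_def\<close>)
    have "exec (Seq (Put aStr (Var vJ) (Var vS)) (?in (Var vJ))) s' = exec (?in (Var vJ)) s2"
      using I j by (simp add: I_def s2_def)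
    moreover have "tables (exec (?in (Var vJ)) s2)" by (rule tables_exec[OF t2]) auto
    ultimately show "I 0 (Suc j) (exec (Seq (Put aStr (Var vJ) (Var vS)) (?in (Var vJ))) s')"
      using 2 I by (auto simp: I_def s2_def less_Suc_eq)
  qed auto
  then have 1: "I w 0 s1" using t0 by (simp add: I_def tables_def)
  then have t1: "tables s1" by (simp add: I_def)
  let ?e = "Plus (Var vW) (Var vJ)"
  have "I w (fst s1 vW) (exec (For vJ vW (Seq (Put aStr ?e (Var vS)) (?in ?e))) s1)"
  proof (rule exec_For_inv)
    show "I w 0 s1" by (rule 1)
    show "I w k ((fst s')(vJ := v), snd s')" if "I w k s'" for k s' v
      using that by (simp add: I_def)
    fix j s' assume j: "j < fst s1 vW" "fst s' vJ = j" and I: "I w j s'"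
    define s2 where "s2 = (fst s', (snd s')(aStr := (snd s' aStr)(w + j := stride (w + j))))"
    have t2: "tables s2" by (rule tables_cong[of s']) (use I in \<open>auto simp: I_def s2_def\<close>)
    have jw: "j < w" using j t1 by (simp add: tables_def)
    have 2: "fst (exec (?in ?e) s2) vS = stride (Suc (w + j)) \<and> snd (exec (?in ?e) s2) = snd s2"
      by (rule inner[of _ "w + j" j]) (use I j jw t2 in \<open>auto simp: I_def s2_def\<close>)
    have "exec (Seq (Put aStr ?e (Var vS)) (?in ?e)) s' = exec (?in ?e) s2"
      using I j by (simp add: I_def s2_def tables_def)
    moreover have "tables (exec (?in ?e) s2)" by (rule tables_exec[OF t2]) auto
    ultimately show "I w (Suc j) (exec (Seq (Put aStr ?e (Var vS)) (?in ?e)) s')"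
      using 2 I by (auto simp: I_def s2_def less_Suc_eq)
  qed auto
  moreover have "fst s1 vW = w" using t1 by (simp add: tables_def)
  ultimately show ?thesis
    by (auto simp: I_def strides_def set_strides_def s1_def s0_def)
qed

definition singletons_upto :: "nat \<Rightarrow> (nat \<times> nat) set" where
  "singletons_upto l = {coord (e1 j) | j. j < l \<and> sz j = 1}"

lemma singletons_upto_Suc: "singletons_upto (Suc j) =
    (if sz j = 1 then insert (coord (e1 j)) (singletons_upto j) else singletons_upto j)"
  by (auto simp: singletons_upto_def less_Suc_eq)

lemma exec_init_marks:
  assumes t: "tables s"
  shows "(\<forall>e<w. snd (exec init_marks s) aD (w + e) = H e) \<and>
    (\<forall>e<w. snd (exec init_marks s) aNU e = max_marks (\<lambda>_. 0) H (singletons_upto m) e) \<and>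
    fst (exec init_marks s) vWon = of_bool ((\<exists>j<m. sz j = 0) \<or> hits H (singletons_upto m))"
proof -
  let ?l1 = "For vE vW (Seq (Put aNU (Var vE) (Num 0))
        (Put aD (Plus (Var vW) (Var vE)) (Arr aH (Var vE))))"
  define s1 where "s1 = exec ?l1 s"
  define I1 where "I1 k s' \<longleftrightarrow> tables s' \<and> (\<forall>e<k. snd s' aNU e = 0 \<and> snd s' aD (w + e) = H e)" for k s'
  have "I1 (fst s vW) s1"
    unfolding s1_def
  proof (rule exec_For_inv)
    fix k s' assume k: "k < fst s vW" "fst s' vE = k" and I: "I1 k s'"
    have "tables (exec (Seq (Put aNU (Var vE) (Num 0))
        (Put aD (Plus (Var vW) (Var vE)) (Arr aH (Var vE)))) s')"
      by (rule tables_exec) (use I in \<open>auto simp: I1_def\<close>)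
    then show "I1 (Suc k) (exec (Seq (Put aNU (Var vE) (Num 0))
        (Put aD (Plus (Var vW) (Var vE)) (Arr aH (Var vE)))) s')"
      using I k t by (auto simp: I1_def less_Suc_eq tables_def)
  qed (use t in \<open>auto simp: I1_def\<close>)
  then have 1: "I1 w s1" using t by (simp add: tables_def)
  let ?body = "Cond (eqE (Arr aSz (Var vJ)) (Num 0)) (Assign vWon (Num 1))
        (Cond (eqE (Arr aSz (Var vJ)) (Num 1)) (seqs
           [Assign vX (Arr aE1 (Var vJ)),
            Cond (Arr aPar (Plus (Arr aK (Var vX)) (Var vN))) (Assign vWon (Num 1)) nop,
            Cond (ltE (Arr aNU (Arr aCh (Var vX))) (Plus (Arr aK (Var vX)) (Num 1)))
              (Put aNU (Arr aCh (Var vX)) (Plus (Arr aK (Var vX)) (Num 1))) nop]) nop)"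
  define s2 where "s2 = ((fst s1)(vWon := 0), snd s1)"
  define I where "I k s' \<longleftrightarrow> tables s' \<and> (\<forall>e<w. snd s' aD (w + e) = H e) \<and>
    (\<forall>e<w. snd s' aNU e = max_marks (\<lambda>_. 0) H (singletons_upto k) e) \<and>
    fst s' vWon = of_bool ((\<exists>j<k. sz j = 0) \<or> hits H (singletons_upto k))" for k s'
  have "I (fst s2 vM) (exec (For vJ vM ?body) s2)"
  proof (rule exec_For_inv)
    show "I 0 s2" using 1 by (auto simp: I_def I1_def s2_def hits_def singletons_upto_def)
    show "I k ((fst s')(vJ := v), snd s')" if "I k s'" for k s' v
      using that by (simp add: I_def)
    fix j s' assume j: "j < fst s2 vM" "fst s' vJ = j" and I: "I j s'"
    have jm: "j < m" using j 1 by (simp add: s2_def I1_def tables_def)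
    have tj: "snd s' aSz j = sz j" "snd s' aE1 j = e1 j" "fst s' vN = n"
      using I jm by (auto simp: I_def tables_def)
    have t': "tables (exec ?body s')" by (rule tables_exec) (use I in \<open>auto simp: I_def\<close>)
    consider "sz j = 0" | "sz j = 1" | "sz j \<noteq> 0" "sz j \<noteq> 1" by auto
    then show "I (Suc j) (exec ?body s')"
    proof cases
      case 1
      then show ?thesis using t' tj I j by (auto simp: I_def singletons_upto_Suc)
    next
      case 3
      then show ?thesis using t' tj I j by (auto simp: I_def singletons_upto_Suc less_Suc_eq)
    next
      case 2
      let ?x = "e1 j"
      have x: "?x < n" by (rule singleton[OF jm 2])
      have tab: "snd s' aCh ?x = ch ?x" "snd s' aK ?x = ab ?x"
        "snd s' aNU (ch ?x) = max_marks (\<lambda>_. 0) H (singletons_upto j) (ch ?x)"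
        "snd s' aPar (ab ?x + n) = of_bool (odd (ab ?x + n))" "ab ?x < H (ch ?x)"
        using I x ch_less[OF x] ab_less[OF x] H_le[of "ch ?x"] by (auto simp: I_def tables_def)
      have h: "hits H (insert (coord ?x) Q) \<longleftrightarrow> hits H Q \<or> odd (ab ?x + n)" for Q
        using tab(5) by (auto simp: hits_def)
      have sj: "(\<exists>i<Suc j. sz i = 0) \<longleftrightarrow> (\<exists>i<j. sz i = 0)" using 2 by (auto simp: less_Suc_eq)
      show ?thesis
        using t' tj I j 2 tab unfolding I_def sj
        by (auto simp: singletons_upto_Suc max_marks_insert h max_def)
    qed
  qed auto
  moreover have "fst s2 vM = m" using 1 by (simp add: s2_def I1_def tables_def)
  ultimately show ?thesis by (simp add: init_marks_def s2_def s1_def I_def)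
qed

definition init_values :: "nat \<Rightarrow> nat" where
  "init_values = max_marks (\<lambda>_. 0) H (singletons_upto m)"

lemma init_values_le: "init_values e \<le> H e"
  unfolding init_values_def by (rule max_marks_le) auto

lemma exec_answer:
  assumes "tables s" "strides s" "table_upto (stride (w + w)) s"
  shows "fst (exec answer s) 0 =
    of_bool ((\<exists>j<m. sz j = 0) \<or> hits H (singletons_upto m) \<or> W H init_values)"
proof -
  define s1 where "s1 = exec init_marks s"
  define s2 where "s2 = exec encode s1"
  note 1 = exec_init_marks[OF assms(1), folded s1_def init_values_def]
  have t1: "tables s1" unfolding s1_def
    by (rule tables_exec[OF assms(1)]) (auto simp: init_marks_mods)
  have st1: "strides s1" unfolding s1_def
    by (rule strides_cong[OF _ assms(2)]) (auto simp: init_marks_mods aframe)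
  have 2: "fst s2 vCode = code_of H init_values"
    unfolding s2_def
  proof (rule exec_encode[OF t1 st1])
    show "snd s1 aNU e = init_values e \<and> init_values e \<le> n" if "e < w" for e
      using 1 that le_trans[OF init_values_le H_le] by simp
    show "snd s1 aD (w + e) = H e \<and> H e \<le> n" if "e < w" for e
      using 1 that H_le by simp
  qed
  have "snd s1 aTab = snd s aTab" unfolding s1_def by (rule aframe) (simp add: init_marks_mods)
  moreover have "snd s2 aTab = snd s1 aTab" unfolding s2_def by (rule aframe) (simp add: encode_mods)
  moreover have "code_of H init_values < stride (w + w)"
    unfolding code_of_eq by (rule sum_digits_less) (auto simp: init_values_le)
  ultimately have tab: "snd s2 aTab (fst s2 vCode) = of_bool (W H init_values)"
    using assms(3) init_values_le unfolding 2 by (simp add: table_upto_def)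
  have "fst s2 vWon = fst s1 vWon" unfolding s2_def by (rule vframe) (simp add: encode_mods)
  then show ?thesis using 1 tab by (simp add: answer_def s2_def[symmetric] s1_def[symmetric])
qed

lemma singletons_range: "(c, k) \<in> singletons_upto m \<Longrightarrow> c < w \<and> k < H c"
  using singleton ch_less ab_less by (auto simp: singletons_upto_def)

lemma first_marks_singletons: "first_marks (singletons_upto m) = marks init_values"
proof -
  let ?K = "singletons_upto m"
  have fin: "finite (insert 0 {Suc k | k. k < H e \<and> (e, k) \<in> ?K})" for e
    using next_marks_finite by simp
  have ge: "Suc k \<le> init_values e" if "(e, k) \<in> ?K" for e k
    unfolding init_values_def max_marks_def
    by (rule Max_ge[OF fin]) (use that singletons_range in auto)
  have mem: "(e, k) \<in> ?K" if "init_values e = Suc k" for e k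
  proof -
    have "init_values e \<in> insert 0 {Suc k | k. k < H e \<and> (e, k) \<in> ?K}"
      unfolding init_values_def max_marks_def by (rule Max_in[OF fin]) simp
    then show ?thesis using that by auto
  qed
  show ?thesis
  proof (intro equalityI subrelI)
    fix e k assume "(e, k) \<in> marks init_values"
    then have *: "init_values e = Suc k" by (auto simp: marks_def)
    then show "(e, k) \<in> first_marks ?K" using mem[OF *] ge[of e] unfolding first_marks_def by force
  next
    fix e k assume "(e, k) \<in> first_marks ?K"
    then have k: "(e, k) \<in> ?K" "\<And>j. (e, j) \<in> ?K \<Longrightarrow> j \<le> k" by (auto simp: first_marks_def)
    obtain j where j: "init_values e = Suc j" using ge[OF k(1)] by (metis Suc_le_D)
    have "init_values e = Suc k" using k(2)[OF mem[OF j]] ge[OF k(1)] j by simp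
    then show "(e, k) \<in> marks init_values" using singletons_range[OF k(1)] by (simp add: marks_def)
  qed
qed

text \<open>The assumption identifies the reference number for parities with the number of unclaimed
  vertices at Maker's first move.\<close>

theorem V0_iff_answer:
  assumes "tot H = n"
  shows "V0 H (singletons_upto m) \<longleftrightarrow> hits H (singletons_upto m) \<or> W H init_values"
proof -
  have "finite (singletons_upto m)" by (simp add: singletons_upto_def)
  then have "V0 H (singletons_upto m) \<longleftrightarrow>
    (\<exists>(c, k)\<in>singletons_upto m. odd (k + n)) \<or> W H init_values"
    using assms singletons_range first_marks_singletons init_values_le
    by (intro V0_decide) auto
  then show ?thesis using singletons_range by (auto simp: hits_def)
qed

end

section \<open>Reading the input\<close>

definition read_sizes :: com where
  "read_sizes = seqs [Assign vN (Arr 0 (Num 0)), Assign vM (Arr 0 (Num 1)), Assign vR (Arr 0 (Num 2)),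
     Assign vNN (Plus (Var vN) (Var vN)), Assign vP (Num 3)]"

text \<open>
  If winning set \<open>j\<close> has fewer than two elements, then the entries \<open>j\<close> of \<open>aE1\<close> and \<open>aE2\<close> that do not
  correspond to an element are filled with whatever follows in the input; they are never used.
\<close>

definition read_sets :: com where
  "read_sets = For vJ vM (seqs
     [Put aSz (Var vJ) (Arr 0 (Var vP)), Put aE1 (Var vJ) (Arr 0 (Plus (Var vP) (Num 1))),
      Put aE2 (Var vJ) (Arr 0 (Plus (Var vP) (Num 2))),
      Assign vP (Plus (Plus (Var vP) (Num 1)) (Arr aSz (Var vJ)))])"

definition read_order :: com where
  "read_order = For vJ vR (seqs
     [Put aP1 (Var vJ) (Arr 0 (Var vP)), Put aP2 (Var vJ) (Arr 0 (Plus (Var vP) (Num 1))),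
      Assign vP (Plus (Var vP) (Num 2))])"

definition count_above :: com where
  "count_above = For vJ vR (Cond (eqE (Arr aP1 (Var vJ)) (Arr aP2 (Var vJ))) nop
     (Put aK (Arr aP1 (Var vJ)) (Plus (Arr aK (Arr aP1 (Var vJ))) (Num 1))))"

text \<open>A chain is represented by its maximal element, the only one with nothing above it.
  Counting these also determines the number of chains, which is not part of the input.\<close>

definition number_chains :: com where
  "number_chains = For vV vN (Cond (Arr aK (Var vV)) nop
     (Seq (Put aCh (Var vV) (Var vW)) (Assign vW (Plus (Var vW) (Num 1)))))"

definition label_chains :: com where
  "label_chains = For vJ vR (Cond (Arr aK (Arr aP2 (Var vJ))) nop
     (Put aCh (Arr aP1 (Var vJ)) (Arr aCh (Arr aP2 (Var vJ)))))"

definition count_heights :: com where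
  "count_heights = For vV vN (Put aH (Arr aCh (Var vV)) (Plus (Arr aH (Arr aCh (Var vV))) (Num 1)))"

text \<open>Parities are requested for \<open>k + n\<close> with \<open>k < n\<close>, hence the
  range up to \<open>2 * n\<close>.\<close>

definition parities :: com where
  "parities = For vI vNN (Put aPar (Plus (Var vI) (Num 1)) (Minus (Num 1) (Arr aPar (Var vI))))"

lemmas phase_defs = read_sets_def read_order_def count_above_def number_chains_def
  label_chains_def count_heights_def parities_def

lemma input_append_add: "i < length xs \<Longrightarrow> input (A @ xs @ ys) (length A + i) = xs ! i"
  by (simp add: input_def nth_append)

abbreviation set_code :: "nat list \<Rightarrow> nat list" where
  "set_code S \<equiv> length S # S"

abbreviation pair_code :: "nat \<times> nat \<Rightarrow> nat list" where
  "pair_code \<equiv> (\<lambda>(i, j). [i, j])"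

lemma concat_map_split:
  assumes "j < length xs"
  shows "concat (map f xs) =
    concat (map f (take j xs)) @ f (xs ! j) @ concat (map f (drop (Suc j) xs))"
  by (subst id_take_nth_drop[OF assms]) simp

lemma exec_read_sets:
  assumes inp: "snd s 0 = input inp" "inp = A @ concat (map set_code Fs) @ B"
    and s: "fst s vM = length Fs" "fst s vP = length A"
  shows "(\<forall>j<length Fs. snd (exec read_sets s) aSz j = length (Fs ! j) \<and>
      (0 < length (Fs ! j) \<longrightarrow> snd (exec read_sets s) aE1 j = Fs ! j ! 0) \<and>
      (1 < length (Fs ! j) \<longrightarrow> snd (exec read_sets s) aE2 j = Fs ! j ! 1)) \<and>
    fst (exec read_sets s) vP = length (A @ concat (map set_code Fs))"
proof -
  let ?body = "seqs
     [Put aSz (Var vJ) (Arr 0 (Var vP)), Put aE1 (Var vJ) (Arr 0 (Plus (Var vP) (Num 1))),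
      Put aE2 (Var vJ) (Arr 0 (Plus (Var vP) (Num 2))),
      Assign vP (Plus (Plus (Var vP) (Num 1)) (Arr aSz (Var vJ)))]"
  define I where "I k s' \<longleftrightarrow> snd s' 0 = input inp \<and>
    fst s' vP = length (A @ concat (map set_code (take k Fs))) \<and>
    (\<forall>j<k. snd s' aSz j = length (Fs ! j) \<and>
      (0 < length (Fs ! j) \<longrightarrow> snd s' aE1 j = Fs ! j ! 0) \<and>
      (1 < length (Fs ! j) \<longrightarrow> snd s' aE2 j = Fs ! j ! 1))" for k and s' :: state
  have "I (fst s vM) (exec read_sets s)"
    unfolding read_sets_def
  proof (rule exec_For_inv)
    show "I 0 s" using inp s by (simp add: I_def)
    fix j s' assume j: "j < fst s vM" "fst s' vJ = j" and I: "I j s'"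
    have jl: "j < length Fs" using j s by simp
    let ?A = "A @ concat (map set_code (take j Fs))"
    have eq: "inp = ?A @ set_code (Fs ! j) @ concat (map set_code (drop (Suc j) Fs)) @ B"
      unfolding inp(2) by (subst concat_map_split[OF jl]) simp
    have at: "input inp (length ?A + i) = set_code (Fs ! j) ! i" if "i < Suc (length (Fs ! j))" for i
      by (subst eq, rule input_append_add) (use that in simp)
    have "input inp (length ?A) = length (Fs ! j)" using at[of 0] by simp
    moreover have "0 < length (Fs ! j) \<longrightarrow> input inp (Suc (length ?A)) = Fs ! j ! 0"
      using at[of 1] by simp
    moreover have "1 < length (Fs ! j) \<longrightarrow> input inp (Suc (Suc (length ?A))) = Fs ! j ! 1"
      using at[of 2] by (simp add: numeral_2_eq_2)
    ultimately show "I (Suc j) (exec ?body s')"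
      using I j jl by (auto simp: I_def less_Suc_eq take_Suc_conv_app_nth simp del: length_append)
         (simp_all)
  qed (auto simp: I_def)
  then show ?thesis using s by (simp add: I_def)
qed

lemma exec_read_order:
  assumes inp: "snd s 0 = input inp" "inp = A @ concat (map pair_code Ps)"
    and s: "fst s vR = length Ps" "fst s vP = length A"
  shows "\<forall>j<length Ps. snd (exec read_order s) aP1 j = fst (Ps ! j) \<and>
    snd (exec read_order s) aP2 j = snd (Ps ! j)"
proof -
  let ?body = "seqs
     [Put aP1 (Var vJ) (Arr 0 (Var vP)), Put aP2 (Var vJ) (Arr 0 (Plus (Var vP) (Num 1))),
      Assign vP (Plus (Var vP) (Num 2))]"
  define I where "I k s' \<longleftrightarrow> snd s' 0 = input inp \<and>
    fst s' vP = length (A @ concat (map pair_code (take k Ps))) \<and>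
    (\<forall>j<k. snd s' aP1 j = fst (Ps ! j) \<and> snd s' aP2 j = snd (Ps ! j))" for k and s' :: state
  have "I (fst s vR) (exec read_order s)"
    unfolding read_order_def
  proof (rule exec_For_inv)
    show "I 0 s" using inp s by (simp add: I_def)
    fix j s' assume j: "j < fst s vR" "fst s' vJ = j" and I: "I j s'"
    have jl: "j < length Ps" using j s by simp
    let ?A = "A @ concat (map pair_code (take j Ps))"
    have eq: "inp = ?A @ pair_code (Ps ! j) @ concat (map pair_code (drop (Suc j) Ps))"
      unfolding inp(2) by (subst concat_map_split[OF jl]) simp
    have at: "input inp (length ?A + i) = pair_code (Ps ! j) ! i" if "i < 2" for i
      by (subst eq, rule input_append_add) (use that in \<open>simp add: case_prod_beta\<close>)
    have "input inp (length ?A) = fst (Ps ! j)" "input inp (Suc (length ?A)) = snd (Ps ! j)"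
      using at[of 0] at[of 1] by (simp_all add: case_prod_beta)
    then show "I (Suc j) (exec ?body s')"
      using I j jl by (auto simp: I_def less_Suc_eq take_Suc_conv_app_nth case_prod_beta
          simp del: length_append) (simp_all)
  qed (auto simp: I_def)
  then show ?thesis using s by (simp add: I_def)
qed

lemma exec_count_above:
  assumes s: "fst s vR = length Ps" "\<And>v. snd s aK v = 0"
    "\<And>j. j < length Ps \<Longrightarrow> snd s aP1 j = fst (Ps ! j) \<and> snd s aP2 j = snd (Ps ! j)"
    and "distinct Ps"
  shows "snd (exec count_above s) aK v = card {t. (v, t) \<in> set Ps \<and> t \<noteq> v}"
proof -
  let ?f = "\<lambda>v p. fst p = v \<and> snd p \<noteq> v"
  define I where "I k s' \<longleftrightarrow> snd s' aP1 = snd s aP1 \<and> snd s' aP2 = snd s aP2 \<and>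
    (\<forall>v. snd s' aK v = length (filter (?f v) (take k Ps)))" for k and s' :: state
  have "I (fst s vR) (exec count_above s)"
    unfolding count_above_def
  proof (rule exec_For_inv)
    show "I 0 s" using s by (simp add: I_def)
    fix j s' assume j: "j < fst s vR" "fst s' vJ = j" and I: "I j s'"
    show "I (Suc j) (exec (Cond (eqE (Arr aP1 (Var vJ)) (Arr aP2 (Var vJ))) nop
     (Put aK (Arr aP1 (Var vJ)) (Plus (Arr aK (Arr aP1 (Var vJ))) (Num 1)))) s')"
      using I j s by (auto simp: I_def take_Suc_conv_app_nth)
  qed (auto simp: I_def)
  then have "snd (exec count_above s) aK v = length (filter (?f v) Ps)"
    using s by (simp add: I_def)
  also have "\<dots> = card (set (filter (?f v) Ps))"
    using assms(4) by (simp add: distinct_card[symmetric] del: set_filter)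
  also have "set (filter (?f v) Ps) = Pair v ` {t. (v, t) \<in> set Ps \<and> t \<noteq> v}" by auto
  also have "card \<dots> = card {t. (v, t) \<in> set Ps \<and> t \<noteq> v}"
    by (rule card_image) (auto simp: inj_on_def)
  finally show ?thesis .
qed

lemma card_less_Suc_filter:
  "card {v. v < Suc k \<and> Q v} = card {v. v < k \<and> Q v} + of_bool (Q k)"
proof -
  have "{v. v < Suc k \<and> Q v} = (if Q k then insert k {v. v < k \<and> Q v} else {v. v < k \<and> Q v})"
    by (auto simp: less_Suc_eq)
  then show ?thesis by simp
qed

lemma exec_number_chains:
  assumes "fst s vN = n" "fst s vW = 0"
  shows "fst (exec number_chains s) vW = card {v. v < n \<and> snd s aK v = 0} \<and>
    (\<forall>v<n. snd s aK v = 0 \<longrightarrow> snd (exec number_chains s) aCh v = card {u. u < v \<and> snd s aK u = 0})"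
proof -
  define I where "I k s' \<longleftrightarrow> snd s' aK = snd s aK \<and>
    fst s' vW = card {v. v < k \<and> snd s aK v = 0} \<and>
    (\<forall>v<k. snd s aK v = 0 \<longrightarrow> snd s' aCh v = card {u. u < v \<and> snd s aK u = 0})" for k and s' :: state
  have "I (fst s vN) (exec number_chains s)"
    unfolding number_chains_def
  proof (rule exec_For_inv)
    show "I 0 s" using assms by (simp add: I_def)
    fix k s' assume "k < fst s vN" "fst s' vV = k" "I k s'"
    then show "I (Suc k) (exec (Cond (Arr aK (Var vV)) nop
     (Seq (Put aCh (Var vV) (Var vW)) (Assign vW (Plus (Var vW) (Num 1))))) s')"
      by (auto simp: I_def card_less_Suc_filter All_less_Suc)
  qed (auto simp: I_def)
  then show ?thesis using assms by (simp add: I_def)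
qed

text \<open>Every vertex is paired with the maximal one of its chain, so one pass suffices. Labels
  are copied only from maximal vertices, and these are overwritten only through their reflexive
  pairs, with the same value; so the order of the pairs does not matter.\<close>

lemma exec_label_chains:
  assumes s: "fst s vR = length Ps"
    "\<And>j. j < length Ps \<Longrightarrow> snd s aP1 j = fst (Ps ! j) \<and> snd s aP2 j = snd (Ps ! j)"
    and top: "\<And>u t t'. (u, t) \<in> set Ps \<Longrightarrow> (u, t') \<in> set Ps \<Longrightarrow> snd s aK t = 0 \<Longrightarrow> snd s aK t' = 0 \<Longrightarrow> t = t'"
    and refl: "\<And>u t. (u, t) \<in> set Ps \<Longrightarrow> snd s aK u = 0 \<Longrightarrow> t = u"
    and ut: "(u, t) \<in> set Ps" "snd s aK t = 0"
  shows "snd (exec label_chains s) aCh u = snd s aCh t"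
proof -
  define I where "I k s' \<longleftrightarrow> snd s' aK = snd s aK \<and> snd s' aP1 = snd s aP1 \<and> snd s' aP2 = snd s aP2 \<and>
    (\<forall>t. snd s aK t = 0 \<longrightarrow> snd s' aCh t = snd s aCh t) \<and>
    (\<forall>u t. (u, t) \<in> set (take k Ps) \<longrightarrow> snd s aK t = 0 \<longrightarrow> snd s' aCh u = snd s aCh t)" for k and s' :: state
  have "I (fst s vR) (exec label_chains s)"
    unfolding label_chains_def
  proof (rule exec_For_inv)
    show "I 0 s" by (simp add: I_def)
    fix k s' assume k: "k < fst s vR" "fst s' vJ = k" and I: "I k s'"
    have kl: "k < length Ps" using k s by simp
    obtain u0 t0 where ut0: "Ps ! k = (u0, t0)" by (cases "Ps ! k")
    have mem: "(u0, t0) \<in> set Ps" using kl ut0 by (metis nth_mem)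
    have P: "snd s' aP1 k = u0" "snd s' aP2 k = t0" using I s(2)[OF kl] ut0 by (auto simp: I_def)
    have st: "set (take (Suc k) Ps) = insert (u0, t0) (set (take k Ps))"
      using kl ut0 by (simp add: take_Suc_conv_app_nth)
    have sub: "(a, b) \<in> set Ps" if "(a, b) \<in> set (take k Ps)" for a b
      using that by (rule in_set_takeD)
    let ?c = "Cond (Arr aK (Arr aP2 (Var vJ))) nop
     (Put aCh (Arr aP1 (Var vJ)) (Arr aCh (Arr aP2 (Var vJ))))"
    show "I (Suc k) (exec ?c s')"
    proof (cases "snd s aK t0 = 0")
      case False
      then show ?thesis using I P k by (auto simp: I_def st)
    next
      case True
      have "exec ?c s' = (fst s', (snd s')(aCh := (snd s' aCh)(u0 := snd s aCh t0)))"
        using I P k True by (simp add: I_def)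
      then show ?thesis
        using I True top[OF mem] refl[OF mem] sub by (auto simp: I_def st)
    qed
  qed (auto simp: I_def)
  then show ?thesis using s ut by (simp add: I_def)
qed

lemma exec_count_heights:
  assumes "fst s vN = n" "\<And>c. snd s aH c = 0"
  shows "snd (exec count_heights s) aH c = card {v. v < n \<and> snd s aCh v = c}"
proof -
  define I where "I k s' \<longleftrightarrow> snd s' aCh = snd s aCh \<and>
    (\<forall>c. snd s' aH c = card {v. v < k \<and> snd s aCh v = c})" for k and s' :: state
  have "I (fst s vN) (exec count_heights s)"
    unfolding count_heights_def
  proof (rule exec_For_inv)
    show "I 0 s" using assms by (simp add: I_def)
    fix k s' assume "k < fst s vN" "fst s' vV = k" "I k s'"
    then show "I (Suc k) (exec (Put aH (Arr aCh (Var vV))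
      (Plus (Arr aH (Arr aCh (Var vV))) (Num 1))) s')"
      by (auto simp: I_def card_less_Suc_filter)
  qed (auto simp: I_def)
  then show ?thesis using assms by (simp add: I_def)
qed

lemma exec_parities:
  assumes "snd s aPar 0 = 0"
  shows "\<forall>i\<le>fst s vNN. snd (exec parities s) aPar i = of_bool (odd i)"
proof -
  define I where "I k s' \<longleftrightarrow> (\<forall>i\<le>k. snd s' aPar i = of_bool (odd i))" for k :: nat and s' :: state
  have "I (fst s vNN) (exec parities s)"
    unfolding parities_def
    by (rule exec_For_inv) (use assms in \<open>auto simp: I_def le_Suc_eq\<close>)
  then show ?thesis by (simp add: I_def)
qed

definition analyse :: com where
  "analyse = seqs [read_sets, read_order, count_above, number_chains, label_chains, count_heights,
     parities, Assign vWW (Plus (Var vW) (Var vW))]"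

lemma phase_mods:
  "vmods read_sets = {vJ, vP}" "amods read_sets = {aSz, aE1, aE2}"
  "vmods read_order = {vJ, vP}" "amods read_order = {aP1, aP2}"
  "vmods count_above = {vJ, vNop}" "amods count_above = {aK}"
  "vmods number_chains = {vV, vW, vNop}" "amods number_chains = {aCh}"
  "vmods label_chains = {vJ, vNop}" "amods label_chains = {aCh}"
  "vmods count_heights = {vV}" "amods count_heights = {aH}"
  "vmods parities = {vI}" "amods parities = {aPar}"
  by (auto simp: phase_defs)

definition program :: com where
  "program = Seq read_sizes (Seq analyse (Seq set_strides (Seq fill_table answer)))"

text \<open>Two vertices belong to the same chain iff \<open>\<kappa>\<close> takes the same value on them.\<close>

locale chain_poset =
  fixes n :: nat and Q :: "(nat \<times> nat) set" and \<kappa> :: "nat \<Rightarrow> 'c"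
  assumes dom: "Q \<subseteq> {..<n} \<times> {..<n}"
    and refl: "v < n \<Longrightarrow> (v, v) \<in> Q"
    and antisym: "(u, v) \<in> Q \<Longrightarrow> (v, u) \<in> Q \<Longrightarrow> u = v"
    and trans: "(u, v) \<in> Q \<Longrightarrow> (v, x) \<in> Q \<Longrightarrow> (u, x) \<in> Q"
    and same: "(u, v) \<in> Q \<Longrightarrow> \<kappa> u = \<kappa> v"
    and total: "u < n \<Longrightarrow> v < n \<Longrightarrow> \<kappa> u = \<kappa> v \<Longrightarrow> (u, v) \<in> Q \<or> (v, u) \<in> Q"
begin

section \<open>Coordinates in a union of disjoint chains\<close>

definition above :: "nat \<Rightarrow> nat" where
  "above v = card {t. (v, t) \<in> Q \<and> t \<noteq> v}"

lemma finite_above: "finite {t. (v, t) \<in> Q \<and> t \<noteq> v}"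
  by (rule finite_subset[of _ "{..<n}"]) (use dom in auto)

lemma above_less: "(u, v) \<in> Q \<Longrightarrow> u \<noteq> v \<Longrightarrow> above v < above u"
  unfolding above_def by (rule psubset_card_mono[OF finite_above]) (use trans antisym in blast)

lemma le_iff: "u < n \<Longrightarrow> v < n \<Longrightarrow> (u, v) \<in> Q \<longleftrightarrow> \<kappa> u = \<kappa> v \<and> above v \<le> above u"
  using same total above_less refl by (metis leD less_imp_le order_refl)

lemma above_inj: "u < n \<Longrightarrow> v < n \<Longrightarrow> \<kappa> u = \<kappa> v \<Longrightarrow> above u = above v \<Longrightarrow> u = v"
  using le_iff antisym by (metis order_refl)

lemma top_exists: "v < n \<Longrightarrow> \<exists>t. (v, t) \<in> Q \<and> above t = 0"
proof (induction "above v" arbitrary: v rule: less_induct)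
  case less
  show ?case
  proof (cases "above v = 0")
    case True
    then show ?thesis using refl less.prems by blast
  next
    case False
    then have "{t. (v, t) \<in> Q \<and> t \<noteq> v} \<noteq> {}"
      unfolding above_def by (metis card.empty)
    then obtain t where t: "(v, t) \<in> Q" "t \<noteq> v" by blast
    then obtain t' where "(t, t') \<in> Q" "above t' = 0"
      using less.hyps[of t] above_less[of v t] dom by auto
    then show ?thesis using t trans by blast
  qed
qed

lemma top_unique: "(v, t) \<in> Q \<Longrightarrow> (v, t') \<in> Q \<Longrightarrow> above t = 0 \<Longrightarrow> above t' = 0 \<Longrightarrow> t = t'"
  using above_inj[of t t'] same[of v t] same[of v t'] dom by auto

definition top :: "nat \<Rightarrow> nat" where
  "top v = (THE t. (v, t) \<in> Q \<and> above t = 0)"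

lemma topI: "(v, t) \<in> Q \<Longrightarrow> above t = 0 \<Longrightarrow> top v = t"
  unfolding top_def using top_unique by blast

lemma top: "v < n \<Longrightarrow> (v, top v) \<in> Q \<and> above (top v) = 0"
  using top_exists topI by metis

definition number :: "nat \<Rightarrow> nat" where
  "number t = card {u. u < t \<and> above u = 0}"

definition chain :: "nat \<Rightarrow> nat" where
  "chain v = number (top v)"

lemma number_mono: "t < t' \<Longrightarrow> above t = 0 \<Longrightarrow> number t < number t'"
  unfolding number_def by (rule psubset_card_mono) auto

lemma chain_eq_iff: "u < n \<Longrightarrow> v < n \<Longrightarrow> chain u = chain v \<longleftrightarrow> \<kappa> u = \<kappa> v"
proof
  assume uv: "u < n" "v < n"
  {
    assume c: "chain u = chain v"
    have "top u = top v"
      using number_mono[of "top u" "top v"] number_mono[of "top v" "top u"] top[OF uv(1)]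
        top[OF uv(2)] c
      by (metis chain_def less_irrefl linorder_neqE_nat)
    then show "\<kappa> u = \<kappa> v" using top uv same by metis
  }
  {
    assume k: "\<kappa> u = \<kappa> v"
    have "\<kappa> (top u) = \<kappa> (top v)" using top uv same k by metis
    then have "top u = top v" using above_inj[of "top u" "top v"] top uv dom by auto
    then show "chain u = chain v" by (simp add: chain_def)
  }
qed

definition width :: nat where
  "width = card {v. v < n \<and> above v = 0}"

lemma chain_less: "v < n \<Longrightarrow> chain v < width"
  unfolding chain_def number_def width_def
  by (rule psubset_card_mono) (use top[of v] dom in auto)

text \<open>Each class of \<open>\<kappa>\<close> contains exactly one maximal vertex.\<close>

lemma width_eq: "width = card (\<kappa> ` {..<n})"
proof -
  have "inj_on \<kappa> {v. v < n \<and> above v = 0}" using above_inj by (auto simp: inj_on_def)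
  moreover have "\<kappa> ` {v. v < n \<and> above v = 0} = \<kappa> ` {..<n}"
  proof (intro equalityI subsetI)
    fix c assume "c \<in> \<kappa> ` {..<n}"
    then obtain v where v: "v < n" "c = \<kappa> v" by auto
    then have "top v < n" "above (top v) = 0" "\<kappa> (top v) = c" using top dom same by force+
    then show "c \<in> \<kappa> ` {v. v < n \<and> above v = 0}" by auto
  qed auto
  ultimately show ?thesis unfolding width_def by (metis card_image)
qed

definition height :: "nat \<Rightarrow> nat" where
  "height c = card {v. v < n \<and> chain v = c}"

lemma height_chain: "v < n \<Longrightarrow> height (chain v) = card {u. u < n \<and> \<kappa> u = \<kappa> v}"
  unfolding height_def using chain_eq_iff by (intro arg_cong[where f = card]) auto

lemma above_less_height: "v < n \<Longrightarrow> above v < height (chain v)"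
  unfolding height_chain above_def
  by (rule psubset_card_mono) (use dom same in auto)

text \<open>On a chain, \<open>above\<close> is injective with values below the height, which is the
  number of its vertices; by counting, every value occurs.\<close>

lemma above_surj:
  assumes "k < height c"
  shows "\<exists>v<n. chain v = c \<and> above v = k"
proof -
  let ?C = "{v. v < n \<and> chain v = c}"
  have "inj_on above ?C" using above_inj chain_eq_iff by (auto simp: inj_on_def)
  moreover have "above ` ?C \<subseteq> {..<height c}" using above_less_height by auto
  ultimately have "above ` ?C = {..<height c}"
    by (intro card_subset_eq) (auto simp: card_image height_def)
  then have "k \<in> above ` ?C" using assms by simp
  then show ?thesis by auto
qed

lemma sum_height: "sum height {..<width} = n"
proof -
  have "sum height {..<width} = card (\<Union>c<width. {v. v < n \<and> chain v = c})"
    unfolding height_def by (rule card_UN_disjoint[symmetric]) auto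
  also have "(\<Union>c<width. {v. v < n \<and> chain v = c}) = {..<n}" using chain_less by auto
  finally show ?thesis by simp
qed

lemma chain_label:
  assumes "(u, t) \<in> Q" "above t = 0"
  shows "chain u = card {v. v < t \<and> above v = 0}"
  using topI[OF assms] by (simp add: chain_def number_def)

end


section \<open>Asymptotics of the running time\<close>

primrec degree :: "(nat \<Rightarrow> nat) \<Rightarrow> com \<Rightarrow> nat" where
  "degree \<delta> (Assign x e) = 0"
| "degree \<delta> (Put a e f) = 0"
| "degree \<delta> (Seq c d) = max (degree \<delta> c) (degree \<delta> d)"
| "degree \<delta> (Cond e c d) = max (degree \<delta> c) (degree \<delta> d)"
| "degree \<delta> (For i x c) = \<delta> x + degree \<delta> c"

text \<open>If every loop bound is a monomial in \<open>g\<close>, then so is the bound on the cost,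
  with the exponent of the most expensive nest of loops. \<open>1 \<le> g\<close> lets constants and
  cheaper parts be absorbed.\<close>

lemma cost_le_power:
  assumes "\<And>x. \<beta> x \<le> \<alpha> x * g ^ \<delta> x" "1 \<le> g"
  shows "cost c \<beta> \<le> cost c \<alpha> * g ^ degree \<delta> c"
proof (induction c)
  case (Seq c d)
  have "cost c \<beta> \<le> cost c \<alpha> * g ^ max (degree \<delta> c) (degree \<delta> d)"
    by (rule le_trans[OF Seq(1)]) (use assms(2) in \<open>simp add: power_increasing\<close>)
  moreover have "cost d \<beta> \<le> cost d \<alpha> * g ^ max (degree \<delta> c) (degree \<delta> d)"
    by (rule le_trans[OF Seq(2)]) (use assms(2) in \<open>simp add: power_increasing\<close>)
  ultimately show ?case by (simp add: algebra_simps)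
next
  case (Cond e c d)
  let ?l = "length (comp_exp e 51) + 3" and ?g = "g ^ max (degree \<delta> c) (degree \<delta> d)"
  have "cost c \<beta> \<le> cost c \<alpha> * ?g"
    by (rule le_trans[OF Cond(1)]) (use assms(2) in \<open>simp add: power_increasing\<close>)
  moreover have "cost d \<beta> \<le> cost d \<alpha> * ?g"
    by (rule le_trans[OF Cond(2)]) (use assms(2) in \<open>simp add: power_increasing\<close>)
  moreover have "?l \<le> ?l * ?g" using assms(2) by simp
  ultimately have "?l + cost c \<beta> + cost d \<beta> \<le> ?l * ?g + cost c \<alpha> * ?g + cost d \<alpha> * ?g"
    by (intro add_mono)
  then show ?case by (simp only: cost.simps degree.simps add_mult_distrib)
next
  case (For i x c)
  let ?g = "g ^ (\<delta> x + degree \<delta> c)"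
  have "1 \<le> g ^ degree \<delta> c" using assms(2) by simp
  then have "cost c \<beta> + 6 \<le> (cost c \<alpha> + 6) * g ^ degree \<delta> c"
    using For by (simp add: add_mult_distrib)
  then have "\<beta> x * (cost c \<beta> + 6) \<le> (\<alpha> x * g ^ \<delta> x) * ((cost c \<alpha> + 6) * g ^ degree \<delta> c)"
    using assms(1) by (intro mult_le_mono) auto
  also have "\<dots> = \<alpha> x * (cost c \<alpha> + 6) * ?g" by (simp add: power_add)
  finally have "3 + \<beta> x * (cost c \<beta> + 6) \<le> 3 * ?g + \<alpha> x * (cost c \<alpha> + 6) * ?g"
    using one_le_power[OF assms(2), of "\<delta> x + degree \<delta> c"] by linarith
  then show ?case by (simp only: cost.simps degree.simps add_mult_distrib)
qed (use assms in auto)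

text \<open>
  For a fixed number \<open>w\<close> of chains there are \<open>O(h)\<close> vertices, \<open>O(h\<^sup>2)\<close> winning sets and pairs of the
  order, and at most \<open>(h + 1)\<close> to the power \<open>2 w\<close> states.
\<close>

definition loop_degree :: "nat \<Rightarrow> nat \<Rightarrow> nat" where
  "loop_degree w = (\<lambda>_. 0)(vN := 1, vNN := 1, vM := 2, vR := 2, vS := 2 * w)"

text \<open>From \<open>n \<le> w * h\<close> follows \<open>n + 1 \<le> (w + 1) * (h + 1)\<close>,
  and there are at most \<open>(n + 1) ^ 2\<close> winning sets and as many pairs. The one factor
  \<open>(2 * w + 2) ^ 2\<close> covers these and also \<open>n + n\<close>, \<open>w\<close> and
  \<open>w + w\<close>. The base \<open>h + 1\<close> keeps all powers positive, even for
  \<open>h = 0\<close>.\<close>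

definition loop_bound :: "nat \<Rightarrow> nat \<Rightarrow> nat \<Rightarrow> nat" where
  "loop_bound w h x = (2 * w + 2) ^ 2 * (h + 1) ^ loop_degree w x"

definition time_bound :: "nat \<Rightarrow> nat \<Rightarrow> nat" where
  "time_bound w h = (10 + cost program (\<lambda>_. (2 * w + 2) ^ 2)) * (h + 1) ^ (2 * (w + 1))"

lemmas program_defs = program_def read_sizes_def analyse_def phase_defs set_strides_def fill_table_def
  decode_def evaluate_def maker_move_def reply_def load_marks_def scan_edges_def try_edge_def
  encode_def refute_move_def answer_def init_marks_def eqE_def

text \<open>The exponent is attained in \<open>fill_table\<close>: \<open>2 * w\<close> from the
  loop over the states and 2 from the scan of the winning sets. The loops over moves and replies in
  between have degree 0.\<close>

lemma degree_program: "degree (loop_degree w) program = 2 * (w + 1)"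
  by (simp add: program_defs loop_degree_def)

lemma wf_program: "wf_com program"
  by (simp add: program_defs)

lemma cost_program: "10 + cost program (loop_bound w h) \<le> time_bound w h"
proof -
  let ?\<alpha> = "\<lambda>_ :: nat. (2 * w + 2) ^ 2"
  have "cost program (loop_bound w h) \<le>
    cost program ?\<alpha> * (h + 1) ^ degree (loop_degree w) program"
    by (rule cost_le_power) (simp_all add: loop_bound_def)
  moreover have "1 \<le> (h + 1) ^ (2 * (w + 1))" by (rule one_le_power) simp
  ultimately show ?thesis
    unfolding degree_program time_bound_def add_mult_distrib by linarith
qed

lemma time_bound_bigo: "(\<lambda>h. real (time_bound w h)) \<in> O(\<lambda>h. real h ^ (2 * (w + 1)))"
proof (rule bigoI)
  let ?K = "real (10 + cost program (\<lambda>_. (2 * w + 2) ^ 2))" and ?e = "2 * (w + 1)"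
  show "\<forall>\<^sub>F h in sequentially. norm (real (time_bound w h)) \<le> ?K * 2 ^ ?e * norm (real h ^ ?e)"
  proof (rule eventually_sequentiallyI[of 1])
    fix h :: nat assume "1 \<le> h"
    then have "real (h + 1) ^ ?e \<le> (2 * real h) ^ ?e" by (intro power_mono) auto
    then have "?K * real (h + 1) ^ ?e \<le> ?K * (2 * real h) ^ ?e" by (intro mult_left_mono) auto
    then show "norm (real (time_bound w h)) \<le> ?K * 2 ^ ?e * norm (real h ^ ?e)"
      unfolding time_bound_def by (simp only: of_nat_mult of_nat_power power_mult_distrib) simp
  qed
qed

text \<open>The value \<open>n\<close>, which the intersection removes, stands for an absent
  element, so two numbers up to \<open>n\<close> describe every such set.\<close>

lemma card_small_subsets: "card {S. S \<subseteq> {..<n} \<and> card S \<le> 2} \<le> (n + 1) ^ 2"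
proof -
  have "{S. S \<subseteq> {..<n} \<and> card S \<le> 2} \<subseteq> (\<lambda>(a, b). {a, b} \<inter> {..<n}) ` ({..n} \<times> {..n})"
  proof
    fix S assume "S \<in> {S. S \<subseteq> {..<n} \<and> card S \<le> 2}"
    then have S: "S \<subseteq> {..<n}" "card S \<le> 2" by auto
    have "finite S" using S(1) by (rule finite_subset) simp
    consider "card S = 0" | "card S = 1" | "card S = 2" using S(2) by linarith
    then show "S \<in> (\<lambda>(a, b). {a, b} \<inter> {..<n}) ` ({..n} \<times> {..n})"
    proof cases
      case 1
      then have "S = {n, n} \<inter> {..<n}" using \<open>finite S\<close> by simp
      then show ?thesis by force
    next
      case 2
      then obtain a where "S = {a}" by (auto simp: card_1_singleton_iff)
      then have "S = {a, n} \<inter> {..<n}" "a \<le> n" using S by auto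
      then show ?thesis by force
    next
      case 3
      then obtain a b where "S = {a, b}" by (auto simp: card_2_iff)
      then have "S = {a, b} \<inter> {..<n}" "a \<le> n" "b \<le> n" using S by auto
      then show ?thesis by force
    qed
  qed
  then have "card {S. S \<subseteq> {..<n} \<and> card S \<le> 2} \<le> card ({..n} \<times> {..n})"
    by (rule surj_card_le[rotated]) simp
  then show ?thesis by (simp add: power2_eq_square)
qed

section \<open>The whole program on an encoded game\<close>

locale encoded_game = chain_poset n "set Ps" \<kappa>
  for n :: nat and Ps :: "(nat \<times> nat) list" and \<kappa> :: "nat \<Rightarrow> 'c" +
  fixes Fs :: "nat list list" and inp :: "nat list" and w h :: nat
  assumes Ps: "distinct Ps"
    and Fs: "distinct (map set Fs)" "\<And>S. S \<in> set Fs \<Longrightarrow> distinct S \<and> set S \<subseteq> {..<n} \<and> length S \<le> 2"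
    and inp: "inp = [n, length Fs, length Ps] @ concat (map set_code Fs) @ concat (map pair_code Ps)"
    and w: "card (\<kappa> ` {..<n}) = w"
    and h: "\<And>v. v < n \<Longrightarrow> card {u. u < n \<and> \<kappa> u = \<kappa> v} \<le> h"
begin

lemma width_w: "width = w"
  using w width_eq by simp

lemma height_le_h: "height c \<le> h"
proof (cases "\<exists>v<n. chain v = c")
  case True
  then show ?thesis using h height_chain by auto
next
  case False
  then have "{v. v < n \<and> chain v = c} = {}" by auto
  then show ?thesis unfolding height_def by (simp only: card.empty)
qed

lemma n_le: "n \<le> w * h"
  using sum_height sum_bounded_above[of "{..<width}" height h] height_le_h width_w by simp

lemma length_Fs: "length Fs \<le> (n + 1) ^ 2"
proof -
  have "length Fs = card (set ` set Fs)" using Fs(1) by (metis distinct_card length_map set_map)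
  also have "\<dots> \<le> card {S. S \<subseteq> {..<n} \<and> card S \<le> 2}"
    by (rule card_mono)
       (use Fs(2) in \<open>auto simp: distinct_card intro: finite_subset[of _ "Pow {..<n}"]\<close>)
  also have "\<dots> \<le> (n + 1) ^ 2" by (rule card_small_subsets)
  finally show ?thesis .
qed

lemma length_Ps: "length Ps \<le> n ^ 2"
  using card_mono[OF _ dom] distinct_card[OF Ps] by (simp add: power2_eq_square)

lemma bounds_le:
  assumes "\<And>x. x \<in> {vN, vM, vR, vW, vWW, vNN} \<Longrightarrow> fst s x \<le>
    (if x = vN then n else if x = vM then length Fs else if x = vR then length Ps
     else if x = vNN then n + n else if x = vW then w else w + w)"
    and "x \<in> {vN, vM, vR, vW, vWW, vNN}"
  shows "fst s x \<le> loop_bound w h x"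
proof -
  have n1: "n + 1 \<le> (w + 1) * (h + 1)" using n_le by simp
  have sq: "4 * ((w + 1) * (h + 1)) ^ 2 = (2 * w + 2) ^ 2 * (h + 1) ^ 2"
    by (simp add: power2_eq_square algebra_simps)
  have m: "(n + 1) ^ 2 \<le> ((w + 1) * (h + 1)) ^ 2" using n1 by (rule power_mono) simp
  have big: "2 * w + 2 \<le> (2 * w + 2) ^ 2" by (simp add: power2_eq_square)
  have "n + n \<le> (2 * w + 2) * (h + 1)" using n_le by simp
  also have "\<dots> \<le> (2 * w + 2) ^ 2 * (h + 1)" using big by (rule mult_le_mono1)
  finally have nn: "n + n \<le> (2 * w + 2) ^ 2 * (h + 1)" .
  have "length Ps \<le> (n + 1) ^ 2" using length_Ps by (simp add: power2_eq_square)
  then have r: "length Ps \<le> (2 * w + 2) ^ 2 * (h + 1) ^ 2" using m sq by linarith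
  have mm: "length Fs \<le> (2 * w + 2) ^ 2 * (h + 1) ^ 2" using length_Fs m sq by linarith
  have ww: "w + w \<le> (2 * w + 2) ^ 2" using big by linarith
  from assms(2) show ?thesis
    using assms(1)[of x] nn r mm ww by (auto simp: loop_bound_def loop_degree_def)
qed

abbreviation coord :: "nat \<Rightarrow> nat \<times> nat" where
  "coord v \<equiv> (chain v, above v)"

definition set_adj :: "nat \<times> nat \<Rightarrow> nat \<times> nat \<Rightarrow> bool" where
  "set_adj x y \<longleftrightarrow> (\<exists>S\<in>set Fs. length S = 2 \<and>
     (x = coord (S ! 0) \<and> y = coord (S ! 1) \<or> x = coord (S ! 1) \<and> y = coord (S ! 0)))"

definition start_marks :: "(nat \<times> nat) set" where
  "start_marks = {coord (S ! 0) | S. S \<in> set Fs \<and> length S = 1}"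

definition maker_wins :: bool where
  "maker_wins \<longleftrightarrow> [] \<in> set Fs \<or> chain_game.V width set_adj (\<lambda>_. 0) None height start_marks"

definition sizes_read :: state where
  "sizes_read = exec read_sizes (init_state inp)"

lemma sizes_read:
  "fst sizes_read = (\<lambda>_. 0)(vN := n, vM := length Fs, vR := length Ps, vNN := n + n, vP := 3)"
  "snd sizes_read = (\<lambda>a i. if a = 0 then input inp i else 0)"
proof -
  have "input inp 0 = n" "input inp (Suc 0) = length Fs" "input inp 2 = length Ps"
    by (auto simp: inp input_def)
  then show "fst sizes_read = (\<lambda>_. 0)(vN := n, vM := length Fs, vR := length Ps, vNN := n + n, vP := 3)"
    "snd sizes_read = (\<lambda>a i. if a = 0 then input inp i else 0)"
    by (auto simp: sizes_read_def read_sizes_def init_state_def fun_eq_iff)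
qed

lemma exec_analyse:
  defines "s \<equiv> exec analyse sizes_read"
  shows "fst s vN = n" "fst s vM = length Fs" "fst s vW = width" "fst s vWW = width + width"
    "\<And>v. snd s aK v = above v" "\<And>v. v < n \<Longrightarrow> snd s aCh v = chain v" "\<And>c. snd s aH c = height c"
    "\<And>j. j < length Fs \<Longrightarrow> snd s aSz j = length (Fs ! j) \<and>
      (0 < length (Fs ! j) \<longrightarrow> snd s aE1 j = Fs ! j ! 0) \<and>
      (1 < length (Fs ! j) \<longrightarrow> snd s aE2 j = Fs ! j ! 1)"
    "\<And>i. i \<le> n + n \<Longrightarrow> snd s aPar i = of_bool (odd i)"
proof -
  define s1 where "s1 = exec read_sets sizes_read"
  define s2 where "s2 = exec read_order s1"
  define s3 where "s3 = exec count_above s2"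
  define s4 where "s4 = exec number_chains s3"
  define s5 where "s5 = exec label_chains s4"
  define s6 where "s6 = exec count_heights s5"
  define s7 where "s7 = exec parities s6"
  have s: "s = ((fst s7)(vWW := fst s7 vW + fst s7 vW), snd s7)"
    by (simp add: s_def analyse_def s7_def s6_def s5_def s4_def s3_def s2_def s1_def)
  note frame = vframe aframe phase_mods
  have 1: "(\<forall>j<length Fs. snd s1 aSz j = length (Fs ! j) \<and>
      (0 < length (Fs ! j) \<longrightarrow> snd s1 aE1 j = Fs ! j ! 0) \<and>
      (1 < length (Fs ! j) \<longrightarrow> snd s1 aE2 j = Fs ! j ! 1)) \<and>
    fst s1 vP = length ([n, length Fs, length Ps] @ concat (map set_code Fs))"
    unfolding s1_def
  proof (rule exec_read_sets)
    show "inp = [n, length Fs, length Ps] @ concat (map set_code Fs) @ concat (map pair_code Ps)"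
      by (rule inp)
  qed (simp_all add: sizes_read)
  have 2: "\<forall>j<length Ps. snd s2 aP1 j = fst (Ps ! j) \<and> snd s2 aP2 j = snd (Ps ! j)"
    unfolding s2_def
  proof (rule exec_read_order)
    show "inp = ([n, length Fs, length Ps] @ concat (map set_code Fs)) @ concat (map pair_code Ps)"
      by (simp add: inp)
    show "fst s1 vP = length ([n, length Fs, length Ps] @ concat (map set_code Fs))" using 1 by blast
  qed (simp_all add: s1_def frame sizes_read)
  have 3: "snd s3 aK v = above v" for v
    unfolding s3_def above_def
    by (rule exec_count_above[OF _ _ _ Ps])
       (use 2 in \<open>simp_all add: s2_def s1_def frame sizes_read\<close>)
  have 4: "fst s4 vW = width \<and> (\<forall>v<n. above v = 0 \<longrightarrow> snd s4 aCh v = card {u. u < v \<and> above u = 0})"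
    using exec_number_chains[of s3 n] 3
    by (simp add: s4_def[symmetric] width_def) (simp add: s3_def s2_def s1_def frame sizes_read)
  have 5: "snd s5 aCh v = chain v" if v: "v < n" for v
  proof -
    obtain t where t: "(v, t) \<in> set Ps" "above t = 0" using top[OF v] by blast
    have k: "snd s4 aK = snd s3 aK" by (simp add: s4_def frame)
    have "snd s5 aCh v = snd s4 aCh t"
      unfolding s5_def
    proof (rule exec_label_chains[OF _ _ _ _ t(1)])
      show "fst s4 vR = length Ps" by (simp add: s4_def s3_def s2_def s1_def frame sizes_read)
      show "snd s4 aP1 j = fst (Ps ! j) \<and> snd s4 aP2 j = snd (Ps ! j)" if "j < length Ps" for j
        using 2 that by (simp add: s4_def s3_def frame)
      show "t = t'" if "(u, t) \<in> set Ps" "(u, t') \<in> set Ps" "snd s4 aK t = 0" "snd s4 aK t' = 0"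
        for u t t' using that top_unique 3 k by metis
      show "t = u" if "(u, t) \<in> set Ps" "snd s4 aK u = 0" for u t
        using that above_less[of u t] 3 k by fastforce
    qed (use t 3 k in simp)
    also have "\<dots> = chain v" using 4 t dom chain_label[OF t] by auto
    finally show ?thesis .
  qed
  have 6: "snd s6 aH c = height c" for c
  proof -
    have "snd s6 aH c = card {v. v < n \<and> snd s5 aCh v = c}"
      unfolding s6_def
      by (rule exec_count_heights) (simp_all add: s5_def s4_def s3_def s2_def s1_def frame sizes_read)
    also have "\<dots> = height c" unfolding height_def using 5 by (intro arg_cong[where f = card]) auto
    finally show ?thesis .
  qed
  have 7: "\<forall>i\<le>n + n. snd s7 aPar i = of_bool (odd i)"
    using exec_parities[of s6]
    by (simp add: s7_def[symmetric])
       (simp add: s6_def s5_def s4_def s3_def s2_def s1_def frame sizes_read)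
  show "fst s vN = n" "fst s vM = length Fs"
    by (simp_all add: s s7_def s6_def s5_def s4_def s3_def s2_def s1_def frame sizes_read)
  show "fst s vW = width" "fst s vWW = width + width"
    using 4 by (simp_all add: s s7_def s6_def s5_def frame)
  show "snd s aK v = above v" for v
    using 3 by (simp add: s s7_def s6_def s5_def s4_def frame)
  show "v < n \<Longrightarrow> snd s aCh v = chain v" for v
    using 5 by (simp add: s s7_def s6_def frame)
  show "snd s aH c = height c" for c
    using 6 by (simp add: s s7_def frame)
  show "snd s aSz j = length (Fs ! j) \<and>
      (0 < length (Fs ! j) \<longrightarrow> snd s aE1 j = Fs ! j ! 0) \<and>
      (1 < length (Fs ! j) \<longrightarrow> snd s aE2 j = Fs ! j ! 1)" if "j < length Fs" for j
    using 1 that by (simp add: s s7_def s6_def s5_def s4_def s3_def s2_def frame)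
  show "i \<le> n + n \<Longrightarrow> snd s aPar i = of_bool (odd i)" for i
    using 7 by (simp add: s)
qed

text \<open>A winning set of size at most 2 takes at most three cells and a pair takes two, which is
  the space that \<open>prelude\<close> leaves before the arrays.\<close>

lemma length_inp: "length inp \<le> 3 + 3 * input inp 1 + 2 * input inp 2"
proof -
  have i: "input inp 1 = length Fs" "input inp 2 = length Ps" by (auto simp: inp input_def)
  have "length (concat (map set_code Gs)) \<le> 3 * length Gs" if "set Gs \<subseteq> set Fs" for Gs
    using that Fs(2) by (induction Gs) force+
  moreover have "length (concat (map pair_code Qs)) = 2 * length Qs" for Qs :: "(nat \<times> nat) list"
    by (induction Qs) auto
  ultimately show ?thesis unfolding i by (simp add: inp)
qed

theorem program_correct:
  "computes_within (prelude @ comp program 10) inp (of_bool maker_wins) (time_bound w h)"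
proof -
  let ?s0 = "init_state inp"
  let ?s1 = sizes_read
  define s2 where "s2 = exec analyse ?s1"
  define s3 where "s3 = exec set_strides s2"
  define s4 where "s4 = exec fill_table s3"
  note an = exec_analyse[folded s2_def]
  let ?sz = "\<lambda>j. length (Fs ! j)" and ?e1 = "snd s2 aE1" and ?e2 = "snd s2 aE2"
  interpret T: game_tables n "length Fs" width chain above ?sz ?e1 ?e2 height
  proof
    show "height c \<le> n" for c
      unfolding height_def using card_mono[of "{..<n}" "{v. v < n \<and> chain v = c}"] by auto
    fix j assume j: "j < length Fs"
    then have S: "distinct (Fs ! j)" "set (Fs ! j) \<subseteq> {..<n}" using Fs(2) nth_mem by blast+
    show "?e1 j < n \<and> ?e2 j < n \<and> ?e1 j \<noteq> ?e2 j" if "?sz j = 2"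
    proof -
      have "?e1 j = Fs ! j ! 0" "?e2 j = Fs ! j ! 1" using an(8)[OF j] that by auto
      moreover have "Fs ! j ! 0 \<in> set (Fs ! j)" "Fs ! j ! 1 \<in> set (Fs ! j)" using that by auto
      moreover have "Fs ! j ! 0 \<noteq> Fs ! j ! 1" using S that by (simp add: nth_eq_iff_index_eq)
      ultimately show ?thesis using S by auto
    qed
    show "?e1 j < n" if "?sz j = 1"
    proof -
      have "?e1 j = Fs ! j ! 0" using an(8)[OF j] that by auto
      moreover have "Fs ! j ! 0 \<in> set (Fs ! j)" using that by auto
      ultimately show ?thesis using S by auto
    qed
  qed (use chain_less above_less_height above_inj chain_eq_iff in auto)
  have nth_bex: "(\<exists>j<length Fs. R (Fs ! j)) \<longleftrightarrow> (\<exists>S\<in>set Fs. R S)" for R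
    by (metis in_set_conv_nth)
  have "T.adj x y \<longleftrightarrow> (\<exists>j<length Fs. length (Fs ! j) = 2 \<and>
     (x = coord (Fs ! j ! 0) \<and> y = coord (Fs ! j ! 1) \<or> x = coord (Fs ! j ! 1) \<and> y = coord (Fs ! j ! 0)))"
    for x y
    unfolding T.adj_def T.adj_upto_def
  proof (intro ex_cong1 conj_cong refl)
    fix j assume "j < length Fs" "length (Fs ! j) = 2"
    then have "?e1 j = Fs ! j ! 0" "?e2 j = Fs ! j ! 1" using an(8)[of j] by auto
    then show "(x = coord (?e1 j) \<and> y = coord (?e2 j) \<or> x = coord (?e2 j) \<and> y = coord (?e1 j)) \<longleftrightarrow>
      (x = coord (Fs ! j ! 0) \<and> y = coord (Fs ! j ! 1) \<or>
       x = coord (Fs ! j ! 1) \<and> y = coord (Fs ! j ! 0))" by simp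
  qed simp_all
  then have "T.adj x y \<longleftrightarrow> set_adj x y" for x y
    using nth_bex[of "\<lambda>S. length S = 2 \<and>
      (x = coord (S ! 0) \<and> y = coord (S ! 1) \<or> x = coord (S ! 1) \<and> y = coord (S ! 0))"]
    unfolding set_adj_def by (simp only:)
  then have adj: "T.adj = set_adj" by (intro ext)
  have "x \<in> T.singletons_upto (length Fs) \<longleftrightarrow>
      (\<exists>j<length Fs. length (Fs ! j) = 1 \<and> x = coord (Fs ! j ! 0))" for x
  proof -
    have "?e1 j = Fs ! j ! 0" if "j < length Fs" "length (Fs ! j) = 1" for j
      using an(8)[OF that(1)] that(2) by auto
    then show ?thesis unfolding T.singletons_upto_def mem_Collect_eq by metis
  qed
  then have "x \<in> T.singletons_upto (length Fs) \<longleftrightarrow> x \<in> start_marks" for x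
    using nth_bex[of "\<lambda>S. length S = 1 \<and> x = coord (S ! 0)"] unfolding start_marks_def by auto
  then have marks: "T.singletons_upto (length Fs) = start_marks" by (rule set_eqI)
  have "T.tot height = n" unfolding T.tot_def by (rule sum_height)
  note V = T.V0_iff_answer[OF this]
  have t2: "T.tables s2" unfolding T.tables_def using an by auto
  have 3: "T.strides s3" "fst s3 vS = T.stride (width + width)"
    using T.exec_set_strides[OF t2] by (auto simp: s3_def)
  have t3: "T.tables s3" unfolding s3_def
    by (rule T.tables_exec[OF t2]) (auto simp: set_strides_mods)
  have t4: "T.tables s4" unfolding s4_def
    by (rule T.tables_exec[OF t3])
       (auto simp: fill_table_mods decode_mods evaluate_mods maker_move_mods reply_mods)
  have st4: "T.strides s4" unfolding s4_def
    by (rule T.strides_cong[OF _ 3(1)]) (simp add: aframe fill_table_mods)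
  have tb4: "T.table_upto (T.stride (width + width)) s4"
    unfolding s4_def by (rule T.exec_fill_table[OF t3 3])
  have empty: "(\<exists>j<length Fs. ?sz j = 0) \<longleftrightarrow> [] \<in> set Fs" using nth_bex[of "\<lambda>S. length S = 0"] by simp
  have result: "fst (exec answer s4) 0 = of_bool maker_wins"
    unfolding T.exec_answer[OF t4 st4 tb4] maker_wins_def adj[symmetric] marks[symmetric]
      V empty by simp
  have out: "fst (exec program ?s0) 0 = of_bool maker_wins"
    unfolding program_def using result by (simp add: s4_def s3_def s2_def sizes_read_def)

  have stride_le: "T.stride q \<le> (h + 1) ^ q" for q
  proof (induction q)
    case (Suc q)
    have "Suc (if q < width then height q else height (q - width)) \<le> h + 1" using height_le_h by auto
    then have "T.stride (Suc q) \<le> (h + 1) ^ q * (h + 1)"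
      unfolding T.stride.simps by (intro mult_le_mono Suc)
    then show ?case by (simp only: power_Suc2)
  qed simp
  let ?\<beta> = "loop_bound w h"
  have "width + width = 2 * w" using width_w by simp
  then have "T.stride (width + width) \<le> (h + 1) ^ (2 * w)" using stride_le[of "2 * w"] by simp
  also have "\<dots> \<le> (2 * w + 2) ^ 2 * (h + 1) ^ (2 * w)"
    using mult_le_mono1[OF one_le_power[of "2 * w + 2" 2], of "(h + 1) ^ (2 * w)"] by simp
  also have "\<dots> = ?\<beta> vS" by (simp add: loop_bound_def loop_degree_def)
  finally have S: "T.stride (width + width) \<le> ?\<beta> vS" .
  have wf: "wf_com read_sizes" "wf_com analyse" "wf_com set_strides" "wf_com fill_table" "wf_com answer"
    using wf_program by (simp_all add: program_def)
  have bd: "bounds read_sizes = {}" "bounds analyse = {vM, vR, vN, vNN}" "bounds set_strides = {vW, vN}"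
    "bounds fill_table = {vS, vWW, vN, vW, vM}" "bounds answer = {vW, vM, vN}"
    by (auto simp: program_defs)
  have vm: "vmods analyse = {vJ, vP, vNop, vV, vW, vI, vWW}"
    "vmods answer = {0, vE, vWon, vJ, vX, vNop, vCode, vI}"
    by (auto simp: analyse_def phase_mods answer_def init_marks_mods encode_mods)
  note mods = vm set_strides_mods fill_table_mods decode_mods evaluate_mods maker_move_mods reply_mods
  have f: "fst s2 vN = n" "fst s2 vM = length Fs" "fst s2 vW = w" "fst s2 vWW = w + w"
    using an width_w by auto
  have f3: "fst s3 x = fst s2 x" if "x \<in> {vN, vM, vW, vWW}" for x
    unfolding s3_def by (rule vframe) (use that in \<open>auto simp: mods\<close>)
  have f4: "fst s4 x = fst s3 x" if "x \<in> {vN, vM, vW, vWW, vS}" for x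
    unfolding s4_def by (rule vframe) (use that in \<open>auto simp: mods\<close>)
  have b1: "fst ?s1 x \<le> ?\<beta> x" if "x \<in> {vM, vR, vN, vNN}" for x
    by (rule bounds_le) (use that in \<open>auto simp: sizes_read\<close>)
  have b2: "fst s2 x \<le> ?\<beta> x" if "x \<in> {vN, vM, vW, vWW}" for x
  proof -
    \<comment> \<open>\<open>bounds_le\<close> asks for all six variables at once, but the values of
      \<open>vR\<close> and \<open>vNN\<close> are not tracked beyond \<open>analyse\<close>;
      setting them to 0 supplies the missing bounds.\<close>
    let ?s = "((fst s2)(vR := 0, vNN := 0), snd s2)"
    have "fst ?s x \<le> ?\<beta> x" by (rule bounds_le) (use that f in auto)
    then show ?thesis using that by auto
  qed
  have b3: "fst s3 x \<le> ?\<beta> x" if "x \<in> {vN, vM, vW, vWW, vS}" for x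
  proof (cases "x = vS")
    case True
    then show ?thesis using S 3(2) by (simp only:)
  next
    case False
    then have "x \<in> {vN, vM, vW, vWW}" using that by blast
    then show ?thesis using b2[of x] f3[of x] by (simp only:)
  qed
  have b4: "fst s4 x \<le> ?\<beta> x" if "x \<in> {vN, vM, vW, vWW, vS}" for x
    unfolding f4[OF that] by (rule b3[OF that])
  \<comment> \<open>\<open>correct_cost\<close> forbids a program to modify its own loop bounds, yet
    \<open>vW\<close>, \<open>vWW\<close> and \<open>vS\<close> are computed before they serve as
    bounds. So the cost is established phase by phase, each in its own start state, and then added
    up.\<close>
  have "correct read_sizes ?s0 (cost read_sizes ?\<beta>)"
    by (rule correct_cost[OF wf(1)]) (simp_all add: bd)
  moreover have "correct analyse ?s1 (cost analyse ?\<beta>)"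
    by (rule correct_cost[OF wf(2)]) (simp add: bd mods, rule b1, simp only: bd)
  moreover have "correct set_strides s2 (cost set_strides ?\<beta>)"
    by (rule correct_cost[OF wf(3)]) (simp add: bd mods, rule b2, unfold bd, blast)
  moreover have "correct fill_table s3 (cost fill_table ?\<beta>)"
    by (rule correct_cost[OF wf(4)]) (simp add: bd mods, rule b3, unfold bd, blast)
  moreover have "correct answer s4 (cost answer ?\<beta>)"
    by (rule correct_cost[OF wf(5)]) (simp add: bd mods, rule b4, unfold bd, blast)
  ultimately have "correct program ?s0 (cost program ?\<beta>)"
    unfolding program_def cost.simps
    by (intro correct_Seq) (simp_all add: sizes_read_def s2_def s3_def s4_def)
  from compile_correct[OF this length_inp] show ?thesis
    using cost_program[of w h] unfolding out computes_within_def by (meson le_trans)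
qed

end

section \<open>Strategies\<close>

lemma is_play_Nil [simp]: "is_play X P []"
  by (simp add: is_play_def)

lemma is_play_snoc: "is_play X P (p @ [v]) \<longleftrightarrow> is_play X P p \<and> v \<in> available X P (set p)"
  unfolding is_play_def by (auto simp: less_Suc_eq nth_append)

lemma follows_snoc:
  "follows q \<sigma> (p @ [v]) \<longleftrightarrow> follows q \<sigma> p \<and> (turn (length p) = q \<longrightarrow> v = \<sigma> p)"
  unfolding follows_def by (auto simp: less_Suc_eq nth_append)

lemma claimed_by_snoc:
  "claimed_by q (p @ [v]) = claimed_by q p \<union> (if turn (length p) = q then {v} else {})"
proof (rule set_eqI)
  fix x
  have "x \<in> claimed_by q (p @ [v]) \<longleftrightarrow> (\<exists>i<Suc (length p). turn i = q \<and> x = (p @ [v]) ! i)"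
    by (auto simp: claimed_by_def)
  also have "\<dots> \<longleftrightarrow> (turn (length p) = q \<and> x = v) \<or> (\<exists>i<length p. turn i = q \<and> x = p ! i)"
    by (simp add: Ex_less_Suc nth_append cong: conj_cong)
  also have "\<dots> \<longleftrightarrow> x \<in> claimed_by q p \<union> (if turn (length p) = q then {v} else {})"
    by (auto simp: claimed_by_def)
  finally show "x \<in> claimed_by q (p @ [v]) \<longleftrightarrow>
    x \<in> claimed_by q p \<union> (if turn (length p) = q then {v} else {})" .
qed

lemma claimed_by_Nil [simp]: "claimed_by q [] = {}"
  by (simp add: claimed_by_def)

lemma card_unclaimed:
  assumes "finite X" "v \<in> available X P C"
  shows "card (X - insert v C) < card (X - C)"
  by (rule psubset_card_mono) (use assms in \<open>auto simp: available_def\<close>)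

context
  fixes X :: "'a set" and F :: "'a set set" and P :: "'a rel"
  assumes finite_X: "finite X"
begin

text \<open>The value of a position by backward induction. From this one predicate a strategy of
  Maker or of Breaker is read off, according to its value at the empty play.\<close>

function maker_won_from :: "'a list \<Rightarrow> bool" where
  "maker_won_from p \<longleftrightarrow>
     (if set p = X then wins_play F Maker p
      else if even (length p) then \<exists>v\<in>available X P (set p). maker_won_from (p @ [v])
      else \<forall>v\<in>available X P (set p). maker_won_from (p @ [v]))"
  by pat_completeness auto
termination
proof (relation "measure (\<lambda>p. card (X - set p))", goal_cases)
  case (2 p v)
  then show ?case
    using card_unclaimed[OF finite_X, of v P "set p"] by simp
next
  case (3 p v)
  then show ?case
    using card_unclaimed[OF finite_X, of v P "set p"] by simp
qed simp

declare maker_won_from.simps [simp del]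

lemma maker_strategy:
  assumes "maker_won_from []"
  shows "has_winning_strategy X F P Maker"
proof -
  define \<sigma> where "\<sigma> p = (SOME v. v \<in> available X P (set p) \<and> maker_won_from (p @ [v]))" for p
  have \<sigma>: "\<sigma> p \<in> available X P (set p) \<and> maker_won_from (p @ [\<sigma> p])"
    if "maker_won_from p" "set p \<noteq> X" "even (length p)" for p
    unfolding \<sigma>_def by (rule someI_ex) (use that in \<open>auto simp: maker_won_from.simps[of p]\<close>)
  have inv: "maker_won_from p" if "is_play X P p" "follows Maker \<sigma> p" for p
    using that
  proof (induction p rule: rev_induct)
    case (snoc v p)
    then have v: "v \<in> available X P (set p)" "set p \<noteq> X" and p: "maker_won_from p"
      by (auto simp: is_play_snoc follows_snoc available_def)
    show ?case
    proof (cases "even (length p)")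
      case True
      then show ?thesis using \<sigma>[OF p v(2)] snoc.prems by (simp add: follows_snoc turn_def)
    next
      case False
      then show ?thesis using p v by (subst (asm) maker_won_from.simps) auto
    qed
  qed (rule assms)
  have "wins_play F Maker p" if "complete_play X P p" "follows Maker \<sigma> p" for p
    using inv[of p] that by (subst (asm) maker_won_from.simps) (auto simp: complete_play_def)
  moreover have "\<sigma> p \<in> available X P (set p)"
    if "is_play X P p" "set p \<noteq> X" "turn (length p) = Maker" "follows Maker \<sigma> p" for p
    using \<sigma>[OF inv] that by (auto simp: turn_def split: if_splits)
  ultimately show ?thesis unfolding has_winning_strategy_def winning_strategy_def by blast
qed

lemma breaker_strategy:
  assumes "\<not> maker_won_from []"
  shows "has_winning_strategy X F P Breaker"
proof -
  define \<sigma> where "\<sigma> p = (SOME v. v \<in> available X P (set p) \<and> \<not> maker_won_from (p @ [v]))" for p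
  have \<sigma>: "\<sigma> p \<in> available X P (set p) \<and> \<not> maker_won_from (p @ [\<sigma> p])"
    if "\<not> maker_won_from p" "set p \<noteq> X" "odd (length p)" for p
    unfolding \<sigma>_def by (rule someI_ex) (use that in \<open>auto simp: maker_won_from.simps[of p]\<close>)
  have inv: "\<not> maker_won_from p" if "is_play X P p" "follows Breaker \<sigma> p" for p
    using that
  proof (induction p rule: rev_induct)
    case (snoc v p)
    then have v: "v \<in> available X P (set p)" "set p \<noteq> X" and p: "\<not> maker_won_from p"
      by (auto simp: is_play_snoc follows_snoc available_def)
    show ?case
    proof (cases "even (length p)")
      case False
      then show ?thesis using \<sigma>[OF p v(2)] snoc.prems by (simp add: follows_snoc turn_def)
    next
      case True
      then show ?thesis using p v by (subst (asm) maker_won_from.simps) auto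
    qed
  qed (rule assms)
  have "wins_play F Breaker p" if "complete_play X P p" "follows Breaker \<sigma> p" for p
    using inv[of p] that
    by (subst (asm) maker_won_from.simps) (auto simp: complete_play_def wins_play_def)
  moreover have "\<sigma> p \<in> available X P (set p)"
    if "is_play X P p" "set p \<noteq> X" "turn (length p) = Breaker" "follows Breaker \<sigma> p" for p
    using \<sigma>[OF inv] that by (auto simp: turn_def split: if_splits)
  ultimately show ?thesis unfolding has_winning_strategy_def winning_strategy_def by blast
qed

end

section \<open>Plays as positions of the chain game\<close>

locale coordinates = chain_game w adj for w adj +
  fixes X :: "'a set" and F :: "'a set set" and P :: "'a rel"
    and H :: "nat \<Rightarrow> nat" and \<phi> :: "'a \<Rightarrow> nat \<times> nat"
  assumes finite_X: "finite X"
    and F: "S \<in> F \<Longrightarrow> S \<subseteq> X \<and> card S \<le> 2"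
    and bij: "bij_betw \<phi> X {(c, k). c < w \<and> k < H c}"
    and P_iff: "u \<in> X \<Longrightarrow> v \<in> X \<Longrightarrow>
      (u, v) \<in> P \<longleftrightarrow> fst (\<phi> u) = fst (\<phi> v) \<and> snd (\<phi> v) \<le> snd (\<phi> u)"
    and adj_iff: "adj x y \<longleftrightarrow> (\<exists>u v. x = \<phi> u \<and> y = \<phi> v \<and> u \<noteq> v \<and> {u, v} \<in> F)"
begin

abbreviation ch :: "'a \<Rightarrow> nat" where "ch x \<equiv> fst (\<phi> x)"
abbreviation ab :: "'a \<Rightarrow> nat" where "ab x \<equiv> snd (\<phi> x)"

lemma coord_range: "x \<in> X \<Longrightarrow> ch x < w \<and> ab x < H (ch x)"
  using bij_betwE[OF bij] by (auto simp: case_prod_beta)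

lemma coord_eq: "x \<in> X \<Longrightarrow> y \<in> X \<Longrightarrow> \<phi> x = \<phi> y \<longleftrightarrow> x = y"
  using bij by (auto simp: bij_betw_def inj_on_def)

lemma coord_surj: "c < w \<Longrightarrow> k < H c \<Longrightarrow> \<exists>x\<in>X. \<phi> x = (c, k)"
  using bij by (auto simp: bij_betw_def set_eq_iff image_iff) metis

text \<open>The claimed vertices form an initial segment of each chain, so the numbers of unclaimed
  vertices determine them.\<close>

definition reached :: "'a list \<Rightarrow> (nat \<Rightarrow> nat) \<Rightarrow> bool" where
  "reached p r \<longleftrightarrow> (\<forall>x\<in>X. x \<in> set p \<longleftrightarrow> r (ch x) \<le> ab x) \<and> (\<forall>c<w. r c \<le> H c) \<and> set p \<subseteq> X"

lemma available_iff:
  assumes "reached p r"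
  shows "v \<in> available X P (set p) \<longleftrightarrow> v \<in> X \<and> r (ch v) = Suc (ab v)"
proof
  assume v: "v \<in> available X P (set p)"
  then have vX: "v \<in> X" "ab v < r (ch v)" using assms by (auto simp: available_def reached_def)
  have "r (ch v) = Suc (ab v)"
  proof (rule ccontr)
    assume "r (ch v) \<noteq> Suc (ab v)"
    then have lt: "Suc (ab v) < r (ch v)" using vX by simp
    moreover have "r (ch v) \<le> H (ch v)" using assms coord_range[OF vX(1)] by (simp add: reached_def)
    ultimately have "r (ch v) - 1 < H (ch v)" by linarith
    then obtain u where u: "u \<in> X" "\<phi> u = (ch v, r (ch v) - 1)"
      using coord_surj[of "ch v" "r (ch v) - 1"] coord_range[OF vX(1)] by auto
    then have "ab u = r (ch v) - 1" by simp
    then have "u \<noteq> v" using lt by auto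
    moreover from u have "(u, v) \<in> P" "u \<notin> set p"
      using P_iff[of u v] vX lt assms by (auto simp: reached_def)
    ultimately show False using v u by (auto simp: available_def)
  qed
  then show "v \<in> X \<and> r (ch v) = Suc (ab v)" using vX by simp
next
  assume v: "v \<in> X \<and> r (ch v) = Suc (ab v)"
  then have "v \<notin> set p" using assms by (auto simp: reached_def)
  moreover have "u \<in> set p" if "u \<in> X" "(u, v) \<in> P" "u \<noteq> v" for u
  proof -
    have "ch u = ch v" "ab v \<le> ab u" using P_iff that v by auto
    moreover have "ab u \<noteq> ab v" using coord_eq[of u v] that v calculation by (metis prod_eqI)
    ultimately show ?thesis using assms that v by (auto simp: reached_def)
  qed
  ultimately show "v \<in> available X P (set p)" using v by (auto simp: available_def)
qed

lemma reached_snoc: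
  assumes "reached p r" "v \<in> available X P (set p)"
  shows "reached (p @ [v]) (lower r (ch v))"
proof -
  have v: "v \<in> X" "r (ch v) = Suc (ab v)" using assms available_iff by auto
  have "x \<in> set (p @ [v]) \<longleftrightarrow> lower r (ch v) (ch x) \<le> ab x" if x: "x \<in> X" for x
  proof (cases "ch x = ch v")
    case True
    then have "x = v \<longleftrightarrow> ab x = ab v" using coord_eq[OF x v(1)] by (metis prod_eqI)
    then show ?thesis
      using True assms(1) x v by (auto simp: reached_def lower_apply)
  next
    case False
    then show ?thesis using assms(1) x by (auto simp: reached_def lower_apply)
  qed
  then show ?thesis using assms(1) v by (auto simp: reached_def lower_apply le_diff_conv)
qed

lemma open_iff:
  assumes "reached p r"
  shows "c \<in> open_chains (\<lambda>_. 0) r \<longleftrightarrow> (\<exists>v\<in>available X P (set p). \<phi> v = (c, r c - 1))"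
proof
  assume "c \<in> open_chains (\<lambda>_. 0) r"
  then have c: "c < w" "0 < r c" by (auto simp: open_chains_def)
  then have "r c \<le> H c" using assms by (simp add: reached_def)
  then have "r c - 1 < H c" using c by linarith
  then obtain v where v: "v \<in> X" "\<phi> v = (c, r c - 1)" using coord_surj[of c "r c - 1"] c by auto
  then have "v \<in> available X P (set p)" using available_iff[OF assms] c by simp
  then show "\<exists>v\<in>available X P (set p). \<phi> v = (c, r c - 1)" using v by blast
next
  assume "\<exists>v\<in>available X P (set p). \<phi> v = (c, r c - 1)"
  then show "c \<in> open_chains (\<lambda>_. 0) r"
    using available_iff[OF assms] coord_range by (fastforce simp: open_chains_def)
qed

lemma finished_iff:
  assumes "reached p r"
  shows "set p = X \<longleftrightarrow> open_chains (\<lambda>_. 0) r = {}"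
proof
  assume "set p = X"
  then have "available X P (set p) = {}" by (auto simp: available_def)
  then show "open_chains (\<lambda>_. 0) r = {}" using open_iff[OF assms] by auto
next
  assume "open_chains (\<lambda>_. 0) r = {}"
  then have "r (ch x) = 0" if "x \<in> X" for x
    using coord_range[OF that] by (auto simp: open_chains_def)
  then show "set p = X" using assms by (auto simp: reached_def)
qed

lemma open_available:
  assumes re: "reached p r"
    and eq: "\<And>c v. v \<in> available X P (set p) \<Longrightarrow> \<phi> v = (c, r c - 1) \<Longrightarrow> R v \<longleftrightarrow> R' c"
  shows "(\<exists>v\<in>available X P (set p). R v) \<longleftrightarrow> (\<exists>c\<in>open_chains (\<lambda>_. 0) r. R' c)"
proof
  assume "\<exists>v\<in>available X P (set p). R v"
  then obtain v where v: "v \<in> available X P (set p)" "R v" by blast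
  have e: "\<phi> v = (ch v, r (ch v) - 1)"
    using available_iff[OF re, of v] v(1) by (simp add: prod_eq_iff)
  then show "\<exists>c\<in>open_chains (\<lambda>_. 0) r. R' c" using open_iff[OF re, of "ch v"] v eq[OF v(1) e] by blast
next
  assume "\<exists>c\<in>open_chains (\<lambda>_. 0) r. R' c"
  then obtain c where c: "c \<in> open_chains (\<lambda>_. 0) r" "R' c" by blast
  then obtain v where "v \<in> available X P (set p)" "\<phi> v = (c, r c - 1)" using open_iff[OF re] by blast
  then show "\<exists>v\<in>available X P (set p). R v" using eq c(2) by blast
qed

abbreviation won :: "'a list \<Rightarrow> bool" where
  "won \<equiv> maker_won_from X F P"

lemmas won_iff = maker_won_from.simps[OF finite_X]

text \<open>A play goes on until the board is full, whereas \<open>V\<close> stops as soon as Maker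
  claims a mark; this bridges the difference. An unfinished position always has a legal move, so
  Maker's existential choice is never empty.\<close>

lemma won_stays_won:
  assumes "reached p r" "S \<in> F" "S \<subseteq> claimed_by Maker p"
  shows "won p"
  using assms(1,3)
proof (induction "card (X - set p)" arbitrary: p r rule: less_induct)
  case less
  show ?case
  proof (cases "set p = X")
    case True
    then show ?thesis using less.prems assms(2) by (subst won_iff) (auto simp: wins_play_def)
  next
    case False
    have "won (p @ [v])" if v: "v \<in> available X P (set p)" for v
    proof (rule less.hyps[OF _ reached_snoc[OF less.prems(1) v]])
      show "card (X - set (p @ [v])) < card (X - set p)"
        using card_unclaimed[OF finite_X v] by simp
      show "S \<subseteq> claimed_by Maker (p @ [v])" using less.prems(2) by (auto simp: claimed_by_snoc)
    qed
    moreover obtain c where "c \<in> open_chains (\<lambda>_. 0) r"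
      using False finished_iff[OF less.prems(1)] by auto
    then obtain v where "v \<in> available X P (set p)" using open_iff[OF less.prems(1)] by blast
    ultimately show ?thesis using False by (subst won_iff) auto
  qed
qed

definition threats :: "'a set \<Rightarrow> 'a \<Rightarrow> bool" where
  "threats M x \<longleftrightarrow> (\<exists>S\<in>F. x \<in> S \<and> S - {x} \<subseteq> M)"

text \<open>Only marks on unclaimed vertices have to be threats. Breaker's moves leave the threats
  on unclaimed vertices unchanged, because a threat consists of Maker's vertices apart from its
  target; and as winning sets have at most two elements, a move \<open>v\<close> of Maker adds
  exactly the threats at those \<open>x\<close> with \<open>{v, x} \<in> F\<close>.\<close>

lemma won_iff_V0:
  assumes "reached p r" "even (length p)"
    and "\<And>x. x \<in> X \<Longrightarrow> x \<notin> set p \<Longrightarrow> \<phi> x \<in> K \<longleftrightarrow> threats (claimed_by Maker p) x"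
    and "\<not> (\<exists>S\<in>F. S \<subseteq> claimed_by Maker p)"
  shows "won p \<longleftrightarrow> V0 r K"
  using assms
proof (induction "card (X - set p)" arbitrary: p r K rule: less_induct)
  case less
  let ?M = "claimed_by Maker p" and ?o = "open_chains (\<lambda>_. 0)"
  note re = less.prems(1)
  have V0: "V0 r K \<longleftrightarrow> (\<exists>c\<in>?o r. (c, r c - 1) \<in> K \<or>
        VB0 (lower r c) (K \<union> Collect (adj (c, r c - 1))))"
    by (subst V_iff) simp
  show ?case
  proof (cases "set p = X")
    case True
    then have "?o r = {}" using finished_iff[OF re] by simp
    then have "\<not> V0 r K" unfolding V0 by simp
    moreover have "\<not> won p" using True less.prems(4) by (subst won_iff) (simp add: wins_play_def)
    ultimately show ?thesis by simp
  next
    case False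
    have step: "won (p @ [v]) \<longleftrightarrow> \<phi> v \<in> K \<or> VB0 (lower r c) (K \<union> Collect (adj (\<phi> v)))"
      if v: "v \<in> available X P (set p)" "\<phi> v = (c, r c - 1)" for c v
    proof -
      have vX: "v \<in> X" "v \<notin> set p" using v by (auto simp: available_def)
      have re1: "reached (p @ [v]) (lower r c)" using reached_snoc[OF re v(1)] v(2) by simp
      have M1: "claimed_by Maker (p @ [v]) = insert v ?M"
        using less.prems(2) by (simp add: claimed_by_snoc turn_def)
      show ?thesis
      proof (cases "\<phi> v \<in> K")
        case True
        then obtain S where "S \<in> F" "S - {v} \<subseteq> ?M" using less.prems(3)[OF vX] by (auto simp: threats_def)
        then have "won (p @ [v])" by (intro won_stays_won[OF re1, of S]) (auto simp: M1)
        then show ?thesis using True by simp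
      next
        case nK: False
        have nw: "\<not> (\<exists>S\<in>F. S \<subseteq> insert v ?M)"
        proof
          assume "\<exists>S\<in>F. S \<subseteq> insert v ?M"
          then obtain S where S: "S \<in> F" "S \<subseteq> insert v ?M" by blast
          then have "v \<in> S" using less.prems(4) by blast
          then have "threats ?M v" using S by (auto simp: threats_def)
          then show False using nK less.prems(3)[OF vX] by simp
        qed
        show ?thesis
        proof (cases "set (p @ [v]) = X")
          case True
          \<comment> \<open>Maker has made the last move without completing a set: here the
            nonemptiness condition in \<open>VB\<close> decides.\<close>
          then have "\<not> won (p @ [v])" using nw by (subst won_iff) (simp add: wins_play_def M1)
          moreover have "?o (lower r c) = {}" using finished_iff[OF re1] True by simp
          ultimately show ?thesis using nK by (simp add: VB_def)
        next
          case nf: False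
          let ?K = "K \<union> Collect (adj (\<phi> v))"
          have IH: "won ((p @ [v]) @ [b]) \<longleftrightarrow> V0 (lower (lower r c) d) ?K"
            if b: "b \<in> available X P (set (p @ [v]))" "\<phi> b = (d, lower r c d - 1)" for b d
          proof (rule less.hyps)
            have "b \<in> X" "b \<notin> set p" using b by (auto simp: available_def)
            then show "card (X - set ((p @ [v]) @ [b])) < card (X - set p)"
              using finite_X by (auto intro!: psubset_card_mono)
            show "reached ((p @ [v]) @ [b]) (lower (lower r c) d)"
              using reached_snoc[OF re1 b(1)] b(2) by simp
            show "even (length ((p @ [v]) @ [b]))" using less.prems(2) by simp
            have M2: "claimed_by Maker ((p @ [v]) @ [b]) = insert v ?M"
              using less.prems(2) by (simp only: claimed_by_snoc[of _ "p @ [v]"] M1) (simp add: turn_def)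
            show "\<not> (\<exists>S\<in>F. S \<subseteq> claimed_by Maker ((p @ [v]) @ [b]))" using nw M2 by simp
            fix x assume x: "x \<in> X" "x \<notin> set ((p @ [v]) @ [b])"
            then have xv: "x \<noteq> v" "x \<notin> set p" by auto
            have adj: "adj (\<phi> v) (\<phi> x) \<longleftrightarrow> {v, x} \<in> F"
            proof
              assume "adj (\<phi> v) (\<phi> x)"
              then obtain u y where u: "\<phi> v = \<phi> u" "\<phi> x = \<phi> y" "{u, y} \<in> F" by (auto simp: adj_iff)
              then have "u = v" "y = x" using F coord_eq[OF vX(1)] coord_eq[OF x(1)] by auto
              then show "{v, x} \<in> F" using u by simp
            qed (use xv in \<open>auto simp: adj_iff\<close>)
            have "threats (insert v ?M) x \<longleftrightarrow> threats ?M x \<or> {v, x} \<in> F"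
            proof
              assume "threats (insert v ?M) x"
              then obtain S where S: "S \<in> F" "x \<in> S" "S - {x} \<subseteq> insert v ?M" by (auto simp: threats_def)
              show "threats ?M x \<or> {v, x} \<in> F"
              proof (cases "v \<in> S")
                case True
                have "finite S" using F[OF S(1)] finite_X finite_subset by blast
                then have "S = {v, x}"
                  using True S(2) xv(1) F[OF S(1)] card_seteq[of S "{v, x}"] by auto
                then show ?thesis using S(1) by simp
              next
                case False
                then have "threats ?M x" using S by (auto simp: threats_def)
                then show ?thesis by simp
              qed
            qed (auto simp: threats_def)
            then show "\<phi> x \<in> ?K \<longleftrightarrow> threats (claimed_by Maker ((p @ [v]) @ [b])) x"
              unfolding M2 using less.prems(3)[OF x(1) xv(2)] adj by simp
          qed
          have "won (p @ [v]) \<longleftrightarrow> \<not> (\<exists>b\<in>available X P (set (p @ [v])). \<not> won ((p @ [v]) @ [b]))"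
            using nf less.prems(2) by (subst won_iff) auto
          also have "\<dots> \<longleftrightarrow> \<not> (\<exists>d\<in>?o (lower r c). \<not> V0 (lower (lower r c) d) ?K)"
            by (intro arg_cong[where f = Not] open_available[OF re1]) (simp only: IH)
          also have "\<dots> \<longleftrightarrow> VB0 (lower r c) ?K"
            using nf finished_iff[OF re1] by (auto simp: VB_def)
          finally show ?thesis using nK by simp
        qed
      qed
    qed
    have "won p \<longleftrightarrow> (\<exists>v\<in>available X P (set p). won (p @ [v]))"
      using False less.prems(2) by (subst won_iff) simp
    also have "\<dots> \<longleftrightarrow> V0 r K"
      unfolding V0
    proof (rule open_available[OF re])
      fix c v assume "v \<in> available X P (set p)" "\<phi> v = (c, r c - 1)"
      then show "won (p @ [v]) \<longleftrightarrow>
        (c, r c - 1) \<in> K \<or> VB0 (lower r c) (K \<union> Collect (adj (c, r c - 1)))"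
        using step by metis
    qed
    finally show ?thesis .
  qed
qed

theorem won_Nil: "won [] \<longleftrightarrow> {} \<in> F \<or> V0 H {\<phi> x | x. {x} \<in> F}"
proof -
  have re: "reached [] H" using coord_range by (auto simp: reached_def not_le)
  show ?thesis
  proof (cases "{} \<in> F")
    case True
    then show ?thesis using won_stays_won[OF re, of "{}"] by simp
  next
    case False
    have "won [] \<longleftrightarrow> V0 H {\<phi> x | x. {x} \<in> F}"
    proof (rule won_iff_V0[OF re])
      fix x assume x: "x \<in> X"
      have "threats {} x \<longleftrightarrow> {x} \<in> F"
        by (auto simp: threats_def) (metis subset_singletonD empty_iff)
      moreover have "\<phi> x \<in> {\<phi> x | x. {x} \<in> F} \<longleftrightarrow> {x} \<in> F" using F coord_eq[OF x] by fastforce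
      ultimately show "\<phi> x \<in> {\<phi> x | x. {x} \<in> F} \<longleftrightarrow> threats (claimed_by Maker []) x" by simp
    qed (use False in auto)
    then show ?thesis using False by simp
  qed
qed

end

section \<open>Transfer between the game on vertices and its encoding by indices\<close>

theorem theorem8:
  shows "\<exists>(prog :: instr list) (T :: nat \<Rightarrow> nat \<Rightarrow> nat).
    (\<forall>w. (\<lambda>h. real (T w h)) \<in> O(\<lambda>h. real h ^ (2 * (w + 1)))) \<and>
    (\<forall>w h (X :: nat set) F P inp.
       poset_game X F P \<and> disjoint_chains w h X P \<and> (\<forall>S\<in>F. card S \<le> 2) \<and>
       encodes_game inp X F P \<longrightarrow>
       (\<exists>q. has_winning_strategy X F P q \<and> computes_within prog inp (player_code q) (T w h)))"
proof (intro exI[of _ "prelude @ comp program 10"] exI[of _ time_bound] conjI allI impI)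
  show "(\<lambda>h. real (time_bound w h)) \<in> O(\<lambda>h. real h ^ (2 * (w + 1)))" for w
    by (rule time_bound_bigo)
  fix w h :: nat and X :: "nat set" and F P inp
  assume asm: "poset_game X F P \<and> disjoint_chains w h X P \<and> (\<forall>S\<in>F. card S \<le> 2) \<and>
       encodes_game inp X F P"
  then have finite_X: "finite X" and FX: "F \<subseteq> Pow X" and po: "partial_order_on X P"
    and F2: "\<forall>S\<in>F. card S \<le> 2" by (auto simp: poset_game_def)
  obtain \<C> where \<C>: "partition_on X \<C>" "finite \<C>" "card \<C> = w"
    "\<forall>C\<in>\<C>. total_on C P \<and> card C \<le> h"
    "\<forall>C\<in>\<C>. \<forall>D\<in>\<C>. C \<noteq> D \<longrightarrow> (\<forall>u\<in>C. \<forall>v\<in>D. (u, v) \<notin> P)"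
    using asm unfolding disjoint_chains_def by blast
  obtain vs Fs Ps where vs: "distinct vs" "set vs = X"
    and Fs: "\<forall>S\<in>set Fs. distinct S \<and> set S \<subseteq> {..<length vs}" "distinct (map set Fs)"
      "F = (\<lambda>S. (!) vs ` set S) ` set Fs"
    and Ps: "distinct Ps" "set Ps \<subseteq> {..<length vs} \<times> {..<length vs}"
      "P = map_prod ((!) vs) ((!) vs) ` set Ps"
    and inp: "inp = [length vs, length Fs, length Ps] @ concat (map (\<lambda>S. length S # S) Fs)
              @ concat (map (\<lambda>(i, j). [i, j]) Ps)"
    using asm unfolding encodes_game_def by blast
  define n where "n = length vs"
  have vs_inj: "vs ! i = vs ! j \<longleftrightarrow> i = j" if "i < n" "j < n" for i j
    using that vs(1) by (simp add: n_def nth_eq_iff_index_eq)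
  have vs_X: "vs ! i \<in> X" if "i < n" for i using that vs(2) by (auto simp: n_def)
  have P_vs: "(vs ! i, vs ! j) \<in> P \<longleftrightarrow> (i, j) \<in> set Ps" if "i < n" "j < n" for i j
  proof
    assume "(vs ! i, vs ! j) \<in> P"
    then obtain a b where ab: "(a, b) \<in> set Ps" "vs ! i = vs ! a" "vs ! j = vs ! b"
      unfolding Ps(3) by auto
    then have "a < n" "b < n" using Ps(2) by (auto simp: n_def)
    then show "(i, j) \<in> set Ps" using ab vs_inj that by auto
  qed (force simp: Ps(3))
  \<comment> \<open>The chain of a vertex in the given partition supplies the labelling
    \<open>\<kappa>\<close>. It enters the analysis only; the program finds the chains by
    itself.\<close>
  define block where "block x = (THE C. C \<in> \<C> \<and> x \<in> C)" for x
  have block: "block x \<in> \<C> \<and> x \<in> block x" if "x \<in> X" for x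
  proof -
    obtain C where C: "C \<in> \<C>" "x \<in> C" using \<C>(1) \<open>x \<in> X\<close> by (auto simp: partition_on_def)
    have uniq: "D = C" if "D \<in> \<C>" "x \<in> D" for D
      using disjointD[OF partition_onD2[OF \<C>(1)], of D C] C that by blast
    have "block x = C" unfolding block_def using C uniq by (intro the_equality) blast+
    then show ?thesis using C by simp
  qed
  have blockI: "block x = C" if "C \<in> \<C>" "x \<in> C" for x C
  proof -
    have "x \<in> X" using \<C>(1) that by (auto simp: partition_on_def)
    then show ?thesis
      using disjointD[OF partition_onD2[OF \<C>(1)], of "block x" C] block[of x] that by blast
  qed
  define \<kappa> where "\<kappa> i = block (vs ! i)" for i
  have img: "(!) vs ` {..<n} = X" using vs(2) by (auto simp: n_def in_set_conv_nth)
  \<comment> \<open>The size bound concerns sets of vertices. As \<open>vs\<close> is injective on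
    indices and the encoding lists have no repetitions, it carries over to the lengths of the
    lists.\<close>
  have len2: "length S \<le> 2" if "S \<in> set Fs" for S
  proof -
    have S: "distinct S" "set S \<subseteq> {..<n}" using Fs(1) that by (auto simp: n_def)
    have "inj_on ((!) vs) (set S)" using S(2) vs_inj by (auto simp: inj_on_def subset_iff)
    then have "card ((!) vs ` set S) = length S" using S(1) by (simp add: card_image distinct_card)
    then show ?thesis using F2 Fs(3) that by force
  qed
  have poD: "refl_on X P" "trans P" "antisym P"
    using po by (simp_all add: partial_order_on_def preorder_on_def)
  interpret E: encoded_game n Ps \<kappa> Fs inp w h
  proof
    show "set Ps \<subseteq> {..<n} \<times> {..<n}" using Ps(2) by (simp add: n_def)
    then have lt: "u < n" "v < n" if "(u, v) \<in> set Ps" for u v using that by auto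
    show "(v, v) \<in> set Ps" if "v < n" for v
      using P_vs[OF that that] poD(1) vs_X[OF that] by (auto dest: refl_onD)
    show "u = v" if "(u, v) \<in> set Ps" "(v, u) \<in> set Ps" for u v
      using that lt[OF that(1)] P_vs vs_inj poD(3) by (metis antisymD)
    show "(u, x) \<in> set Ps" if "(u, v) \<in> set Ps" "(v, x) \<in> set Ps" for u v x
      using that lt[OF that(1)] lt[OF that(2)] P_vs poD(2) by (metis transD)
    show "\<kappa> u = \<kappa> v" if "(u, v) \<in> set Ps" for u v
      unfolding \<kappa>_def
      using that lt[OF that] P_vs[of u v] block[OF vs_X[of u]] block[OF vs_X[of v]] \<C>(5) by blast
    show "(u, v) \<in> set Ps \<or> (v, u) \<in> set Ps" if uv: "u < n" "v < n" "\<kappa> u = \<kappa> v" for u v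
    proof (cases "u = v")
      case True
      then show ?thesis using P_vs[OF uv(1,1)] poD(1) vs_X[OF uv(1)] by (auto dest: refl_onD)
    next
      case False
      have "total_on (\<kappa> u) P" "vs ! u \<in> \<kappa> u" "vs ! v \<in> \<kappa> u"
        using block[OF vs_X[OF uv(1)]] block[OF vs_X[OF uv(2)]] \<C>(4) uv(3) by (auto simp: \<kappa>_def)
      then have "(vs ! u, vs ! v) \<in> P \<or> (vs ! v, vs ! u) \<in> P"
        using False vs_inj uv unfolding total_on_def by auto
      then show ?thesis using P_vs uv by auto
    qed
    show "distinct S \<and> set S \<subseteq> {..<n} \<and> length S \<le> 2" if "S \<in> set Fs" for S
      using that Fs(1) len2 by (auto simp: n_def)
    have "\<kappa> ` {..<n} = block ` X" unfolding \<kappa>_def img[symmetric] by (simp add: image_image)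
    also have "\<dots> = \<C>"
    proof (intro equalityI subsetI)
      fix C assume C: "C \<in> \<C>"
      then obtain x where x: "x \<in> C" using \<C>(1) by (auto simp: partition_on_def) (metis ex_in_conv)
      then have "x \<in> X" using \<C>(1) C by (auto simp: partition_on_def)
      then show "C \<in> block ` X" using blockI[OF C x] by blast
    qed (use block in auto)
    finally show "card (\<kappa> ` {..<n}) = w" using \<C>(3) by simp
    show "card {u. u < n \<and> \<kappa> u = \<kappa> v} \<le> h" if v: "v < n" for v
    proof -
      have "(!) vs ` {u. u < n \<and> \<kappa> u = \<kappa> v} \<subseteq> \<kappa> v"
        using block vs_X by (auto simp: \<kappa>_def)
      moreover have \<kappa>v: "\<kappa> v \<in> \<C>" using block[OF vs_X[OF v]] by (simp add: \<kappa>_def)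
      moreover have "finite (\<kappa> v)"
        using \<kappa>v \<C>(1) finite_X by (auto simp: partition_on_def intro: finite_subset[of _ X])
      ultimately have "card ((!) vs ` {u. u < n \<and> \<kappa> u = \<kappa> v}) \<le> h"
        using \<C>(4) card_mono by (metis le_trans)
      moreover have "inj_on ((!) vs) {u. u < n \<and> \<kappa> u = \<kappa> v}" using vs_inj by (auto simp: inj_on_def)
      ultimately show ?thesis by (simp add: card_image)
    qed
  qed (use Ps Fs inp in \<open>auto simp: n_def\<close>)
  \<comment> \<open>\<open>\<iota>\<close> inverts the enumeration of the board, so that
    \<open>\<phi>\<close> gives each vertex the coordinates of its index.\<close>
  define \<iota> where "\<iota> = the_inv_into {..<n} ((!) vs)"
  have inj: "inj_on ((!) vs) {..<n}" using vs_inj by (auto simp: inj_on_def)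
  have \<iota>_vs: "\<iota> (vs ! i) = i" if "i < n" for i
    unfolding \<iota>_def using the_inv_into_f_f[OF inj] that by simp
  have vs_\<iota>: "\<iota> x < n" "vs ! \<iota> x = x" if "x \<in> X" for x
    using that \<iota>_vs img by (force, force)
  define \<phi> where "\<phi> x = E.coord (\<iota> x)" for x
  have F_iff: "(\<lambda>i. vs ! i) ` S \<in> F \<longleftrightarrow> S \<in> set ` set Fs" if "S \<subseteq> {..<n}" for S
  proof
    assume "(!) vs ` S \<in> F"
    then obtain T where T: "T \<in> set Fs" "(!) vs ` S = (!) vs ` set T" unfolding Fs(3) by auto
    then have "S = set T" using inj_on_image_eq_iff[OF inj that] Fs(1) by (simp add: n_def)
    then show "S \<in> set ` set Fs" using T by blast
  qed (auto simp: Fs(3))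
  have adj: "E.set_adj x y \<longleftrightarrow> (\<exists>u v. x = \<phi> u \<and> y = \<phi> v \<and> u \<noteq> v \<and> {u, v} \<in> F)" for x y
  proof
    assume "E.set_adj x y"
    then obtain S where S: "S \<in> set Fs" "length S = 2"
      "x = E.coord (S ! 0) \<and> y = E.coord (S ! 1) \<or> x = E.coord (S ! 1) \<and> y = E.coord (S ! 0)"
      unfolding E.set_adj_def by blast
    obtain a b where ab: "S = [a, b]" using S(2) by (auto simp: length_Suc_conv numeral_2_eq_2)
    have lt: "a < n" "b < n" "a \<noteq> b" using Fs(1) S(1) ab by (auto simp: n_def)
    have "(!) vs ` set S \<in> F" using S(1) Fs(3) by blast
    then have "{vs ! a, vs ! b} \<in> F" "{vs ! b, vs ! a} \<in> F" using ab by (auto simp: insert_commute)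
    moreover have "vs ! a \<noteq> vs ! b" using vs_inj lt by simp
    moreover have "E.coord a = \<phi> (vs ! a)" "E.coord b = \<phi> (vs ! b)" using \<iota>_vs lt by (auto simp: \<phi>_def)
    ultimately show "\<exists>u v. x = \<phi> u \<and> y = \<phi> v \<and> u \<noteq> v \<and> {u, v} \<in> F"
      using S(3) ab by auto metis+
  next
    assume "\<exists>u v. x = \<phi> u \<and> y = \<phi> v \<and> u \<noteq> v \<and> {u, v} \<in> F"
    then obtain u v where uv: "x = \<phi> u" "y = \<phi> v" "u \<noteq> v" "{u, v} \<in> F" by blast
    have X: "u \<in> X" "v \<in> X" using uv FX by auto
    have "(!) vs ` {\<iota> u, \<iota> v} \<in> F" using uv vs_\<iota> X by simp
    then obtain S where S: "S \<in> set Fs" "{\<iota> u, \<iota> v} = set S"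
      using F_iff[of "{\<iota> u, \<iota> v}"] vs_\<iota> X by auto
    have ne: "\<iota> u \<noteq> \<iota> v" using uv vs_\<iota> X by metis
    have "distinct S" using S Fs(1) by auto
    then have "length S = 2" using S(2) ne distinct_card[of S] by (metis card_2_iff)
    then obtain a b where ab: "S = [a, b]" by (auto simp: length_Suc_conv numeral_2_eq_2)
    have "\<iota> u = a \<and> \<iota> v = b \<or> \<iota> u = b \<and> \<iota> v = a" using S(2) ab ne by (auto simp: doubleton_eq_iff)
    then show "E.set_adj x y"
      unfolding E.set_adj_def using S(1) ab uv by (auto simp: \<phi>_def intro!: bexI[of _ S])
  qed
  interpret G: chain_game E.width E.set_adj
  proof
    fix x y
    show "E.set_adj x y \<Longrightarrow> E.set_adj y x" by (auto simp: E.set_adj_def)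
    show "\<not> E.set_adj x x"
    proof
      assume "E.set_adj x x"
      then obtain u v where uv: "\<phi> u = \<phi> v" "u \<noteq> v" "{u, v} \<in> F" by (auto simp: adj)
      then have X: "u \<in> X" "v \<in> X" using FX by auto
      have "\<iota> u = \<iota> v"
        using uv(1) E.above_inj[of "\<iota> u" "\<iota> v"] E.chain_eq_iff[of "\<iota> u" "\<iota> v"] vs_\<iota> X
        by (auto simp: \<phi>_def)
      then show False using uv vs_\<iota> X by metis
    qed
  qed
  interpret C: coordinates E.width E.set_adj X F P E.height \<phi>
  proof
    show "finite X" by fact
    show "S \<subseteq> X \<and> card S \<le> 2" if "S \<in> F" for S using that FX F2 by auto
    show "E.set_adj x y \<longleftrightarrow> (\<exists>u v. x = \<phi> u \<and> y = \<phi> v \<and> u \<noteq> v \<and> {u, v} \<in> F)" for x y by (rule adj)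
    show "(u, v) \<in> P \<longleftrightarrow> fst (\<phi> u) = fst (\<phi> v) \<and> snd (\<phi> v) \<le> snd (\<phi> u)"
      if "u \<in> X" "v \<in> X" for u v
      using P_vs[of "\<iota> u" "\<iota> v"] E.le_iff[of "\<iota> u" "\<iota> v"] E.chain_eq_iff[of "\<iota> u" "\<iota> v"] vs_\<iota> that
      by (simp add: \<phi>_def)
    show "bij_betw \<phi> X {(c, k). c < E.width \<and> k < E.height c}"
    proof (rule bij_betw_imageI)
      show "inj_on \<phi> X"
      proof
        fix u v assume uv: "u \<in> X" "v \<in> X" "\<phi> u = \<phi> v"
        then have "\<iota> u = \<iota> v"
          using E.above_inj[of "\<iota> u" "\<iota> v"] E.chain_eq_iff[of "\<iota> u" "\<iota> v"] vs_\<iota>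
          by (auto simp: \<phi>_def)
        then show "u = v" using uv vs_\<iota> by metis
      qed
      show "\<phi> ` X = {(c, k). c < E.width \<and> k < E.height c}"
      proof (intro equalityI subsetI)
        fix x assume "x \<in> \<phi> ` X"
        then show "x \<in> {(c, k). c < E.width \<and> k < E.height c}"
          using E.chain_less E.above_less_height vs_\<iota> by (auto simp: \<phi>_def)
      next
        fix x assume "x \<in> {(c, k). c < E.width \<and> k < E.height c}"
        then obtain v where "v < n" "x = E.coord v" using E.above_surj by (cases x) auto
        then have "x = \<phi> (vs ! v)" "vs ! v \<in> X" using \<iota>_vs vs_X by (auto simp: \<phi>_def)
        then show "x \<in> \<phi> ` X" by blast
      qed
    qed
  qed
  have "{} \<in> F \<longleftrightarrow> [] \<in> set Fs" unfolding Fs(3) by auto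
  moreover have "{\<phi> x | x. {x} \<in> F} = E.start_marks"
  proof (intro equalityI subsetI)
    fix y assume "y \<in> {\<phi> x | x. {x} \<in> F}"
    then obtain x where x: "y = \<phi> x" "{x} \<in> F" by blast
    then have "x \<in> X" using FX by auto
    then have "{\<iota> x} \<in> set ` set Fs" using F_iff[of "{\<iota> x}"] x(2) vs_\<iota> by simp
    then obtain S where S: "S \<in> set Fs" "{\<iota> x} = set S" by auto
    then have "distinct S" using Fs(1) by auto
    then have "length S = 1" using S(2) distinct_card[of S] by (metis card_1_singleton_iff One_nat_def)
    then obtain a where "S = [a]" by (auto simp: length_Suc_conv)
    then show "y \<in> E.start_marks" using S x(1)
      by (auto simp: E.start_marks_def \<phi>_def intro!: exI[of _ S])
  next
    fix y assume "y \<in> E.start_marks"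
    then obtain S where S: "S \<in> set Fs" "length S = 1" "y = E.coord (S ! 0)"
      by (auto simp: E.start_marks_def)
    then obtain a where a: "S = [a]" by (auto simp: length_Suc_conv)
    have "a < n" using Fs(1) S(1) a by (auto simp: n_def)
    moreover have "(!) vs ` set S \<in> F" using S(1) Fs(3) by blast
    ultimately have "{vs ! a} \<in> F" "y = \<phi> (vs ! a)" using a S(3) \<iota>_vs by (auto simp: \<phi>_def)
    then show "y \<in> {\<phi> x | x. {x} \<in> F}" by blast
  qed
  ultimately have wins: "maker_won_from X F P [] \<longleftrightarrow> E.maker_wins"
    unfolding C.won_Nil E.maker_wins_def by simp
  note correct = E.program_correct
  show "\<exists>q. has_winning_strategy X F P q \<and>
    computes_within (prelude @ comp program 10) inp (player_code q) (time_bound w h)"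
  proof (cases E.maker_wins)
    case True
    then have "has_winning_strategy X F P Maker" using wins maker_strategy[OF finite_X] by blast
    then show ?thesis using correct True by (intro exI[of _ Maker]) simp
  next
    case False
    then have "has_winning_strategy X F P Breaker" using wins breaker_strategy[OF finite_X] by blast
    then show ?thesis using correct False by (intro exI[of _ Breaker]) simp
  qed
qed

end
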